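(* Let $u$ be the bounded solution of the parabolic initial-boundary value problem (P) described in the context, and for $k\ge 1$ and $l\in\{1,\dots,I\}$ let $u_l^k$ be the $k$-th iterate in the subdomain $\Omega_l$ of the Optimized Schwarz Waveform Relaxation algorithm with Robin parameter $p\in\mathbb{R}$ and initial guess $h^0$, as described in the context. Then there is a constant $\Lambda$ such that for every strictly positive function $\varphi\in C^1(\mathbb{R})$ with $$-\max_{s\in\mathbb{R}}\left(\frac{\varphi'(s)}{\varphi(s)}\right)\ \ge\ \Lambda$$ one has $$\lim_{k\to\infty}\ \max_{l\in\{1,\dots,I\}}\left\Vert\left(\frac{\partial (u_l^k-u)}{\partial x_n}\,\exp(p x_n)\right)^2\varphi(t)\right\Vert_{C(\overline{\Omega_l\times(0,T)})}=0 .$$ Moreover, for every $l\in\{1,\dots,I\}$, the sequence $\{u_l^k-u\}_k$ converges pointwise to $0$ as $k\to\infty$.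
   Context: **Domain.** Let $T>0$ and $\Omega=D\times(\alpha,\beta)\subset\mathbb{R}^n$, where $D$ is a bounded, smooth enough domain in $\mathbb{R}^{n-1}$. Points of $\mathbb{R}^n$ are written $x=(X,x_n)$ with $X\in\mathbb{R}^{n-1}$, $x_n\in\mathbb{R}$. The notation $v(\cdot,s,\cdot)$ denotes the restriction of $v(X,x_n,t)$ to $x_n=s$. The norm $\Vert\cdot\Vert_{C(\overline{\Omega_l\times(0,T)})}$ is the supremum norm. **Problem (P).** $$\frac{\partial u}{\partial t}-\sum_{i,j=1}^n a_{i,j}(t)\frac{\partial^2 u}{\partial x_i\partial x_j}+\sum_{i=1}^n b_i(t)\frac{\partial u}{\partial x_i}+c(t)u=f(t,x)\quad\text{in }\Omega\times(0,T),$$ $$u(x,t)=g(x,t)\ \text{ on }\partial\Omega\times(0,T),\qquad u(x,0)=g(x,0)\ \text{ on }\Omega .$$ **Assumptions on the data.** - (A1) $a_{i,j}(t)=a_{j,i}(t)$ for all $i,j\in\{1,\dots,n\}$, and there exists $\nu_0>0$ such that $A(t)=(a_{i,j}(t))\ge\nu_0\,\mathrm{Id}$ for all $t\in(0,T)$ in the sense of symmetric positive definite matrices. - (A2) $a_{i,j},b_i,c$ are bounded functions in $C^\infty(\mathbb{R})$; $f$ and $g$ are bounded functions in $C^\infty(\overline{\Omega\times(0,T)})$. Under these conditions (P) has a unique bounded solution $u$, which lies in $C^\infty(\Omega\times(0,T))$ (taken as known). **Decomposition.** $\Omega$ is divided into $I\ge2$ overlapping subdomains $\Omega_l=D\times(a_l,b_l)$,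 $l=1,\dots,I$, with $$\alpha=a_1<a_2<b_1<\dots<a_I<b_{I-1}<b_I=\beta$$ (the chain being $a_1<a_2<b_1<a_3<b_2<\dots<a_I<b_{I-1}<b_I$). **Algorithm.** Let $p\in\mathbb{R}$ be a constant and $h^0$ a bounded function in $C^\infty(\overline{\Omega\times(0,T)})$ (the initial guess). For $k\ge1$ and $l\in\{1,\dots,I\}$, the iterate $u_l^k$ is the solution of $$\frac{\partial u_l^k}{\partial t}-\sum_{i,j=1}^n a_{i,j}(t)\frac{\partial^2 u_l^k}{\partial x_i\partial x_j}+\sum_{i=1}^n b_i(t)\frac{\partial u_l^k}{\partial x_i}+c(t)u_l^k=f(t,x)\quad\text{in }\Omega_l\times(0,T),$$ with $u_l^k(x,t)=g(x,t)$ on $(\partial\Omega_l\cap\partial\Omega)\times(0,T)$ and $u_l^k(x,0)=g(x,0)$ in $\Omega_l$ (in particular $u_1^k(\cdot,\alpha,\cdot)=g(\cdot,\alpha,\cdot)$ and $u_I^k(\cdot,\beta,\cdot)=g(\cdot,\beta,\cdot)$), together with the following Robin transmission conditions on $D\times(0,T)$. - For $k\ge2$: for $l\in\{2,\dots,I\}$, $$\frac{\partial u_l^k(\cdot,a_l,\cdot)}{\partial x_n}+p\,u_l^k(\cdot,a_l,\cdot)=\frac{\partial u_{l-1}^{k-1}(\cdot,a_l,\cdot)}{\partial x_n}+p\,u_{l-1}^{k-1}(\cdot,a_l,\cdot),$$ and for $l\in\{1,\dots,I-1\}$, $$\frac{\partial u_l^k(\cdot,b_l,\cdot)}{\partial x_n}+p\,u_l^k(\cdot,b_l,\cdot)=\frac{\partial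 u_{l+1}^{k-1}(\cdot,b_l,\cdot)}{\partial x_n}+p\,u_{l+1}^{k-1}(\cdot,b_l,\cdot).$$ - For $k=1$: the right-hand sides above are replaced by $h^0(\cdot,a_l,\cdot)$ (for $l\in\{2,\dots,I\}$) and $h^0(\cdot,b_l,\cdot)$ (for $l\in\{1,\dots,I-1\}$), respectively. Each subproblem has a unique solution at every iteration, and it lies in $C^\infty(\Omega_l\times(0,T))$, so the algorithm is well posed (taken as known). *)

theory Defs
  imports "HOL-Analysis.Analysis"
begin

(* On an open set S of a Euclidean space this is C^k: differentiability together with
   C^(k-1) regularity of every directional derivative. *)
primrec Ck_on :: "nat \<Rightarrow> ('a::real_normed_vector \<Rightarrow> 'b::real_normed_vector) \<Rightarrow> 'a set \<Rightarrow> bool" where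
  "Ck_on 0 f S \<longleftrightarrow> continuous_on S f"
| "Ck_on (Suc k) f S \<longleftrightarrow>
     (\<forall>x\<in>S. f differentiable (at x)) \<and>
     (\<forall>v. Ck_on k (\<lambda>x. frechet_derivative f (at x) v) S)"

definition smooth_on :: "('a::real_normed_vector \<Rightarrow> 'b::real_normed_vector) \<Rightarrow> 'a set \<Rightarrow> bool" where
  "smooth_on f S \<longleftrightarrow> (\<forall>k. Ck_on k f S)"

(* C^infinity of the closed set closure S: restrictions of functions that are smooth on
   some open neighbourhood of it. *)
definition smooth_on_closure :: "('a::real_normed_vector \<Rightarrow> 'b::real_normed_vector) \<Rightarrow> 'a set \<Rightarrow> bool" where
  "smooth_on_closure f S \<longleftrightarrow>
     (\<exists>V F. open V \<and> closure S \<subseteq> V \<and> smooth_on F V \<and> (\<forall>x\<in>closure S. f x = F x))"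

(* Boundary of class C^1, the domain lying locally on one side of it.  This is the weakest
   reading of "smooth enough", hence implied by every stronger one. *)
definition C1_boundary :: "('a::euclidean_space) set \<Rightarrow> bool" where
  "C1_boundary D \<longleftrightarrow>
     (\<forall>x\<in>frontier D. \<exists>V \<psi>. open V \<and> x \<in> V \<and> Ck_on 1 (\<psi> :: 'a \<Rightarrow> real) V \<and>
        (\<forall>y\<in>V. frechet_derivative \<psi> (at y) \<noteq> (\<lambda>v. 0)) \<and>
        D \<inter> V = {y\<in>V. \<psi> y < 0})"

(* A point x = (X, x_n) of R^n, n = CARD('m) + 1.  Coordinate directions, and hence the indices
   of the coefficients, are the elements of Basis; the direction x_n is (0, 1).
   Functions of space and time take the argument (x, t). *)
type_synonym 'm pt = "(real ^ 'm) \<times> real"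

definition dx :: "('m::finite) pt \<Rightarrow> ('m pt \<times> real \<Rightarrow> real) \<Rightarrow> 'm pt \<times> real \<Rightarrow> real" where
  "dx i u = (\<lambda>(x, t). deriv (\<lambda>h. u (x + h *\<^sub>R i, t)) 0)"

definition dt :: "(('m::finite) pt \<times> real \<Rightarrow> real) \<Rightarrow> 'm pt \<times> real \<Rightarrow> real" where
  "dt u = (\<lambda>(x, t). deriv (\<lambda>s. u (x, s)) t)"

definition parabolic_op ::
  "(real \<Rightarrow> ('m::finite) pt \<Rightarrow> 'm pt \<Rightarrow> real) \<Rightarrow> (real \<Rightarrow> 'm pt \<Rightarrow> real) \<Rightarrow> (real \<Rightarrow> real) \<Rightarrow>
   ('m pt \<times> real \<Rightarrow> real) \<Rightarrow> 'm pt \<times> real \<Rightarrow> real" where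
  "parabolic_op a b c u = (\<lambda>(x, t).
     dt u (x, t)
     - (\<Sum>i\<in>Basis. \<Sum>j\<in>Basis. a t i j * dx i (dx j u) (x, t))
     + (\<Sum>i\<in>Basis. b t i * dx i u (x, t))
     + c t * u (x, t))"

(* Classical solution in Q x (0,T): smooth inside, and continuous up to the lateral boundary and
   the initial time, which is what gives the pointwise boundary and initial values a meaning. *)
definition classical_solution ::
  "real \<Rightarrow> (real \<Rightarrow> ('m::finite) pt \<Rightarrow> 'm pt \<Rightarrow> real) \<Rightarrow> (real \<Rightarrow> 'm pt \<Rightarrow> real) \<Rightarrow> (real \<Rightarrow> real) \<Rightarrow>
   ('m pt \<times> real \<Rightarrow> real) \<Rightarrow> 'm pt set \<Rightarrow> ('m pt \<times> real \<Rightarrow> real) \<Rightarrow> bool" where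
  "classical_solution T a b c f Q u \<longleftrightarrow>
     smooth_on u (Q \<times> {0<..<T}) \<and>
     continuous_on (closure Q \<times> {0..<T}) u \<and>
     (\<forall>z \<in> Q \<times> {0<..<T}. parabolic_op a b c u z = f z)"

definition solves_P ::
  "real \<Rightarrow> (real \<Rightarrow> ('m::finite) pt \<Rightarrow> 'm pt \<Rightarrow> real) \<Rightarrow> (real \<Rightarrow> 'm pt \<Rightarrow> real) \<Rightarrow> (real \<Rightarrow> real) \<Rightarrow>
   ('m pt \<times> real \<Rightarrow> real) \<Rightarrow> ('m pt \<times> real \<Rightarrow> real) \<Rightarrow> 'm pt set \<Rightarrow> ('m pt \<times> real \<Rightarrow> real) \<Rightarrow> bool" where
  "solves_P T a b c f g Q u \<longleftrightarrow>
     classical_solution T a b c f Q u \<and>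
     (\<forall>z \<in> frontier Q \<times> {0<..<T}. u z = g z) \<and>
     (\<forall>x\<in>Q. u (x, 0) = g (x, 0))"

definition subdomains :: "nat \<Rightarrow> real \<Rightarrow> real \<Rightarrow> (nat \<Rightarrow> real) \<Rightarrow> (nat \<Rightarrow> real) \<Rightarrow> bool" where
  "subdomains N \<alpha> \<beta> lo hi \<longleftrightarrow>
     2 \<le> N \<and> lo 1 = \<alpha> \<and> hi N = \<beta> \<and>
     lo 1 < lo 2 \<and>
     (\<forall>l\<in>{1..N-1}. lo (l + 1) < hi l) \<and>
     (\<forall>l\<in>{1..N-2}. hi l < lo (l + 2)) \<and>
     hi (N - 1) < hi N"

(* The derivative in x_n of v at x_n = s is taken within the interval J, so that at an end point
   of J it is the one-sided derivative from inside the subdomain D x J. *)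
definition dn_differentiable ::
  "real set \<Rightarrow> (('m::finite) pt \<times> real \<Rightarrow> real) \<Rightarrow> real \<Rightarrow> real ^ 'm \<Rightarrow> real \<Rightarrow> bool" where
  "dn_differentiable J v s X t \<longleftrightarrow> (\<lambda>r. v ((X, r), t)) differentiable (at s within J)"

definition robin_trace ::
  "real \<Rightarrow> real set \<Rightarrow> (('m::finite) pt \<times> real \<Rightarrow> real) \<Rightarrow> real \<Rightarrow> real ^ 'm \<Rightarrow> real \<Rightarrow> real" where
  "robin_trace p J v s X t =
     vector_derivative (\<lambda>r. v ((X, r), t)) (at s within J) + p * v ((X, s), t)"

(* U k l is the k-th iterate in the l-th subdomain, for k \<ge> 1 and 1 \<le> l \<le> N. *)
definition schwarz_iterates ::
  "real \<Rightarrow> (real \<Rightarrow> ('m::finite) pt \<Rightarrow> 'm pt \<Rightarrow> real) \<Rightarrow> (real \<Rightarrow> 'm pt \<Rightarrow> real) \<Rightarrow> (real \<Rightarrow> real) \<Rightarrow>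
   ('m pt \<times> real \<Rightarrow> real) \<Rightarrow> ('m pt \<times> real \<Rightarrow> real) \<Rightarrow> (real ^ 'm) set \<Rightarrow> real \<Rightarrow> real \<Rightarrow>
   nat \<Rightarrow> (nat \<Rightarrow> real) \<Rightarrow> (nat \<Rightarrow> real) \<Rightarrow> real \<Rightarrow> ('m pt \<times> real \<Rightarrow> real) \<Rightarrow>
   (nat \<Rightarrow> nat \<Rightarrow> 'm pt \<times> real \<Rightarrow> real) \<Rightarrow> bool" where
  "schwarz_iterates T a b c f g D \<alpha> \<beta> N lo hi p h0 U \<longleftrightarrow>
     (\<forall>k\<ge>1. \<forall>l\<in>{1..N}.
        classical_solution T a b c f (D \<times> {lo l<..<hi l}) (U k l) \<and>
        (\<forall>z \<in> (frontier (D \<times> {lo l<..<hi l}) \<inter> frontier (D \<times> {\<alpha><..<\<beta>})) \<times> {0<..<T}.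
           U k l z = g z) \<and>
        (\<forall>x \<in> D \<times> {lo l<..<hi l}. U k l (x, 0) = g (x, 0))) \<and>
     (\<forall>k\<ge>1. \<forall>X\<in>D. \<forall>t\<in>{0<..<T}.
        (\<forall>l\<in>{2..N}.
           dn_differentiable {lo l..hi l} (U k l) (lo l) X t \<and>
           robin_trace p {lo l..hi l} (U k l) (lo l) X t =
             (if k = 1 then h0 ((X, lo l), t)
              else robin_trace p {lo (l - 1)..hi (l - 1)} (U (k - 1) (l - 1)) (lo l) X t)) \<and>
        (\<forall>l\<in>{1..N-1}.
           dn_differentiable {lo l..hi l} (U k l) (hi l) X t \<and>
           robin_trace p {lo l..hi l} (U k l) (hi l) X t =
             (if k = 1 then h0 ((X, hi l), t)
              else robin_trace p {lo (l + 1)..hi (l + 1)} (U (k - 1) (l + 1)) (hi l) X t)))"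

(* For w continuous on closure S this is its norm in C(closure S).  Taking the supremum over S
   only needs w on S, and extended real values make it infinite when w is unbounded. *)
definition sup_norm :: "'a set \<Rightarrow> ('a \<Rightarrow> real) \<Rightarrow> ereal" where
  "sup_norm S w = (SUP z\<in>S. ereal \<bar>w z\<bar>)"

end

theory Submission
  imports Defs
begin

text \<open>
The error \<open>e = u\<^sub>l\<^sup>k - u\<close> solves the homogeneous equation with zero initial values and zero values on
the physical boundary.  Since the coefficients depend on time alone, the weighted error
\<open>v = exp (p x\<^sub>n - \<kappa> t) e\<close> solves an equation of the same type, and its normal derivative is the
weighted Robin trace of \<open>e\<close>.  The algorithm therefore exchanges the values of \<open>\<partial>\<^sub>n v\<close>, and the claim
is that this exchange is a contraction in the supremum norm.

One would like to apply the maximum principle to \<open>\<partial>\<^sub>n v\<close>, which solves the same equation.  But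
\<open>\<partial>\<^sub>n v\<close> is only known to exist pointwise on the interfaces; it need not be continuous there, and
the data are not compatible at the edges of the space-time cylinder.  The argument is therefore
carried out for differences \<open>v (X, x) - v (X, y)\<close> of two points on the same vertical line.
Translation invariance in \<open>x\<close> lets both points move together, so that the difference solves a
parabolic equation; at a face only one point moves, and a one-sided derivative at that point is
enough to exclude a maximum (\<open>monotonicity_principle\<close>).

Applied to \<open>v - M \<Gamma>\<close>, where \<open>\<Gamma>\<close> is a primitive of the barrier \<open>\<eta>(s) = cosh (\<mu> (s - mid))\<close>, this gives
\<open>\<bar>\<partial>\<^sub>n v\<bar> \<le> C \<eta>\<close> in the slab as soon as it holds on the faces with Robin data.  A physical face carries
the condition \<open>v = 0\<close> instead of a flux; there a comparison with \<open>M (\<Gamma> - \<Gamma> lo)\<close> bounds the growth of \<open>v\<close>,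
provided that \<open>\<mu>\<close> is large compared with the drift (\<open>growth_from_lo\<close>, \<open>growth_from_hi\<close>).  The same
barrier bounds \<open>v\<close> itself.  The rate \<open>\<kappa>\<close> is chosen after \<open>\<mu>\<close> and makes all zeroth-order terms
favourable, whatever the signs of \<open>p\<close> and \<open>c\<close> (\<open>cosh_barrier_exists\<close>).

The barrier is strictly smaller at interior points than at the ends of its interval.  Each subdomain
is read by its neighbours at interior planes, which is where the overlap enters, so one iteration
multiplies the largest flux by a factor \<open>\<gamma> < 1\<close> (\<open>schwarz_error_decay\<close>).  The iteration starts from
finite data because \<open>\<partial>\<^sub>n u\<close> is bounded, by the same slab estimate applied to \<open>u\<close> minus a smooth
extension of the boundary values (\<open>normal_derivative_bounded\<close>).
\<close>

section \<open>Second-order conditions at a maximum\<close>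

text \<open>The trace of the product of a positive definite and a negative semidefinite form is not positive.
This is an induction along the Cholesky decomposition: splitting off one pivot writes \<open>A\<close> as a
rank-one square, on which the pairing with \<open>H\<close> is a value of the form \<open>H\<close>, plus the Schur
complement, which is positive definite in one variable less.\<close>

lemma trace_product_nonpos:
  fixes A H :: "'i \<Rightarrow> 'i \<Rightarrow> real"
  assumes "finite I"
    and "\<And>i j. i \<in> I \<Longrightarrow> j \<in> I \<Longrightarrow> A i j = A j i"
    and "\<And>\<xi>. (\<exists>i\<in>I. \<xi> i \<noteq> 0) \<Longrightarrow> (\<Sum>i\<in>I. \<Sum>j\<in>I. A i j * \<xi> i * \<xi> j) > 0"
    and "\<And>\<xi>. (\<Sum>i\<in>I. \<Sum>j\<in>I. H i j * \<xi> i * \<xi> j) \<le> 0"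
  shows "(\<Sum>i\<in>I. \<Sum>j\<in>I. A i j * H i j) \<le> 0"
  using assms
proof (induction I arbitrary: A rule: finite_induct)
  case empty
  then show ?case by simp
next
  case (insert k I)
  note sym = insert.prems(1) and pos = insert.prems(2) and neg = insert.prems(3)
  have fin: "finite I" and k: "k \<notin> I" using insert.hyps by auto
  have symI: "A j k = A k j" if "j \<in> I" for j using sym that by blast
  have split: "(\<Sum>i\<in>insert k I. \<Sum>j\<in>insert k I. f i j)
      = f k k + (\<Sum>j\<in>I. f k j) + (\<Sum>i\<in>I. f i k) + (\<Sum>i\<in>I. \<Sum>j\<in>I. f i j)" for f :: "'i \<Rightarrow> 'i \<Rightarrow> real"
    using fin k by (simp add: sum.distrib)
  have akk: "A k k > 0"
  proof -
    define e :: "'i \<Rightarrow> real" where "e = (\<lambda>i. if i = k then 1 else 0)"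
    have "0 < (\<Sum>i\<in>insert k I. \<Sum>j\<in>insert k I. A i j * e i * e j)"
      by (rule pos) (simp add: e_def)
    also have "\<dots> = A k k"
    proof -
      have e: "e k = 1" "\<And>i. i \<in> I \<Longrightarrow> e i = 0" using k by (auto simp: e_def)
      have "(\<Sum>j\<in>I. A k j * e k * e j) = 0" "(\<Sum>i\<in>I. A i k * e i * e k) = 0"
        "(\<Sum>i\<in>I. \<Sum>j\<in>I. A i j * e i * e j) = 0"
        by (simp_all add: e(2))
      then show ?thesis unfolding split by (simp add: e(1))
    qed
    finally show ?thesis .
  qed
  define B where "B i j = A i j - A i k * A k j / A k k" for i j
  have "(\<Sum>i\<in>I. \<Sum>j\<in>I. B i j * H i j) \<le> 0"
  proof (rule insert.IH)
    show "B i j = B j i" if "i \<in> I" "j \<in> I" for i j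
    proof -
      have "A i j = A j i" "A i k = A k i" "A j k = A k j" using that sym by auto
      then show ?thesis by (simp only: B_def mult.commute)
    qed
    show "(\<Sum>i\<in>I. \<Sum>j\<in>I. B i j * \<xi> i * \<xi> j) > 0" if ex: "\<exists>i\<in>I. \<xi> i \<noteq> 0" for \<xi>
    proof -
      define S where "S = (\<Sum>j\<in>I. A k j * \<xi> j)"
      \<comment> \<open>the value in the direction of the pivot that minimises the quadratic form of \<open>A\<close>\<close>
      define \<zeta> where "\<zeta> i = (if i = k then - S / A k k else \<xi> i)" for i
      have zI: "\<zeta> i = \<xi> i" if "i \<in> I" for i using that k by (auto simp: \<zeta>_def)
      have zk: "\<zeta> k = - S / A k k" by (simp add: \<zeta>_def)
      have S2: "(\<Sum>i\<in>I. A i k * \<xi> i) = S"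
        unfolding S_def by (rule sum.cong) (simp_all add: symI)
      have r: "(\<Sum>j\<in>I. A k j * \<zeta> k * \<zeta> j) = \<zeta> k * S"
        unfolding S_def sum_distrib_left by (rule sum.cong) (auto simp: zI)
      have c: "(\<Sum>i\<in>I. A i k * \<zeta> i * \<zeta> k) = \<zeta> k * S"
        unfolding S2[symmetric] sum_distrib_left by (rule sum.cong) (auto simp: zI)
      have m: "(\<Sum>i\<in>I. \<Sum>j\<in>I. A i j * \<zeta> i * \<zeta> j) = (\<Sum>i\<in>I. \<Sum>j\<in>I. A i j * \<xi> i * \<xi> j)"
        by (intro sum.cong refl) (auto simp: zI)
      have "(\<Sum>i\<in>I. \<Sum>j\<in>I. B i j * \<xi> i * \<xi> j)
          = (\<Sum>i\<in>I. \<Sum>j\<in>I. A i j * \<xi> i * \<xi> j - (A i k * \<xi> i) * (A k j * \<xi> j) / A k k)"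
        by (intro sum.cong refl) (auto simp: B_def algebra_simps)
      also have "\<dots> = (\<Sum>i\<in>I. \<Sum>j\<in>I. A i j * \<xi> i * \<xi> j) - S * S / A k k"
        by (simp add: sum_subtractf sum_divide_distrib[symmetric] sum_product[symmetric] S2 S_def[symmetric])
      also have "\<dots> = (\<Sum>i\<in>insert k I. \<Sum>j\<in>insert k I. A i j * \<zeta> i * \<zeta> j)"
        unfolding split r c m using akk by (simp add: zk)
      also have "\<dots> > 0" by (rule pos) (use ex zI in auto)
      finally show ?thesis .
    qed
    show "(\<Sum>i\<in>I. \<Sum>j\<in>I. H i j * \<xi> i * \<xi> j) \<le> 0" for \<xi>
    proof -
      have "(\<Sum>i\<in>I. \<Sum>j\<in>I. H i j * \<xi> i * \<xi> j) = (\<Sum>i\<in>I. \<Sum>j\<in>I. H i j * (\<xi>(k:=0)) i * (\<xi>(k:=0)) j)"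
        by (intro sum.cong refl) (use k in auto)
      also have "\<dots> = (\<Sum>i\<in>insert k I. \<Sum>j\<in>insert k I. H i j * (\<xi>(k:=0)) i * (\<xi>(k:=0)) j)"
        unfolding split by simp
      finally show ?thesis using neg[of "\<xi>(k:=0)"] by simp
    qed
  qed
  moreover have "(\<Sum>i\<in>insert k I. \<Sum>j\<in>insert k I. H i j * A i k * A j k) / A k k \<le> 0"
    using neg[of "\<lambda>i. A i k"] akk by (simp add: divide_nonpos_pos)
  moreover have "(\<Sum>i\<in>insert k I. \<Sum>j\<in>insert k I. A i j * H i j)
     = (\<Sum>i\<in>I. \<Sum>j\<in>I. B i j * H i j) + (\<Sum>i\<in>insert k I. \<Sum>j\<in>insert k I. H i j * A i k * A j k) / A k k"
  proof -
    have *: "(\<Sum>i\<in>I. \<Sum>j\<in>I. A i j * H i j) = (\<Sum>i\<in>I. \<Sum>j\<in>I. B i j * H i j) + (\<Sum>i\<in>I. \<Sum>j\<in>I. H i j * A i k * A j k) / A k k"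
      unfolding sum_divide_distrib sum.distrib[symmetric]
      by (intro sum.cong refl) (simp add: B_def symI algebra_simps)
    have **: "(\<Sum>j\<in>I. A k j * H k j) = (\<Sum>j\<in>I. H k j * A k k * A j k) / A k k"
      unfolding sum_divide_distrib by (intro sum.cong refl) (use akk in \<open>simp add: symI\<close>)
    have ***: "(\<Sum>i\<in>I. A i k * H i k) = (\<Sum>i\<in>I. H i k * A i k * A k k) / A k k"
      unfolding sum_divide_distrib by (intro sum.cong refl) (use akk in auto)
    have "A k k * H k k = H k k * A k k * A k k / A k k" using akk by simp
    then show ?thesis unfolding split * ** *** add_divide_distrib by linarith
  qed
  ultimately show ?case by linarith
qed

text \<open>Restricting \<open>w\<close> to a line through the maximum reduces the second-order condition to one real
variable: a positive second derivative would make \<open>w\<close> increase along the line.\<close>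

lemma local_max_second_order:
  fixes w :: "'a::euclidean_space \<Rightarrow> real"
  assumes "open S" "x0 \<in> S"
    and w1: "\<And>y. y \<in> S \<Longrightarrow> (w has_derivative (\<lambda>h. \<Sum>i\<in>Basis. (h \<bullet> i) * w1 i y)) (at y)"
    and w2: "\<And>j. j \<in> Basis \<Longrightarrow> (w1 j has_derivative (\<lambda>h. \<Sum>i\<in>Basis. (h \<bullet> i) * w2 i j)) (at x0)"
    and max: "\<And>y. y \<in> S \<Longrightarrow> w y \<le> w x0"
  shows "i \<in> Basis \<Longrightarrow> w1 i x0 = 0"
    and "(\<Sum>i\<in>Basis. \<Sum>j\<in>Basis. w2 i j * \<xi> i * \<xi> j) \<le> 0"
proof -
  have z: "(\<lambda>h. \<Sum>i\<in>Basis. (h \<bullet> i) * w1 i x0) = (\<lambda>v. 0)"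
    using differential_zero_maxmin[OF \<open>x0 \<in> S\<close> \<open>open S\<close> w1[OF \<open>x0 \<in> S\<close>]] max by blast
  have g0: "w1 i x0 = 0" if "i \<in> Basis" for i
  proof -
    have "(\<Sum>j\<in>Basis. (i \<bullet> j) * w1 j x0) = 0" using z by metis
    then show ?thesis using that by (simp add: inner_Basis if_distrib[of "\<lambda>x. x * _"] cong: if_cong)
  qed
  then show "i \<in> Basis \<Longrightarrow> w1 i x0 = 0" by simp
  define X where "X = (\<Sum>i\<in>Basis. \<xi> i *\<^sub>R (i::'a))"
  have Xi: "X \<bullet> i = \<xi> i" if "i \<in> Basis" for i
    unfolding X_def using that by (rule inner_sum_left_Basis)
  define q where "q = (\<Sum>i\<in>Basis. \<Sum>j\<in>Basis. w2 i j * \<xi> i * \<xi> j)"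
  have line: "((\<lambda>s. x0 + s *\<^sub>R X) has_derivative (\<lambda>h. h *\<^sub>R X)) (at r)" for r
    by (auto intro!: derivative_eq_intros)
  obtain \<epsilon> where \<epsilon>: "\<epsilon> > 0" "ball x0 \<epsilon> \<subseteq> S" using assms(1,2) open_contains_ball by blast
  define d where "d = \<epsilon> / (norm X + 1)"
  have d: "d > 0" "\<And>s. \<bar>s\<bar> < d \<Longrightarrow> x0 + s *\<^sub>R X \<in> S"
  proof -
    have X1: "norm X + 1 > 0" by (simp add: add_nonneg_pos)
    then show "d > 0" using \<epsilon> by (simp add: d_def)
    fix s :: real assume "\<bar>s\<bar> < d"
    then have "\<bar>s\<bar> * (norm X + 1) < \<epsilon>" using X1 by (simp add: d_def pos_less_divide_eq)
    moreover have "\<bar>s\<bar> * norm X \<le> \<bar>s\<bar> * (norm X + 1)" by (simp add: mult_left_mono)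
    ultimately have "x0 + s *\<^sub>R X \<in> ball x0 \<epsilon>" by (simp add: dist_norm)
    then show "x0 + s *\<^sub>R X \<in> S" using \<epsilon> by blast
  qed
  define \<phi>1 where "\<phi>1 s = (\<Sum>j\<in>Basis. \<xi> j * w1 j (x0 + s *\<^sub>R X))" for s
  have D1: "((\<lambda>s. w (x0 + s *\<^sub>R X)) has_field_derivative \<phi>1 s) (at s)" if "\<bar>s\<bar> < d" for s
  proof -
    have "((\<lambda>s. w (x0 + s *\<^sub>R X)) has_derivative (\<lambda>h. \<Sum>i\<in>Basis. ((h *\<^sub>R X) \<bullet> i) * w1 i (x0 + s *\<^sub>R X))) (at s)"
      by (rule has_derivative_compose[OF line w1[OF d(2)[OF that]]])
    moreover have "(\<lambda>h. \<Sum>i\<in>Basis. ((h *\<^sub>R X) \<bullet> i) * w1 i (x0 + s *\<^sub>R X)) = (*) (\<phi>1 s)"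
      by (auto simp: \<phi>1_def sum_distrib_left sum_distrib_right fun_eq_iff Xi intro!: sum.cong)
    ultimately show ?thesis by (simp add: has_field_derivative_def)
  qed
  have D2: "(\<phi>1 has_field_derivative q) (at 0)"
  proof -
    have "((\<lambda>s. \<xi> j * w1 j (x0 + s *\<^sub>R X)) has_field_derivative \<xi> j * (\<Sum>i\<in>Basis. \<xi> i * w2 i j)) (at 0)"
      if j: "j \<in> Basis" for j
    proof -
      have "(w1 j has_derivative (\<lambda>h. \<Sum>i\<in>Basis. (h \<bullet> i) * w2 i j)) (at (x0 + 0 *\<^sub>R X))"
        using w2[OF j] by simp
      then have "((\<lambda>s. w1 j (x0 + s *\<^sub>R X)) has_derivative (\<lambda>h. \<Sum>i\<in>Basis. ((h *\<^sub>R X) \<bullet> i) * w2 i j)) (at 0)"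
        by (rule has_derivative_compose[OF line])
      moreover have "(\<lambda>h. \<Sum>i\<in>Basis. ((h *\<^sub>R X) \<bullet> i) * w2 i j) = (*) (\<Sum>i\<in>Basis. \<xi> i * w2 i j)"
        by (auto simp: sum_distrib_left sum_distrib_right fun_eq_iff Xi intro!: sum.cong)
      ultimately show ?thesis by (auto simp: has_field_derivative_def[symmetric] intro!: DERIV_cmult)
    qed
    then have "(\<phi>1 has_field_derivative (\<Sum>j\<in>Basis. \<xi> j * (\<Sum>i\<in>Basis. \<xi> i * w2 i j))) (at 0)"
      unfolding \<phi>1_def by (intro DERIV_sum) auto
    moreover have "(\<Sum>j\<in>Basis. \<xi> j * (\<Sum>i\<in>Basis. \<xi> i * w2 i j)) = q"
      unfolding q_def sum_distrib_left by (subst sum.swap) (intro sum.cong refl, simp add: algebra_simps)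
    ultimately show ?thesis by simp
  qed
  have "\<phi>1 0 = 0" by (simp add: \<phi>1_def g0)
  have "q \<le> 0"
  proof (rule ccontr)
    assume "\<not> q \<le> 0"
    then obtain e where e: "e > 0" "\<And>h. 0 < h \<Longrightarrow> h < e \<Longrightarrow> \<phi>1 0 < \<phi>1 (0 + h)"
      using DERIV_pos_inc_right[OF D2] by auto
    define r where "r = min d e / 2"
    have r: "0 < r" "r < d" "r < e" using d(1) e(1) by (auto simp: r_def)
    have "w (x0 + 0 *\<^sub>R X) < w (x0 + r *\<^sub>R X)"
    proof (rule DERIV_pos_imp_increasing_open[OF \<open>0 < r\<close>])
      show "\<exists>y. ((\<lambda>s. w (x0 + s *\<^sub>R X)) has_real_derivative y) (at x) \<and> 0 < y" if "0 < x" "x < r" for x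
        using D1[of x] e(2)[of x] that r \<open>\<phi>1 0 = 0\<close> by auto
      show "continuous_on {0..r} (\<lambda>s. w (x0 + s *\<^sub>R X))"
        by (intro continuous_at_imp_continuous_on ballI DERIV_isCont[OF D1]) (use r in auto)
    qed
    then show False using max[of "x0 + r *\<^sub>R X"] d(2)[of r] r by auto
  qed
  then show "(\<Sum>i\<in>Basis. \<Sum>j\<in>Basis. w2 i j * \<xi> i * \<xi> j) \<le> 0" by (simp add: q_def)
qed

section \<open>Solutions with coefficients depending on time only\<close>

text \<open>The partial derivatives are existentially quantified rather than named.  Sums, translates and
exponential multiples of solutions are then handled by the rules for Frechet derivatives, and the
regularity required is exactly what a maximum principle uses at an interior point.\<close>

definition parabolic_solution ::
  "(real \<Rightarrow> 'a \<Rightarrow> 'a \<Rightarrow> real) \<Rightarrow> (real \<Rightarrow> 'a \<Rightarrow> real) \<Rightarrow> (real \<Rightarrow> real) \<Rightarrow> ('a::euclidean_space \<times> real \<Rightarrow> real) \<Rightarrow>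
   'a set \<Rightarrow> real \<Rightarrow> ('a \<times> real \<Rightarrow> real) \<Rightarrow> bool" where
  "parabolic_solution a b c F Q T v \<longleftrightarrow>
     (\<exists>vt v1 v2. \<forall>x\<in>Q. \<forall>t\<in>{0<..<T}.
        ((\<lambda>s. v (x, s)) has_field_derivative vt x t) (at t) \<and>
        ((\<lambda>y. v (y, t)) has_derivative (\<lambda>h. \<Sum>i\<in>Basis. (h \<bullet> i) * v1 t i x)) (at x) \<and>
        (\<forall>j\<in>Basis. (v1 t j has_derivative (\<lambda>h. \<Sum>i\<in>Basis. (h \<bullet> i) * v2 t x i j)) (at x)) \<and>
        vt x t - (\<Sum>i\<in>Basis. \<Sum>j\<in>Basis. a t i j * v2 t x i j)
          + (\<Sum>i\<in>Basis. b t i * v1 t i x) + c t * v (x, t) = F (x, t))"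

lemma parabolic_solutionE:
  assumes "parabolic_solution a b c F Q T v"
  obtains vt v1 v2 where
    "\<And>x t. x \<in> Q \<Longrightarrow> t \<in> {0<..<T} \<Longrightarrow> ((\<lambda>s. v (x, s)) has_field_derivative vt x t) (at t)"
    "\<And>x t. x \<in> Q \<Longrightarrow> t \<in> {0<..<T} \<Longrightarrow>
       ((\<lambda>y. v (y, t)) has_derivative (\<lambda>h. \<Sum>i\<in>Basis. (h \<bullet> i) * v1 t i x)) (at x)"
    "\<And>x t j. x \<in> Q \<Longrightarrow> t \<in> {0<..<T} \<Longrightarrow> j \<in> Basis \<Longrightarrow>
       (v1 t j has_derivative (\<lambda>h. \<Sum>i\<in>Basis. (h \<bullet> i) * v2 t x i j)) (at x)"
    "\<And>x t. x \<in> Q \<Longrightarrow> t \<in> {0<..<T} \<Longrightarrow>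
       vt x t - (\<Sum>i\<in>Basis. \<Sum>j\<in>Basis. a t i j * v2 t x i j)
         + (\<Sum>i\<in>Basis. b t i * v1 t i x) + c t * v (x, t) = F (x, t)"
  using assms unfolding parabolic_solution_def
  apply (elim exE)
  subgoal premises prems for vt v1 v2
    by (rule prems(1)[of vt v1 v2]) (use prems(2) in \<open>simp_all only:\<close>)
  done

lemma parabolic_solution_diff:
  assumes "parabolic_solution a b c F Q T v" "parabolic_solution a b c G Q T w"
  shows "parabolic_solution a b c (\<lambda>z. F z - G z) Q T (\<lambda>z. v z - w z)"
proof -
  obtain vt v1 v2 where v:
    "\<And>x t. x \<in> Q \<Longrightarrow> t \<in> {0<..<T} \<Longrightarrow> ((\<lambda>s. v (x, s)) has_field_derivative vt x t) (at t)"
    "\<And>x t. x \<in> Q \<Longrightarrow> t \<in> {0<..<T} \<Longrightarrow>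
       ((\<lambda>y. v (y, t)) has_derivative (\<lambda>h. \<Sum>i\<in>Basis. (h \<bullet> i) * v1 t i x)) (at x)"
    "\<And>x t j. x \<in> Q \<Longrightarrow> t \<in> {0<..<T} \<Longrightarrow> j \<in> Basis \<Longrightarrow>
       (v1 t j has_derivative (\<lambda>h. \<Sum>i\<in>Basis. (h \<bullet> i) * v2 t x i j)) (at x)"
    "\<And>x t. x \<in> Q \<Longrightarrow> t \<in> {0<..<T} \<Longrightarrow>
       vt x t - (\<Sum>i\<in>Basis. \<Sum>j\<in>Basis. a t i j * v2 t x i j)
         + (\<Sum>i\<in>Basis. b t i * v1 t i x) + c t * v (x, t) = F (x, t)"
    using parabolic_solutionE[OF assms(1)] by blast
  obtain wt w1 w2 where w:
    "\<And>x t. x \<in> Q \<Longrightarrow> t \<in> {0<..<T} \<Longrightarrow> ((\<lambda>s. w (x, s)) has_field_derivative wt x t) (at t)"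
    "\<And>x t. x \<in> Q \<Longrightarrow> t \<in> {0<..<T} \<Longrightarrow>
       ((\<lambda>y. w (y, t)) has_derivative (\<lambda>h. \<Sum>i\<in>Basis. (h \<bullet> i) * w1 t i x)) (at x)"
    "\<And>x t j. x \<in> Q \<Longrightarrow> t \<in> {0<..<T} \<Longrightarrow> j \<in> Basis \<Longrightarrow>
       (w1 t j has_derivative (\<lambda>h. \<Sum>i\<in>Basis. (h \<bullet> i) * w2 t x i j)) (at x)"
    "\<And>x t. x \<in> Q \<Longrightarrow> t \<in> {0<..<T} \<Longrightarrow>
       wt x t - (\<Sum>i\<in>Basis. \<Sum>j\<in>Basis. a t i j * w2 t x i j)
         + (\<Sum>i\<in>Basis. b t i * w1 t i x) + c t * w (x, t) = G (x, t)"
    using parabolic_solutionE[OF assms(2)] by blast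
  have E: "(\<lambda>h. \<Sum>i\<in>Basis. (h \<bullet> i) * (p i - q i)) = (\<lambda>h. (\<Sum>i\<in>Basis. (h \<bullet> i) * p i) - (\<Sum>i\<in>Basis. (h \<bullet> i) * q i))"
    for p q :: "'a \<Rightarrow> real"
    by (simp add: algebra_simps sum_subtractf)
  show ?thesis
    unfolding parabolic_solution_def
  proof (rule exI[of _ "\<lambda>x t. vt x t - wt x t"], rule exI[of _ "\<lambda>t i x. v1 t i x - w1 t i x"],
      rule exI[of _ "\<lambda>t x i j. v2 t x i j - w2 t x i j"], intro ballI conjI)
    fix x t assume xt: "x \<in> Q" "t \<in> {0<..<T}"
    show "((\<lambda>s. v (x, s) - w (x, s)) has_real_derivative vt x t - wt x t) (at t)"
      by (rule DERIV_diff[OF v(1)[OF xt] w(1)[OF xt]])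
    show "((\<lambda>y. v (y, t) - w (y, t)) has_derivative (\<lambda>h. \<Sum>i\<in>Basis. (h \<bullet> i) * (v1 t i x - w1 t i x))) (at x)"
      unfolding E by (rule has_derivative_diff[OF v(2)[OF xt] w(2)[OF xt]])
    show "((\<lambda>x. v1 t j x - w1 t j x) has_derivative (\<lambda>h. \<Sum>i\<in>Basis. (h \<bullet> i) * (v2 t x i j - w2 t x i j))) (at x)"
      if "j \<in> Basis" for j
      unfolding E by (rule has_derivative_diff[OF v(3)[OF xt that] w(3)[OF xt that]])
    show "vt x t - wt x t - (\<Sum>i\<in>Basis. \<Sum>j\<in>Basis. a t i j * (v2 t x i j - w2 t x i j)) +
       (\<Sum>i\<in>Basis. b t i * (v1 t i x - w1 t i x)) + c t * (v (x, t) - w (x, t)) = F (x, t) - G (x, t)"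
      using v(4)[OF xt] w(4)[OF xt] by (simp add: right_diff_distrib sum_subtractf)
  qed
qed

lemma parabolic_solution_zero: "parabolic_solution a b c (\<lambda>z. 0) Q T (\<lambda>z. 0)"
  unfolding parabolic_solution_def
  by (rule exI[of _ "\<lambda>_ _. 0"], rule exI[of _ "\<lambda>_ _ _. 0"], rule exI[of _ "\<lambda>_ _ _ _. 0"]) auto

lemma parabolic_solution_uminus:
  assumes "parabolic_solution a b c F Q T v"
  shows "parabolic_solution a b c (\<lambda>z. - F z) Q T (\<lambda>z. - v z)"
  using parabolic_solution_diff[OF parabolic_solution_zero assms] by simp

lemma parabolic_solution_cong:
  assumes "parabolic_solution a b c F Q T v" "R \<subseteq> Q"
    and "\<And>x t. x \<in> R \<Longrightarrow> t \<in> {0<..<T} \<Longrightarrow> F (x, t) = G (x, t)"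
  shows "parabolic_solution a b c G R T v"
  using assms(1) unfolding parabolic_solution_def
  by - ((erule ex_forward)+, use assms(2,3) in \<open>simp add: subset_iff\<close>)

text \<open>This is how barriers that depend on one coordinate only enter comparison arguments.\<close>

lemma parabolic_solution_profile:
  fixes \<Gamma> \<Gamma>1 \<Gamma>2 :: "real \<Rightarrow> real"
  assumes n: "n \<in> Basis"
    and 1: "\<And>s. (\<Gamma> has_field_derivative \<Gamma>1 s) (at s)"
    and 2: "\<And>s. (\<Gamma>1 has_field_derivative \<Gamma>2 s) (at s)"
  shows "parabolic_solution a b c
    (\<lambda>(x, t). - a t n n * \<Gamma>2 (x \<bullet> n) + b t n * \<Gamma>1 (x \<bullet> n) + c t * \<Gamma> (x \<bullet> n)) Q T (\<lambda>(x, t). \<Gamma> (x \<bullet> n))"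
proof -
  have sel: "(\<Sum>i\<in>Basis. f i * (if i = n then r else 0)) = f n * r" for f :: "'a \<Rightarrow> real" and r
    using n by (simp add: if_distrib[of "\<lambda>x. _ * x"] cong: if_cong)
  have sel2: "(\<Sum>i\<in>Basis. \<Sum>j\<in>Basis. f i j * (if j = n then if i = n then r else 0 else 0)) = f n n * r"
    for f :: "'a \<Rightarrow> 'a \<Rightarrow> real" and r
    by (simp add: sel)
  have in_dir: "((\<lambda>x. G (x \<bullet> n)) has_derivative (\<lambda>h. (h \<bullet> n) * G' (x \<bullet> n))) (at x)"
    if "\<And>s. (G has_field_derivative G' s) (at s)" for G G' :: "real \<Rightarrow> real" and x
  proof -
    have "((\<lambda>x. G (x \<bullet> n)) has_derivative (\<lambda>h. G' (x \<bullet> n) * (h \<bullet> n))) (at x)"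
      by (rule has_derivative_compose[of "\<lambda>x. x \<bullet> n" "\<lambda>h. h \<bullet> n" x UNIV G "(*) (G' (x \<bullet> n))"])
         (use that[of "x \<bullet> n"] in \<open>auto intro!: derivative_eq_intros simp: has_field_derivative_def\<close>)
    then show ?thesis by (simp add: mult.commute)
  qed
  show ?thesis
    unfolding parabolic_solution_def
  proof (rule exI[of _ "\<lambda>_ _. 0"], rule exI[of _ "\<lambda>t i x. if i = n then \<Gamma>1 (x \<bullet> n) else 0"],
      rule exI[of _ "\<lambda>t x i j. if j = n then if i = n then \<Gamma>2 (x \<bullet> n) else 0 else 0"], intro ballI conjI)
    fix x t
    show "((\<lambda>s. case (x, s) of (x, t) \<Rightarrow> \<Gamma> (x \<bullet> n)) has_real_derivative 0) (at t)" by simp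
    show "((\<lambda>y. case (y, t) of (x, t) \<Rightarrow> \<Gamma> (x \<bullet> n)) has_derivative
         (\<lambda>h. \<Sum>i\<in>Basis. h \<bullet> i * (if i = n then \<Gamma>1 (x \<bullet> n) else 0))) (at x)"
      unfolding sel using in_dir[OF 1] by simp
    show "((\<lambda>x. if j = n then \<Gamma>1 (x \<bullet> n) else 0) has_derivative
         (\<lambda>h. \<Sum>i\<in>Basis. h \<bullet> i * (if j = n then if i = n then \<Gamma>2 (x \<bullet> n) else 0 else 0))) (at x)"
      for j using in_dir[OF 2] by (cases "j = n") (simp_all add: sel)
    show "0 - (\<Sum>i\<in>Basis. \<Sum>j\<in>Basis. a t i j * (if j = n then if i = n then \<Gamma>2 (x \<bullet> n) else 0 else 0)) +
           (\<Sum>i\<in>Basis. b t i * (if i = n then \<Gamma>1 (x \<bullet> n) else 0)) +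
           c t * (case (x, t) of (x, t) \<Rightarrow> \<Gamma> (x \<bullet> n)) =
           (case (x, t) of (x, t) \<Rightarrow> - a t n n * \<Gamma>2 (x \<bullet> n) + b t n * \<Gamma>1 (x \<bullet> n) + c t * \<Gamma> (x \<bullet> n))"
      unfolding sel sel2 by simp
  qed
qed

text \<open>The exponential in \<open>x \<bullet> n\<close> turns the Robin operator \<open>\<partial>\<^sub>n + p\<close> into the plain
derivative \<open>\<partial>\<^sub>n\<close>, and the exponential in time makes the zeroth-order coefficient as large
as one likes, while the coefficients continue to depend on time alone.\<close>

lemma parabolic_solution_exp_mult:
  fixes p \<kappa> :: real
  assumes sol: "parabolic_solution a b c F Q T e" and n: "n \<in> Basis"
  defines "\<rho> \<equiv> (\<lambda>x t. exp (p * (x \<bullet> n) - \<kappa> * t))"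
  shows "parabolic_solution a (\<lambda>t i. b t i + p * (a t i n + a t n i))
     (\<lambda>t. c t + \<kappa> - p * b t n - p\<^sup>2 * a t n n)
     (\<lambda>(x, t). \<rho> x t * F (x, t)) Q T (\<lambda>(x, t). \<rho> x t * e (x, t))"
proof -
  obtain et e1 e2 where e:
    "\<And>x t. x \<in> Q \<Longrightarrow> t \<in> {0<..<T} \<Longrightarrow> ((\<lambda>s. e (x, s)) has_field_derivative et x t) (at t)"
    "\<And>x t. x \<in> Q \<Longrightarrow> t \<in> {0<..<T} \<Longrightarrow>
       ((\<lambda>y. e (y, t)) has_derivative (\<lambda>h. \<Sum>i\<in>Basis. (h \<bullet> i) * e1 t i x)) (at x)"
    "\<And>x t j. x \<in> Q \<Longrightarrow> t \<in> {0<..<T} \<Longrightarrow> j \<in> Basis \<Longrightarrow>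
       (e1 t j has_derivative (\<lambda>h. \<Sum>i\<in>Basis. (h \<bullet> i) * e2 t x i j)) (at x)"
    "\<And>x t. x \<in> Q \<Longrightarrow> t \<in> {0<..<T} \<Longrightarrow>
       et x t - (\<Sum>i\<in>Basis. \<Sum>j\<in>Basis. a t i j * e2 t x i j)
         + (\<Sum>i\<in>Basis. b t i * e1 t i x) + c t * e (x, t) = F (x, t)"
    using parabolic_solutionE[OF sol] by blast
  define \<delta> where "\<delta> i = (if i = n then 1 else (0::real))" for i
  have sel: "(\<Sum>i\<in>Basis. f i * \<delta> i) = f n" for f :: "'a \<Rightarrow> real"
    using n by (simp add: \<delta>_def if_distrib[of "\<lambda>x. _ * x"] cong: if_cong)
  have d\<rho>: "((\<lambda>x. \<rho> x t) has_derivative (\<lambda>h. p * (h \<bullet> n) * \<rho> x t)) (at x)" for x t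
    unfolding \<rho>_def by (auto intro!: derivative_eq_intros)
  have prod: "((\<lambda>x. \<rho> x t * g x) has_derivative (\<lambda>h. \<Sum>i\<in>Basis. (h \<bullet> i) * (\<rho> x t * (g' i + p * \<delta> i * g x)))) (at x)"
    if "(g has_derivative (\<lambda>h. \<Sum>i\<in>Basis. (h \<bullet> i) * g' i)) (at x)" for g g' x t
  proof -
    have "(\<Sum>i\<in>Basis. (h \<bullet> i) * (\<rho> x t * (g' i + p * \<delta> i * g x)))
        = \<rho> x t * (\<Sum>i\<in>Basis. (h \<bullet> i) * g' i) + p * (h \<bullet> n) * \<rho> x t * g x" for h
    proof -
      have "(\<Sum>i\<in>Basis. (h \<bullet> i) * (\<rho> x t * (g' i + p * \<delta> i * g x)))
        = (\<Sum>i\<in>Basis. \<rho> x t * ((h \<bullet> i) * g' i)) + (\<Sum>i\<in>Basis. ((h \<bullet> i) * \<rho> x t * p * g x) * \<delta> i)"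
        unfolding sum.distrib[symmetric] by (intro sum.cong refl) (simp add: algebra_simps)
      then show ?thesis by (simp add: sel sum_distrib_left)
    qed
    then show ?thesis
      using has_derivative_mult[OF d\<rho>[of t x] that] by simp
  qed
  show ?thesis
    unfolding parabolic_solution_def
  proof (rule exI[of _ "\<lambda>x t. \<rho> x t * (et x t - \<kappa> * e (x, t))"],
      rule exI[of _ "\<lambda>t i x. \<rho> x t * (e1 t i x + p * \<delta> i * e (x, t))"],
      rule exI[of _ "\<lambda>t x i j. \<rho> x t * ((e2 t x i j + p * \<delta> j * e1 t i x)
          + p * \<delta> i * (e1 t j x + p * \<delta> j * e (x, t)))"], intro ballI conjI)
    fix x t assume xt: "x \<in> Q" "t \<in> {0<..<T}"
    note e' = e(1)[OF xt] e(2)[OF xt] e(3)[OF xt] e(4)[OF xt]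
    show "((\<lambda>s. case (x, s) of (x, t) \<Rightarrow> \<rho> x t * e (x, t)) has_real_derivative
            \<rho> x t * (et x t - \<kappa> * e (x, t))) (at t)"
      unfolding \<rho>_def using e'(1) by (auto intro!: derivative_eq_intros simp: algebra_simps)
    show "((\<lambda>y. case (y, t) of (x, t) \<Rightarrow> \<rho> x t * e (x, t)) has_derivative
         (\<lambda>h. \<Sum>i\<in>Basis. h \<bullet> i * (\<rho> x t * (e1 t i x + p * \<delta> i * e (x, t))))) (at x)"
      using prod[OF e'(2)] by simp
    show "((\<lambda>x. \<rho> x t * (e1 t j x + p * \<delta> j * e (x, t))) has_derivative
          (\<lambda>h. \<Sum>i\<in>Basis. h \<bullet> i * (\<rho> x t * ((e2 t x i j + p * \<delta> j * e1 t i x)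
             + p * \<delta> i * (e1 t j x + p * \<delta> j * e (x, t)))))) (at x)"
      if j: "j \<in> Basis" for j
    proof (rule prod)
      have "((\<lambda>x. e1 t j x + p * \<delta> j * e (x, t)) has_derivative
         (\<lambda>h. (\<Sum>i\<in>Basis. h \<bullet> i * e2 t x i j) + p * \<delta> j * (\<Sum>i\<in>Basis. h \<bullet> i * e1 t i x))) (at x)"
        by (intro has_derivative_add e'(3)[OF j] has_derivative_mult_right e'(2))
      then show "((\<lambda>x. e1 t j x + p * \<delta> j * e (x, t)) has_derivative
         (\<lambda>h. \<Sum>i\<in>Basis. h \<bullet> i * (e2 t x i j + p * \<delta> j * e1 t i x))) (at x)"
        by (simp add: algebra_simps sum.distrib sum_distrib_left)
    qed
    have A: "(\<Sum>i\<in>Basis. \<Sum>j\<in>Basis. a t i j * (\<rho> x t * ((e2 t x i j + p * \<delta> j * e1 t i x)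
            + p * \<delta> i * (e1 t j x + p * \<delta> j * e (x, t)))))
        = \<rho> x t * ((\<Sum>i\<in>Basis. \<Sum>j\<in>Basis. a t i j * e2 t x i j)
           + p * (\<Sum>i\<in>Basis. a t i n * e1 t i x) + p * (\<Sum>j\<in>Basis. a t n j * e1 t j x) + p\<^sup>2 * a t n n * e (x, t))"
      (is "?L = _")
    proof -
      have "(\<Sum>j\<in>Basis. a t i j * (\<rho> x t * ((e2 t x i j + p * \<delta> j * e1 t i x)
            + p * \<delta> i * (e1 t j x + p * \<delta> j * e (x, t)))))
          = \<rho> x t * (\<Sum>j\<in>Basis. a t i j * e2 t x i j) + \<rho> x t * p * (a t i n * e1 t i x)
             + (\<rho> x t * p * (\<Sum>j\<in>Basis. a t i j * e1 t j x) + \<rho> x t * p\<^sup>2 * a t i n * e (x, t)) * \<delta> i" for i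
      proof -
        have "(\<Sum>j\<in>Basis. a t i j * (\<rho> x t * ((e2 t x i j + p * \<delta> j * e1 t i x)
            + p * \<delta> i * (e1 t j x + p * \<delta> j * e (x, t)))))
          = (\<Sum>j\<in>Basis. \<rho> x t * (a t i j * e2 t x i j)) + (\<Sum>j\<in>Basis. (\<rho> x t * p * (a t i j * e1 t i x)) * \<delta> j)
            + (\<Sum>j\<in>Basis. (\<rho> x t * p * \<delta> i) * (a t i j * e1 t j x))
            + (\<Sum>j\<in>Basis. (\<rho> x t * p\<^sup>2 * a t i j * e (x, t) * \<delta> i) * \<delta> j)"
          unfolding sum.distrib[symmetric] by (intro sum.cong refl) (simp add: algebra_simps power2_eq_square)
        then show ?thesis
          unfolding sel sum_distrib_left[symmetric] by (simp add: algebra_simps)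
      qed
      then have "?L = (\<Sum>i\<in>Basis. \<rho> x t * (\<Sum>j\<in>Basis. a t i j * e2 t x i j)) + (\<Sum>i\<in>Basis. \<rho> x t * p * (a t i n * e1 t i x))
          + (\<Sum>i\<in>Basis. (\<rho> x t * p * (\<Sum>j\<in>Basis. a t i j * e1 t j x) + \<rho> x t * p\<^sup>2 * a t i n * e (x, t)) * \<delta> i)"
        by (simp only: sum.distrib)
      then show ?thesis
        unfolding sel sum_distrib_left[symmetric] by (simp add: algebra_simps)
    qed
    have B: "(\<Sum>i\<in>Basis. (b t i + p * (a t i n + a t n i)) * (\<rho> x t * (e1 t i x + p * \<delta> i * e (x, t))))
       = \<rho> x t * ((\<Sum>i\<in>Basis. b t i * e1 t i x) + p * (\<Sum>i\<in>Basis. a t i n * e1 t i x)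
           + p * (\<Sum>i\<in>Basis. a t n i * e1 t i x) + p * b t n * e (x, t) + 2 * p\<^sup>2 * a t n n * e (x, t))"
      (is "?L = _")
    proof -
      have "?L = \<rho> x t * (\<Sum>i\<in>Basis. b t i * e1 t i x) + \<rho> x t * p * (\<Sum>i\<in>Basis. a t i n * e1 t i x)
           + \<rho> x t * p * (\<Sum>i\<in>Basis. a t n i * e1 t i x)
           + (\<Sum>i\<in>Basis. ((b t i + p * (a t i n + a t n i)) * \<rho> x t * p * e (x, t)) * \<delta> i)"
        unfolding sum_distrib_left sum.distrib[symmetric] by (intro sum.cong refl) (simp add: algebra_simps)
      then show ?thesis
        unfolding sel by (simp add: algebra_simps power2_eq_square)
    qed
    show "\<rho> x t * (et x t - \<kappa> * e (x, t)) -
           (\<Sum>i\<in>Basis. \<Sum>j\<in>Basis. a t i j * (\<rho> x t * ((e2 t x i j + p * \<delta> j * e1 t i x)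
            + p * \<delta> i * (e1 t j x + p * \<delta> j * e (x, t))))) +
           (\<Sum>i\<in>Basis. (b t i + p * (a t i n + a t n i)) * (\<rho> x t * (e1 t i x + p * \<delta> i * e (x, t)))) +
           (c t + \<kappa> - p * b t n - p\<^sup>2 * a t n n) * (case (x, t) of (x, t) \<Rightarrow> \<rho> x t * e (x, t)) =
           (case (x, t) of (x, t) \<Rightarrow> \<rho> x t * F (x, t))"
      unfolding A B prod.case e'(4)[symmetric] by (simp only: algebra_simps)
  qed
qed

section \<open>Maximum and monotonicity principles in a slab\<close>

text \<open>Translation invariance, the consequence of coefficients that do not depend on \<open>x\<close> on
which the two-point argument below rests.\<close>

lemma parabolic_solution_translate:
  assumes "parabolic_solution a b c F Q T v" "\<And>x. x \<in> S \<Longrightarrow> P + x \<in> Q"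
  shows "parabolic_solution a b c (\<lambda>(x, t). F (P + x, t)) S T (\<lambda>(x, t). v (P + x, t))"
proof -
  obtain vt v1 v2 where v:
    "\<And>x t. x \<in> Q \<Longrightarrow> t \<in> {0<..<T} \<Longrightarrow> ((\<lambda>s. v (x, s)) has_field_derivative vt x t) (at t)"
    "\<And>x t. x \<in> Q \<Longrightarrow> t \<in> {0<..<T} \<Longrightarrow>
       ((\<lambda>y. v (y, t)) has_derivative (\<lambda>h. \<Sum>i\<in>Basis. (h \<bullet> i) * v1 t i x)) (at x)"
    "\<And>x t j. x \<in> Q \<Longrightarrow> t \<in> {0<..<T} \<Longrightarrow> j \<in> Basis \<Longrightarrow>
       (v1 t j has_derivative (\<lambda>h. \<Sum>i\<in>Basis. (h \<bullet> i) * v2 t x i j)) (at x)"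
    "\<And>x t. x \<in> Q \<Longrightarrow> t \<in> {0<..<T} \<Longrightarrow>
       vt x t - (\<Sum>i\<in>Basis. \<Sum>j\<in>Basis. a t i j * v2 t x i j)
         + (\<Sum>i\<in>Basis. b t i * v1 t i x) + c t * v (x, t) = F (x, t)"
    using parabolic_solutionE[OF assms(1)] by blast
  have tr: "((\<lambda>x. g (P + x)) has_derivative g') (at x)" if "(g has_derivative g') (at (P + x))"
    for g :: "'a \<Rightarrow> real" and g' x
    by (rule has_derivative_compose[of "\<lambda>x. P + x" "\<lambda>h. h" x UNIV g g'])
       (use that in \<open>auto intro!: derivative_eq_intros\<close>)
  show ?thesis
    unfolding parabolic_solution_def prod.case
  proof (rule exI[of _ "\<lambda>x. vt (P + x)"], rule exI[of _ "\<lambda>t i x. v1 t i (P + x)"],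
      rule exI[of _ "\<lambda>t x. v2 t (P + x)"], intro ballI conjI)
    fix x t assume x: "x \<in> S" and t: "t \<in> {0<..<T}"
    note xt = assms(2)[OF x] t
    show "((\<lambda>s. v (P + x, s)) has_real_derivative vt (P + x) t) (at t)"
      by (rule v(1)[OF xt])
    show "((\<lambda>x. v (P + x, t)) has_derivative (\<lambda>h. \<Sum>i\<in>Basis. h \<bullet> i * v1 t i (P + x))) (at x)"
      by (rule tr[OF v(2)[OF xt]])
    show "((\<lambda>x. v1 t j (P + x)) has_derivative (\<lambda>h. \<Sum>i\<in>Basis. h \<bullet> i * v2 t (P + x) i j)) (at x)"
      if "j \<in> Basis" for j
      by (rule tr[OF v(3)[OF xt that]])
    show "vt (P + x) t - (\<Sum>i\<in>Basis. \<Sum>j\<in>Basis. a t i j * v2 t (P + x) i j) +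
           (\<Sum>i\<in>Basis. b t i * v1 t i (P + x)) + c t * v (P + x, t) = F (P + x, t)"
      by (rule v(4)[OF xt])
  qed
qed

definition elliptic :: "('a::euclidean_space \<Rightarrow> 'a \<Rightarrow> real) \<Rightarrow> bool" where
  "elliptic A \<longleftrightarrow> (\<forall>i\<in>Basis. \<forall>j\<in>Basis. A i j = A j i) \<and>
     (\<forall>\<xi>. \<xi> \<noteq> 0 \<longrightarrow> (\<Sum>i\<in>Basis. \<Sum>j\<in>Basis. A i j * (\<xi> \<bullet> i) * (\<xi> \<bullet> j)) > 0)"

text \<open>At a maximum over earlier times and nearby points the gradient vanishes, the second-order term is
of one sign and the time derivative is nonnegative; only the zeroth-order term is left to balance
the source.\<close>

lemma parabolic_solution_at_max:
  fixes v :: "'a::euclidean_space \<times> real \<Rightarrow> real"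
  assumes sol: "parabolic_solution a b c F Q T v"
    and "open Q" "x0 \<in> Q" "t \<in> {0<..<T}" and ell: "elliptic (a t)"
    and space_max: "\<And>x. x \<in> Q \<Longrightarrow> v (x, t) \<le> v (x0, t)"
    and time_max: "\<And>s. 0 < s \<Longrightarrow> s < t \<Longrightarrow> v (x0, s) \<le> v (x0, t)"
  shows "c t * v (x0, t) \<le> F (x0, t)"
proof -
  obtain vt v1 v2 where v:
    "\<And>x t. x \<in> Q \<Longrightarrow> t \<in> {0<..<T} \<Longrightarrow> ((\<lambda>s. v (x, s)) has_field_derivative vt x t) (at t)"
    "\<And>x t. x \<in> Q \<Longrightarrow> t \<in> {0<..<T} \<Longrightarrow>
       ((\<lambda>y. v (y, t)) has_derivative (\<lambda>h. \<Sum>i\<in>Basis. (h \<bullet> i) * v1 t i x)) (at x)"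
    "\<And>x t j. x \<in> Q \<Longrightarrow> t \<in> {0<..<T} \<Longrightarrow> j \<in> Basis \<Longrightarrow>
       (v1 t j has_derivative (\<lambda>h. \<Sum>i\<in>Basis. (h \<bullet> i) * v2 t x i j)) (at x)"
    "\<And>x t. x \<in> Q \<Longrightarrow> t \<in> {0<..<T} \<Longrightarrow>
       vt x t - (\<Sum>i\<in>Basis. \<Sum>j\<in>Basis. a t i j * v2 t x i j)
         + (\<Sum>i\<in>Basis. b t i * v1 t i x) + c t * v (x, t) = F (x, t)"
    using parabolic_solutionE[OF sol] by blast
  note xt = \<open>x0 \<in> Q\<close> \<open>t \<in> {0<..<T}\<close>
  note second = local_max_second_order[OF \<open>open Q\<close> \<open>x0 \<in> Q\<close>, of "\<lambda>x. v (x, t)" "v1 t" "v2 t x0",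
      OF v(2)[OF _ xt(2)] v(3)[OF xt] space_max]
  have "(\<Sum>i\<in>Basis. \<Sum>j\<in>Basis. a t i j * v2 t x0 i j) \<le> 0"
  proof (rule trace_product_nonpos)
    show "a t i j = a t j i" if "i \<in> Basis" "j \<in> Basis" for i j
      using ell that by (auto simp: elliptic_def)
    show "0 < (\<Sum>i\<in>Basis. \<Sum>j\<in>Basis. a t i j * \<xi> i * \<xi> j)" if "\<exists>i\<in>Basis. \<xi> i \<noteq> 0" for \<xi> :: "'a \<Rightarrow> real"
    proof -
      define X where "X = (\<Sum>i\<in>Basis. \<xi> i *\<^sub>R (i::'a))"
      have Xi: "X \<bullet> i = \<xi> i" if "i \<in> Basis" for i
        unfolding X_def using that by (rule inner_sum_left_Basis)
      then have "X \<noteq> 0" using that by auto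
      then have "(\<Sum>i\<in>Basis. \<Sum>j\<in>Basis. a t i j * (X \<bullet> i) * (X \<bullet> j)) > 0"
        using ell by (auto simp: elliptic_def)
      then show ?thesis by (simp add: Xi)
    qed
    show "(\<Sum>i\<in>Basis. \<Sum>j\<in>Basis. v2 t x0 i j * \<xi> i * \<xi> j) \<le> 0" for \<xi>
      by (rule second(2))
  qed simp
  moreover have "(\<Sum>i\<in>Basis. b t i * v1 t i x0) = 0"
    by (rule sum.neutral) (simp add: second(1))
  moreover have "vt x0 t \<ge> 0"
  proof (rule ccontr)
    \<comment> \<open>only earlier times are compared, so the maximum may be taken at the end of a time interval\<close>
    assume "\<not> vt x0 t \<ge> 0"
    then obtain d where d: "d > 0" "\<And>h. 0 < h \<Longrightarrow> h < d \<Longrightarrow> v (x0, t) < v (x0, t - h)"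
      using DERIV_neg_dec_left[OF v(1)[OF xt]] by auto
    define h where "h = min d t / 2"
    have "0 < h" "h < d" "h < t" using d(1) xt(2) by (auto simp: h_def)
    then show False using d(2)[of h] time_max[of "t - h"] by auto
  qed
  ultimately show ?thesis using v(4)[OF xt] by linarith
qed

text \<open>At the two flat faces a one-sided derivative pointing in the right direction can replace a bound for
the value: it excludes a maximum there.  Its mere existence at each point is enough, and no
continuity of the gradient up to the face is involved.  This is what makes Robin conditions that
hold only pointwise usable.\<close>

lemma weak_maximum_principle:
  fixes D :: "'a::euclidean_space set" and m :: "('a \<times> real) \<times> real \<Rightarrow> real"
  assumes D: "open D" "bounded D" and lohi: "lo < hi"
    and ell: "\<And>t. t \<in> {0<..<T} \<Longrightarrow> elliptic (a t)" and c: "\<And>t. t \<in> {0<..<T} \<Longrightarrow> c t > 0"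
    and sol: "parabolic_solution a b c F (D \<times> {lo<..<hi}) T m"
    and src: "\<And>X s t. X \<in> D \<Longrightarrow> s \<in> {lo<..<hi} \<Longrightarrow> t \<in> {0<..<T} \<Longrightarrow> F ((X, s), t) \<le> 0"
    and cont: "continuous_on ((closure D \<times> {lo..hi}) \<times> {0..<T}) m"
    and init: "\<And>X s. X \<in> closure D \<Longrightarrow> s \<in> {lo..hi} \<Longrightarrow> m ((X, s), 0) \<le> 0"
    and lat: "\<And>X s t. X \<in> frontier D \<Longrightarrow> s \<in> {lo..hi} \<Longrightarrow> t \<in> {0<..<T} \<Longrightarrow> m ((X, s), t) \<le> 0"
    and bot: "\<And>X t. X \<in> D \<Longrightarrow> t \<in> {0<..<T} \<Longrightarrow> m ((X, lo), t) \<le> 0 \<or>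
       (\<exists>d>0. ((\<lambda>s. m ((X, s), t)) has_field_derivative d) (at lo within {lo..hi}))"
    and top: "\<And>X t. X \<in> D \<Longrightarrow> t \<in> {0<..<T} \<Longrightarrow> m ((X, hi), t) \<le> 0 \<or>
       (\<exists>d<0. ((\<lambda>s. m ((X, s), t)) has_field_derivative d) (at hi within {lo..hi}))"
    and X: "X \<in> closure D" and s: "s \<in> {lo..hi}" and t: "t \<in> {0..<T}"
  shows "m ((X, s), t) \<le> 0"
proof (rule ccontr)
  assume "\<not> m ((X, s), t) \<le> 0"
  then have pos: "m ((X, s), t) > 0" by simp
  define K where "K = (closure D \<times> {lo..hi}) \<times> {0..t}"
  have "compact K" unfolding K_def using D by (intro compact_Times compact_Icc) auto
  moreover have "((X, s), t) \<in> K" using X s t by (auto simp: K_def)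
  moreover have "continuous_on K m"
    by (rule continuous_on_subset[OF cont]) (use t in \<open>auto simp: K_def\<close>)
  ultimately obtain z where z: "z \<in> K" "\<And>y. y \<in> K \<Longrightarrow> m y \<le> m z"
    using continuous_attains_sup[of K m] by blast
  obtain X0 s0 t0 where z0: "z = ((X0, s0), t0)" by (metis surj_pair)
  have K0: "X0 \<in> closure D" "s0 \<in> {lo..hi}" "t0 \<in> {0..t}" using z(1) by (auto simp: K_def z0)
  have max: "m ((X', s'), t') \<le> m ((X0, s0), t0)" if "X' \<in> closure D" "s' \<in> {lo..hi}" "t' \<in> {0..t}" for X' s' t'
    using z(2) that by (auto simp: K_def z0)
  have pos0: "m ((X0, s0), t0) > 0" using max[OF X s] t pos by force
  have t0: "t0 \<in> {0<..<T}"
    using init[OF K0(1,2)] K0(3) t pos0 by (cases "t0 = 0") auto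
  have X0: "X0 \<in> D"
    using lat[OF _ K0(2) t0, of X0] K0(1) pos0 closure_Un_frontier[of D] by force
  have s0: "s0 \<in> {lo<..<hi}"
  proof -
    have "s0 \<noteq> lo"
    proof
      assume "s0 = lo"
      with bot[OF X0 t0] pos0 obtain d where d: "d > 0"
        "((\<lambda>s. m ((X0, s), t0)) has_field_derivative d) (at lo within {lo..hi})" by auto
      obtain e where e: "e > 0" "\<And>h. 0 < h \<Longrightarrow> lo + h \<in> {lo..hi} \<Longrightarrow> h < e \<Longrightarrow> m ((X0, lo), t0) < m ((X0, lo + h), t0)"
        using has_real_derivative_pos_inc_right[OF d(2,1)] by auto
      define h where "h = min e (hi - lo) / 2"
      have "0 < h" "h < e" "h < hi - lo" using e(1) lohi by (auto simp: h_def)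
      then show False using e(2)[of h] max[of X0 "lo + h" t0] K0 \<open>s0 = lo\<close> by auto
    qed
    moreover have "s0 \<noteq> hi"
    proof
      assume "s0 = hi"
      with top[OF X0 t0] pos0 obtain d where d: "d < 0"
        "((\<lambda>s. m ((X0, s), t0)) has_field_derivative d) (at hi within {lo..hi})" by auto
      obtain e where e: "e > 0" "\<And>h. 0 < h \<Longrightarrow> hi - h \<in> {lo..hi} \<Longrightarrow> h < e \<Longrightarrow> m ((X0, hi), t0) < m ((X0, hi - h), t0)"
        using has_real_derivative_neg_dec_left[OF d(2,1)] by auto
      define h where "h = min e (hi - lo) / 2"
      have "0 < h" "h < e" "h < hi - lo" using e(1) lohi by (auto simp: h_def)
      then show False using e(2)[of h] max[of X0 "hi - h" t0] K0 \<open>s0 = hi\<close> by auto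
    qed
    ultimately show ?thesis using K0(2) by auto
  qed
  have "c t0 * m ((X0, s0), t0) \<le> F ((X0, s0), t0)"
  proof (rule parabolic_solution_at_max[OF sol _ _ t0 ell[OF t0]])
    show "open (D \<times> {lo<..<hi})" using D by (intro open_Times) auto
    show "(X0, s0) \<in> D \<times> {lo<..<hi}" using X0 s0 by auto
    show "m (x, t0) \<le> m ((X0, s0), t0)" if "x \<in> D \<times> {lo<..<hi}" for x
    proof -
      obtain X' s' where x: "x = (X', s')" by force
      show ?thesis unfolding x by (rule max) (use that x K0 closure_subset[of D] in auto)
    qed
    show "m ((X0, s0), r) \<le> m ((X0, s0), t0)" if "0 < r" "r < t0" for r
      by (rule max) (use K0 that in auto)
  qed
  then show False using src[OF X0 s0 t0] mult_pos_pos[OF c[OF t0] pos0] by linarith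
qed

text \<open>The gradient bound without gradients.  One maximises \<open>m ((X, x), t) - m ((X, y), t)\<close> over \<open>y \<le> x\<close>.
Moving both points by the same vector preserves this constraint as well as the equation, so at an
interior maximum the difference of two translates of \<open>m\<close> solves an equation whose source has the
wrong sign.  At a face one of the two points can be moved alone, and a negative one-sided derivative
excludes the maximum.\<close>

lemma monotonicity_principle:
  fixes D :: "'a::euclidean_space set" and m :: "('a \<times> real) \<times> real \<Rightarrow> real"
  assumes D: "open D" "bounded D" and lohi: "lo < hi"
    and ell: "\<And>t. t \<in> {0<..<T} \<Longrightarrow> elliptic (a t)" and c: "\<And>t. t \<in> {0<..<T} \<Longrightarrow> c t > 0"
    and sol: "parabolic_solution a b c F (D \<times> {lo<..<hi}) T m"
    and src: "\<And>X x y t. X \<in> D \<Longrightarrow> lo < y \<Longrightarrow> y < x \<Longrightarrow> x < hi \<Longrightarrow> t \<in> {0<..<T} \<Longrightarrow> F ((X, x), t) \<le> F ((X, y), t)"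
    and cont: "continuous_on ((closure D \<times> {lo..hi}) \<times> {0..<T}) m"
    and init: "\<And>X x y. X \<in> closure D \<Longrightarrow> lo \<le> y \<Longrightarrow> y < x \<Longrightarrow> x \<le> hi \<Longrightarrow> m ((X, x), 0) \<le> m ((X, y), 0)"
    and lat: "\<And>X x y t. X \<in> frontier D \<Longrightarrow> lo \<le> y \<Longrightarrow> y < x \<Longrightarrow> x \<le> hi \<Longrightarrow> t \<in> {0<..<T} \<Longrightarrow>
       m ((X, x), t) \<le> m ((X, y), t)"
    and bot: "\<And>X t. X \<in> D \<Longrightarrow> t \<in> {0<..<T} \<Longrightarrow> (\<forall>x\<in>{lo..hi}. m ((X, x), t) \<le> m ((X, lo), t)) \<or>
       (\<exists>d<0. ((\<lambda>s. m ((X, s), t)) has_field_derivative d) (at lo within {lo..hi}))"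
    and top: "\<And>X t. X \<in> D \<Longrightarrow> t \<in> {0<..<T} \<Longrightarrow> (\<forall>y\<in>{lo..hi}. m ((X, hi), t) \<le> m ((X, y), t)) \<or>
       (\<exists>d<0. ((\<lambda>s. m ((X, s), t)) has_field_derivative d) (at hi within {lo..hi}))"
    and X: "X \<in> closure D" and xy: "lo \<le> y" "y \<le> x" "x \<le> hi" and t: "t \<in> {0..<T}"
  shows "m ((X, x), t) \<le> m ((X, y), t)"
proof (rule ccontr)
  assume "\<not> m ((X, x), t) \<le> m ((X, y), t)"
  then have pos: "m ((X, x), t) - m ((X, y), t) > 0" by simp
  define K where "K = (closure D \<times> {lo..hi} \<times> {lo..hi} \<times> {0..t}) \<inter> {(X, x, y, t). y \<le> x}"
  define Z where "Z = (\<lambda>(X, x, y, t). m ((X, x), t) - m ((X, y), t))"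
  have "closed {(X :: 'a, x :: real, y, t :: real). y \<le> x}"
    by (simp add: case_prod_unfold) (intro closed_Collect_le continuous_intros)
  then have "compact K" unfolding K_def using D by (intro compact_Int_closed compact_Times compact_Icc) auto
  moreover have "(X, x, y, t) \<in> K" using X xy t by (auto simp: K_def)
  moreover have "continuous_on K Z"
    unfolding Z_def case_prod_unfold
    by (intro continuous_on_diff continuous_on_compose2[OF cont] continuous_intros) (use t in \<open>auto simp: K_def\<close>)
  ultimately obtain z where z: "z \<in> K" "\<And>y. y \<in> K \<Longrightarrow> Z y \<le> Z z"
    using continuous_attains_sup[of K Z] by blast
  obtain X0 x0 y0 t0 where z0: "z = (X0, x0, y0, t0)" by (metis surj_pair)
  have K0: "X0 \<in> closure D" "x0 \<in> {lo..hi}" "y0 \<in> {lo..hi}" "y0 \<le> x0" "t0 \<in> {0..t}"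
    using z(1) by (auto simp: K_def z0)
  have max: "m ((X', x'), t') - m ((X', y'), t') \<le> m ((X0, x0), t0) - m ((X0, y0), t0)"
    if "X' \<in> closure D" "lo \<le> y'" "y' \<le> x'" "x' \<le> hi" "t' \<in> {0..t}" for X' x' y' t'
    using z(2)[of "(X', x', y', t')"] that by (auto simp: K_def Z_def z0)
  have pos0: "m ((X0, x0), t0) - m ((X0, y0), t0) > 0" using max[OF X xy] t pos by force
  have yx: "y0 < x0" using pos0 K0(4) by (cases "y0 = x0") auto
  have t0: "t0 \<in> {0<..<T}"
    using init[OF K0(1), of y0 x0] yx K0 t pos0 by (cases "t0 = 0") auto
  have X0: "X0 \<in> D"
    using lat[of X0 y0 x0 t0, OF _ _ yx _ t0] K0 pos0 closure_Un_frontier[of D] by force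
  have y0: "lo < y0"
  proof (rule ccontr)
    assume "\<not> lo < y0"
    then have ylo: "y0 = lo" using K0 by auto
    with bot[OF X0 t0] pos0 K0(2) obtain d where d: "d < 0"
      "((\<lambda>s. m ((X0, s), t0)) has_field_derivative d) (at lo within {lo..hi})" by fastforce
    obtain e where e: "e > 0" "\<And>h. 0 < h \<Longrightarrow> lo + h \<in> {lo..hi} \<Longrightarrow> h < e \<Longrightarrow> m ((X0, lo), t0) > m ((X0, lo + h), t0)"
      using has_real_derivative_neg_dec_right[OF d(2,1)] by auto
    define h where "h = min e (x0 - lo) / 2"
    have "0 < h" "h < e" "h < x0 - lo" using e(1) yx ylo by (auto simp: h_def)
    then show False using e(2)[of h] max[of X0 "lo + h" x0 t0] K0 ylo by auto
  qed
  have x0: "x0 < hi"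
  proof (rule ccontr)
    assume "\<not> x0 < hi"
    then have xhi: "x0 = hi" using K0 by auto
    with top[OF X0 t0] pos0 K0(3) obtain d where d: "d < 0"
      "((\<lambda>s. m ((X0, s), t0)) has_field_derivative d) (at hi within {lo..hi})" by fastforce
    obtain e where e: "e > 0" "\<And>h. 0 < h \<Longrightarrow> hi - h \<in> {lo..hi} \<Longrightarrow> h < e \<Longrightarrow> m ((X0, hi), t0) < m ((X0, hi - h), t0)"
      using has_real_derivative_neg_dec_left[OF d(2,1)] by auto
    define h where "h = min e (hi - y0) / 2"
    have "0 < h" "h < e" "h < hi - y0" using e(1) yx xhi by (auto simp: h_def)
    then show False using e(2)[of h] max[of X0 y0 "hi - h" t0] K0 xhi by auto
  qed
  \<comment> \<open>the admissible common displacements of the two points\<close>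
  define S where "S = {\<zeta>. X0 + fst \<zeta> \<in> D \<and> lo < y0 + snd \<zeta> \<and> x0 + snd \<zeta> < (hi::real)}"
  have S: "(X0, x0) + \<zeta> \<in> D \<times> {lo<..<hi}" "(X0, y0) + \<zeta> \<in> D \<times> {lo<..<hi}" if "\<zeta> \<in> S" for \<zeta>
    using that yx by (auto simp: S_def plus_prod_def)
  have sub: "parabolic_solution a b c
      (\<lambda>z. (\<lambda>(\<zeta>, t). F ((X0, x0) + \<zeta>, t)) z - (\<lambda>(\<zeta>, t). F ((X0, y0) + \<zeta>, t)) z) S T
      (\<lambda>z. (\<lambda>(\<zeta>, t). m ((X0, x0) + \<zeta>, t)) z - (\<lambda>(\<zeta>, t). m ((X0, y0) + \<zeta>, t)) z)"
    by (intro parabolic_solution_diff parabolic_solution_translate[OF sol] S)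
  have "open S"
  proof -
    have "S = ((\<lambda>\<zeta>. X0 + fst \<zeta>) -` D) \<inter> {\<zeta>. lo < y0 + snd \<zeta>} \<inter> {\<zeta>. x0 + snd \<zeta> < hi}"
      by (auto simp: S_def)
    moreover have "open ((\<lambda>\<zeta>::'a \<times> real. X0 + fst \<zeta>) -` D)"
      by (intro open_vimage D continuous_intros)
    ultimately show ?thesis by (auto intro!: open_Collect_less continuous_intros)
  qed
  have zero: "0 \<in> S" using X0 y0 x0 by (auto simp: S_def)
  have space: "m ((X0, x0) + \<zeta>, t0) - m ((X0, y0) + \<zeta>, t0) \<le> m ((X0, x0), t0) - m ((X0, y0), t0)"
    if "\<zeta> \<in> S" for \<zeta>
  proof -
    obtain p q where \<zeta>: "\<zeta> = (p, q)" by force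
    show ?thesis using max[of "X0 + p" "y0 + q" "x0 + q" t0] that K0 yx closure_subset[of D]
      by (auto simp: \<zeta> S_def)
  qed
  have time: "m ((X0, x0), r) - m ((X0, y0), r) \<le> m ((X0, x0), t0) - m ((X0, y0), t0)"
    if "0 < r" "r < t0" for r
    by (rule max) (use K0 that in auto)
  have "c t0 * (m ((X0, x0), t0) - m ((X0, y0), t0)) \<le> F ((X0, x0), t0) - F ((X0, y0), t0)"
    using parabolic_solution_at_max[OF sub \<open>open S\<close> zero t0 ell[OF t0]] space time by simp
  then show False
    using src[OF X0 y0 yx x0 t0] mult_pos_pos[OF c[OF t0] pos0] by linarith
qed

section \<open>Slab estimates from hyperbolic barriers\<close>

lemma abs_sinh_le_cosh: "\<bar>sinh x\<bar> \<le> cosh (x::real)"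
  by (auto simp: abs_le_iff sinh_def cosh_def)

lemma cosh_less_at_ends:
  fixes \<mu> :: real
  assumes "\<mu> > 0" "lo < s" "s < hi"
  shows "cosh (\<mu> * (s - (lo + hi) / 2)) < cosh (\<mu> * (hi - lo) / 2)"
proof -
  have "\<bar>s - (lo + hi) / 2\<bar> < (hi - lo) / 2" using assms by (simp add: abs_less_iff field_simps)
  then have "\<bar>\<mu> * (s - (lo + hi) / 2)\<bar> < \<mu> * (hi - lo) / 2"
    using assms(1) mult_strict_left_mono[of "\<bar>s - (lo + hi) / 2\<bar>" "(hi - lo) / 2" \<mu>] by (simp add: abs_mult)
  then show ?thesis
    using cosh_real_nonneg_less_iff[of "\<bar>\<mu> * (s - (lo + hi) / 2)\<bar>" "\<mu> * (hi - lo) / 2"] by simp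
qed

text \<open>The comparison arguments need strict inequalities at the faces; this removes the strictness.\<close>

lemma ge_from_strictly_larger:
  fixes q r C :: real
  assumes "\<And>M. M > C \<Longrightarrow> q \<le> M * r"
  shows "q \<le> C * r"
proof (rule tendsto_lowerbound)
  show "((\<lambda>M. M * r) \<longlongrightarrow> C * r) (at_right C)" by (intro tendsto_intros)
  show "\<forall>\<^sub>F M in at_right C. q \<le> M * r"
    using assms by (simp add: eventually_at_filter)
qed simp

abbreviation (input) e\<^sub>n :: "'a::euclidean_space \<times> real" where "e\<^sub>n \<equiv> (0, 1)"

lemma e\<^sub>n_Basis: "e\<^sub>n \<in> (Basis :: ('a::euclidean_space \<times> real) set)"
  by (auto simp: Basis_prod_def)

text \<open>The barrier is \<open>\<eta>(s) = cosh (\<mu> (s - mid))\<close> with \<open>mid\<close> the midpoint of the interval, and \<open>\<Gamma>\<close>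
is a primitive of it.  Three properties are needed.  The zeroth-order coefficient absorbs the other
terms of the operator on \<open>\<eta>\<close> (\<open>absorb\<close>).  The slope of \<open>\<eta>\<close> at the ends dominates the drift,
which makes \<open>\<Gamma> - \<Gamma> lo\<close> a supersolution near a Dirichlet face (\<open>steep\<close>).  The same slope exceeds
fluxes of size \<open>cosh h\<close>, so that \<open>\<eta>\<close> is a barrier for the solution itself (\<open>steep'\<close>).  Since \<open>\<eta>\<close> is strictly larger at
the ends than inside, every bound proportional to \<open>\<eta>\<close> gains a factor less than one when it is read
off at an interior point.\<close>

locale cosh_barrier =
  fixes D :: "'a::euclidean_space set" and lo hi T \<mu> :: real
    and a :: "real \<Rightarrow> 'a \<times> real \<Rightarrow> 'a \<times> real \<Rightarrow> real" and b :: "real \<Rightarrow> 'a \<times> real \<Rightarrow> real" and c :: "real \<Rightarrow> real"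
  assumes D: "open D" "bounded D" and lohi: "lo < hi" and \<mu>: "\<mu> > 0"
    and ell: "\<And>t. t \<in> {0<..<T} \<Longrightarrow> elliptic (a t)"
    and absorb: "\<And>t. t \<in> {0<..<T} \<Longrightarrow> a t e\<^sub>n e\<^sub>n * \<mu>\<^sup>2 + \<bar>b t e\<^sub>n\<bar> * \<mu> + 1 \<le> c t"
    and steep: "\<And>t. t \<in> {0<..<T} \<Longrightarrow>
      (\<bar>b t e\<^sub>n\<bar> + 1) * cosh (\<mu> * (hi - lo) / 2) \<le> a t e\<^sub>n e\<^sub>n * (\<mu> * sinh (\<mu> * (hi - lo) / 2))"
    and steep': "2 * cosh (\<mu> * (hi - lo) / 2) \<le> \<mu> * sinh (\<mu> * (hi - lo) / 2)"
begin

abbreviation h where "h \<equiv> \<mu> * (hi - lo) / 2"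
definition \<eta> where "\<eta> s = cosh (\<mu> * (s - (lo + hi) / 2))"
definition \<Gamma> where "\<Gamma> s = sinh (\<mu> * (s - (lo + hi) / 2)) / \<mu>"
definition \<eta>1 where "\<eta>1 s = \<mu> * sinh (\<mu> * (s - (lo + hi) / 2))"
text \<open>The operator applied to \<open>\<Gamma>\<close>.\<close>

definition LG where "LG s t = - a t e\<^sub>n e\<^sub>n * \<eta>1 s + b t e\<^sub>n * \<eta> s + c t * \<Gamma> s"

lemma \<eta>_ge_1: "\<eta> s \<ge> 1" by (simp add: \<eta>_def cosh_real_ge_1)
lemma D\<Gamma>: "(\<Gamma> has_field_derivative \<eta> s) (at s within A)"
  unfolding \<Gamma>_def[abs_def] \<eta>_def using \<mu> by (auto intro!: derivative_eq_intros)
lemma D\<eta>: "(\<eta> has_field_derivative \<eta>1 s) (at s within A)"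
  unfolding \<eta>_def[abs_def] \<eta>1_def by (auto intro!: derivative_eq_intros)
lemma D\<eta>1: "(\<eta>1 has_field_derivative \<mu>\<^sup>2 * \<eta> s) (at s within A)"
  unfolding \<eta>1_def[abs_def] \<eta>_def by (auto intro!: derivative_eq_intros simp: power2_eq_square)

lemma args: "\<mu> * (lo - (lo + hi) / 2) = - h" "\<mu> * (hi - (lo + hi) / 2) = h"
  by (simp_all add: field_simps)

lemma ends: "\<eta> lo = cosh h" "\<eta> hi = cosh h" "\<eta>1 lo = - (\<mu> * sinh h)" "\<eta>1 hi = \<mu> * sinh h"
  unfolding \<eta>_def \<eta>1_def args by simp_all

lemma \<Gamma>_mono: "y \<le> x \<Longrightarrow> \<Gamma> y \<le> \<Gamma> x"
  using \<mu> by (auto simp: \<Gamma>_def divide_right_mono)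

lemma operator_on_\<eta>:
  assumes "t \<in> {0<..<T}"
  shows "- a t e\<^sub>n e\<^sub>n * (\<mu>\<^sup>2 * \<eta> s) + b t e\<^sub>n * \<eta>1 s + c t * \<eta> s \<ge> 1"
proof -
  define S where "S = sinh (\<mu> * (s - (lo + hi) / 2))"
  have S: "\<bar>S\<bar> \<le> \<eta> s" unfolding S_def \<eta>_def by (rule abs_sinh_le_cosh)
  have "\<bar>b t e\<^sub>n * (\<mu> * S)\<bar> \<le> \<bar>b t e\<^sub>n\<bar> * \<mu> * \<eta> s"
    using S \<mu> by (simp add: abs_mult mult.assoc mult_left_mono)
  moreover have "(a t e\<^sub>n e\<^sub>n * \<mu>\<^sup>2 + \<bar>b t e\<^sub>n\<bar> * \<mu> + 1) * \<eta> s \<le> c t * \<eta> s"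
    using absorb[OF assms] \<eta>_ge_1[of s] by (intro mult_right_mono) auto
  moreover have "\<eta>1 s = \<mu> * S" by (simp add: \<eta>1_def S_def)
  ultimately show ?thesis
    using \<eta>_ge_1[of s] by (simp add: algebra_simps abs_le_iff)
qed

text \<open>The derivative in \<open>s\<close> of the operator applied to \<open>\<Gamma>\<close> is the operator applied to \<open>\<eta>\<close>.\<close>

lemma LG_increasing:
  assumes t: "t \<in> {0<..<T}" and "y \<le> x"
  shows "x - y \<le> LG x t - LG y t"
proof -
  have "LG y t - y \<le> LG x t - x"
  proof (rule DERIV_nonneg_imp_nondecreasing[OF \<open>y \<le> x\<close>])
    fix s
    have "((\<lambda>s. LG s t - s) has_field_derivative
       (- a t e\<^sub>n e\<^sub>n * (\<mu>\<^sup>2 * \<eta> s) + b t e\<^sub>n * \<eta>1 s + c t * \<eta> s) - 1) (at s)"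
      unfolding LG_def by (auto intro!: derivative_eq_intros D\<Gamma> D\<eta> D\<eta>1)
    then show "\<exists>d. ((\<lambda>s. LG s t - s) has_field_derivative d) (at s) \<and> 0 \<le> d"
      using operator_on_\<eta>[OF t, of s] by fastforce
  qed
  then show ?thesis by simp
qed

text \<open>At a face where \<open>\<Gamma>\<close> is normalised to vanish, the zeroth-order term is no help, and the
second-order term has to beat the drift on its own.\<close>

lemma outward_flux:
  assumes t: "t \<in> {0<..<T}"
  shows "- a t e\<^sub>n e\<^sub>n * \<eta>1 lo + b t e\<^sub>n * \<eta> lo \<ge> 1"
    and "a t e\<^sub>n e\<^sub>n * \<eta>1 hi - b t e\<^sub>n * \<eta> hi \<ge> 1"
proof -
  have c1: "cosh h \<ge> 1" by (rule cosh_real_ge_1)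
  have "\<bar>b t e\<^sub>n * cosh h\<bar> = \<bar>b t e\<^sub>n\<bar> * cosh h" using c1 by (simp add: abs_mult)
  then have "b t e\<^sub>n * cosh h \<ge> - \<bar>b t e\<^sub>n\<bar> * cosh h" "b t e\<^sub>n * cosh h \<le> \<bar>b t e\<^sub>n\<bar> * cosh h" by linarith+
  moreover have "\<bar>b t e\<^sub>n\<bar> * cosh h + cosh h \<le> a t e\<^sub>n e\<^sub>n * (\<mu> * sinh h)"
    using steep[OF t] by (simp only: distrib_right mult_1)
  ultimately show "- a t e\<^sub>n e\<^sub>n * \<eta>1 lo + b t e\<^sub>n * \<eta> lo \<ge> 1" "a t e\<^sub>n e\<^sub>n * \<eta>1 hi - b t e\<^sub>n * \<eta> hi \<ge> 1"
    using c1 unfolding ends minus_mult_minus by linarith+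
qed

lemma c_pos: "t \<in> {0<..<T} \<Longrightarrow> c t > 0"
proof -
  assume t: "t \<in> {0<..<T}"
  have h0: "h > 0" using \<mu> lohi by simp
  have "0 < (\<bar>b t e\<^sub>n\<bar> + 1) * cosh h" by (intro mult_pos_pos) auto
  then have "0 < a t e\<^sub>n e\<^sub>n * (\<mu> * sinh h)" using steep[OF t] by linarith
  moreover have "0 < \<mu> * sinh h" using \<mu> h0 by (simp only: mult_pos_pos sinh_real_pos_iff)
  ultimately have "0 < a t e\<^sub>n e\<^sub>n" by (rule zero_less_mult_pos2)
  then show "c t > 0" using absorb[OF t] \<mu> by (smt (verit) abs_ge_zero mult_nonneg_nonneg zero_le_power2)
qed

text \<open>One constant measures the source, its variation in the normal direction and the prescribed
fluxes.  Fluxes are compared with \<open>cosh h\<close>, the value of \<open>\<eta>\<close> at the two ends.  Each face carries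
either a homogeneous Dirichlet condition or a flux bound.\<close>

definition data_bounded_by where
  "data_bounded_by C F v \<longleftrightarrow> 0 \<le> C \<and>
     parabolic_solution a b c F (D \<times> {lo<..<hi}) T v \<and>
     continuous_on ((closure D \<times> {lo..hi}) \<times> {0..<T}) v \<and>
     (\<forall>X\<in>closure D. \<forall>s\<in>{lo..hi}. v ((X, s), 0) = 0) \<and>
     (\<forall>X\<in>frontier D. \<forall>s\<in>{lo..hi}. \<forall>t\<in>{0<..<T}. v ((X, s), t) = 0) \<and>
     (\<forall>X\<in>D. \<forall>s\<in>{lo<..<hi}. \<forall>t\<in>{0<..<T}. \<bar>F ((X, s), t)\<bar> \<le> C) \<and>
     (\<forall>X\<in>D. \<forall>t\<in>{0<..<T}. \<forall>x\<in>{lo<..<hi}. \<forall>y\<in>{lo<..<hi}. \<bar>F ((X, x), t) - F ((X, y), t)\<bar> \<le> C * \<bar>x - y\<bar>) \<and>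
     (\<forall>s\<in>{lo, hi}. (\<forall>X\<in>D. \<forall>t\<in>{0<..<T}. v ((X, s), t) = 0) \<or>
       (\<forall>X\<in>D. \<forall>t\<in>{0<..<T}. \<exists>d. ((\<lambda>r. v ((X, r), t)) has_field_derivative d) (at s within {lo..hi}) \<and>
           \<bar>d\<bar> \<le> C * cosh h))"

lemma data_bounded_byD:
  assumes "data_bounded_by C F v"
  shows "0 \<le> C"
    and "parabolic_solution a b c F (D \<times> {lo<..<hi}) T v"
    and "continuous_on ((closure D \<times> {lo..hi}) \<times> {0..<T}) v"
    and "\<forall>X\<in>closure D. \<forall>s\<in>{lo..hi}. v ((X, s), 0) = 0"
    and "\<forall>X\<in>frontier D. \<forall>s\<in>{lo..hi}. \<forall>t\<in>{0<..<T}. v ((X, s), t) = 0"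
    and "\<forall>X\<in>D. \<forall>s\<in>{lo<..<hi}. \<forall>t\<in>{0<..<T}. \<bar>F ((X, s), t)\<bar> \<le> C"
    and "\<forall>X\<in>D. \<forall>t\<in>{0<..<T}. \<forall>x\<in>{lo<..<hi}. \<forall>y\<in>{lo<..<hi}. \<bar>F ((X, x), t) - F ((X, y), t)\<bar> \<le> C * \<bar>x - y\<bar>"
    and "\<forall>s\<in>{lo, hi}. (\<forall>X\<in>D. \<forall>t\<in>{0<..<T}. v ((X, s), t) = 0) \<or>
       (\<forall>X\<in>D. \<forall>t\<in>{0<..<T}. \<exists>d. ((\<lambda>r. v ((X, r), t)) has_field_derivative d) (at s within {lo..hi}) \<and>
           \<bar>d\<bar> \<le> C * cosh h)"
  using assms unfolding data_bounded_by_def by - (elim conjE, assumption)+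

lemma data_bounded_by_uminus:
  assumes "data_bounded_by C F v"
  shows "data_bounded_by C (\<lambda>z. - F z) (\<lambda>z. - v z)"
proof -
  have minus: "\<exists>d. ((\<lambda>r. - v ((X, r), t)) has_field_derivative d) (at s within {lo..hi}) \<and> \<bar>d\<bar> \<le> C * cosh h"
    if ex: "\<exists>d. ((\<lambda>r. v ((X, r), t)) has_field_derivative d) (at s within {lo..hi}) \<and> \<bar>d\<bar> \<le> C * cosh h" for X s t
  proof -
    obtain d where "((\<lambda>r. v ((X, r), t)) has_field_derivative d) (at s within {lo..hi})" "\<bar>d\<bar> \<le> C * cosh h"
      using ex by blast
    then show ?thesis by (intro exI[of _ "- d"]) (auto intro: DERIV_minus)
  qed
  have abs: "\<bar>- p - - q\<bar> = \<bar>p - q\<bar>" for p q :: real by simp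
  note old = data_bounded_byD[OF assms]
  show ?thesis
    unfolding data_bounded_by_def abs abs_minus_cancel neg_equal_0_iff_equal
  proof (intro conjI old parabolic_solution_uminus continuous_on_minus ballI)
    fix s assume s: "s \<in> {lo, hi}"
    show "(\<forall>X\<in>D. \<forall>t\<in>{0<..<T}. v ((X, s), t) = 0) \<or>
       (\<forall>X\<in>D. \<forall>t\<in>{0<..<T}. \<exists>d. ((\<lambda>r. - v ((X, r), t)) has_field_derivative d) (at s within {lo..hi}) \<and>
           \<bar>d\<bar> \<le> C * cosh h)"
      using bspec[OF old(8) s] minus by (elim disjE) (rule disjI1, assumption, rule disjI2, blast)
  qed
qed

lemma diff_profile:
  assumes v: "parabolic_solution a b c F Q T v"
    and 1: "\<And>s. (G has_field_derivative G1 s) (at s)"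
    and 2: "\<And>s. (G1 has_field_derivative G2 s) (at s)"
  shows "parabolic_solution a b c
    (\<lambda>(x, t). F (x, t) - (- a t e\<^sub>n e\<^sub>n * G2 (snd x) + b t e\<^sub>n * G1 (snd x) + c t * G (snd x))) Q T
    (\<lambda>(x, t). v (x, t) - G (snd x))"
  using parabolic_solution_diff[OF v parabolic_solution_profile[OF e\<^sub>n_Basis 1 2, of a b c Q T]]
  by (simp add: case_prod_unfold inner_prod_def)

lemma cont_diff_profile:
  assumes "continuous_on A v" "\<And>s. (G has_field_derivative G1 s) (at s)"
  shows "continuous_on A (\<lambda>(x :: 'a \<times> real, t :: real). v (x, t) - G (snd x))"
proof -
  have "continuous_on UNIV G" using assms(2) by (auto intro!: continuous_at_imp_continuous_on DERIV_isCont)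
  then show ?thesis unfolding case_prod_unfold using assms(1)
    by (auto intro!: continuous_intros continuous_on_compose2[of UNIV G])
qed

text \<open>In the comparisons that follow, \<open>M > C\<close> gives strict inequalities at faces with prescribed flux.\<close>

context
  fixes C M F v
  assumes data: "data_bounded_by C F v" and M: "M > C"
begin

lemma
  sol: "parabolic_solution a b c F (D \<times> {lo<..<hi}) T v" and
  cont: "continuous_on ((closure D \<times> {lo..hi}) \<times> {0..<T}) v" and
  init: "\<And>X s. X \<in> closure D \<Longrightarrow> s \<in> {lo..hi} \<Longrightarrow> v ((X, s), 0) = 0" and
  lat: "\<And>X s t. X \<in> frontier D \<Longrightarrow> s \<in> {lo..hi} \<Longrightarrow> t \<in> {0<..<T} \<Longrightarrow> v ((X, s), t) = 0" and
  FC: "\<And>X s t. X \<in> D \<Longrightarrow> s \<in> {lo<..<hi} \<Longrightarrow> t \<in> {0<..<T} \<Longrightarrow> \<bar>F ((X, s), t)\<bar> \<le> C" and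
  FL: "\<And>X t x y. X \<in> D \<Longrightarrow> t \<in> {0<..<T} \<Longrightarrow> x \<in> {lo<..<hi} \<Longrightarrow> y \<in> {lo<..<hi} \<Longrightarrow>
     \<bar>F ((X, x), t) - F ((X, y), t)\<bar> \<le> C * \<bar>x - y\<bar>" and
  ends_cond: "\<And>s. s \<in> {lo, hi} \<Longrightarrow> (\<forall>X\<in>D. \<forall>t\<in>{0<..<T}. v ((X, s), t) = 0) \<or>
       (\<forall>X\<in>D. \<forall>t\<in>{0<..<T}. \<exists>d. ((\<lambda>r. v ((X, r), t)) has_field_derivative d) (at s within {lo..hi}) \<and>
           \<bar>d\<bar> \<le> C * cosh h)" and
  C0: "C \<ge> 0"
  using data_bounded_byD[OF data] by (blast, blast, blast, blast, blast, blast, blast, blast)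

lemma M0: "M > 0" using M C0 by simp

lemma MC_cosh: "C * cosh h < M * cosh h"
  using M by simp

lemma DM: "((\<lambda>s. M * \<Gamma> s + q) has_field_derivative M * \<eta> s) (at s within A)"
  "((\<lambda>s. M * \<eta> s) has_field_derivative M * \<eta>1 s) (at s within A)"
  "((\<lambda>s. M * \<eta>1 s) has_field_derivative M * (\<mu>\<^sup>2 * \<eta> s)) (at s within A)"
  by (auto intro!: derivative_eq_intros D\<Gamma> D\<eta> D\<eta>1)

text \<open>Comparison of \<open>v\<close> with \<open>M \<eta>\<close>, which is positive and has large outward slope at both ends.\<close>

lemma upper_bound:
  assumes "X \<in> closure D" "s \<in> {lo..hi}" "t \<in> {0..<T}"
  shows "v ((X, s), t) \<le> M * \<eta> s"
proof -
  have "(\<lambda>(x, t). v (x, t) - M * \<eta> (snd x)) ((X, s), t) \<le> 0"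
  proof (rule weak_maximum_principle[OF D lohi ell c_pos diff_profile[OF sol DM(2,3)] _ cont_diff_profile[OF cont DM(2)] _ _ _ _ assms])
    have M\<eta>: "M * \<eta> s \<ge> 0" for s using M0 \<eta>_ge_1[of s] by simp
    show "(\<lambda>(x, t). F (x, t) - (- a t e\<^sub>n e\<^sub>n * (M * (\<mu>\<^sup>2 * \<eta> (snd x))) + b t e\<^sub>n * (M * \<eta>1 (snd x)) + c t * (M * \<eta> (snd x))))
        ((X, s), t) \<le> 0" if X: "X \<in> D" "s \<in> {lo<..<hi}" "t \<in> {0<..<T}" for X s t
    proof -
      have "M * 1 \<le> M * (- a t e\<^sub>n e\<^sub>n * (\<mu>\<^sup>2 * \<eta> s) + b t e\<^sub>n * \<eta>1 s + c t * \<eta> s)"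
        using M0 by (intro mult_left_mono operator_on_\<eta> X) auto
      then show ?thesis using FC[OF X] M by (simp add: algebra_simps)
    qed
    show "(\<lambda>(x, t). v (x, t) - M * \<eta> (snd x)) ((X, s), 0) \<le> 0" if "X \<in> closure D" "s \<in> {lo..hi}" for X s
      using init[OF that] M\<eta> by simp
    show "(\<lambda>(x, t). v (x, t) - M * \<eta> (snd x)) ((X, s), t) \<le> 0"
      if "X \<in> frontier D" "s \<in> {lo..hi}" "t \<in> {0<..<T}" for X s t
      using lat[OF that] M\<eta> by simp
    have pos: "M * (\<mu> * sinh h) > C * cosh h"
    proof -
      have "M * (2 * cosh h) \<le> M * (\<mu> * sinh h)" using steep' M0 by simp
      moreover have "0 < M * cosh h" using M0 by simp
      ultimately show ?thesis using MC_cosh by linarith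
    qed
    fix X t assume Xt: "X \<in> D" "t \<in> {0<..<T}"
    show "(\<lambda>(x, t). v (x, t) - M * \<eta> (snd x)) ((X, lo), t) \<le> 0 \<or>
         (\<exists>d>0. ((\<lambda>s. (\<lambda>(x, t). v (x, t) - M * \<eta> (snd x)) ((X, s), t)) has_real_derivative d) (at lo within {lo..hi}))"
      using ends_cond[of lo, OF insertI1]
    proof (elim disjE)
      assume "\<forall>X\<in>D. \<forall>t\<in>{0<..<T}. \<exists>d. ((\<lambda>r. v ((X, r), t)) has_field_derivative d) (at lo within {lo..hi}) \<and>
           \<bar>d\<bar> \<le> C * cosh h"
      then obtain d where d: "((\<lambda>r. v ((X, r), t)) has_field_derivative d) (at lo within {lo..hi})" "\<bar>d\<bar> \<le> C * cosh h"
        using Xt by blast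
      have "d - M * \<eta>1 lo > 0" using d(2) pos by (simp add: ends)
      then show ?thesis using DERIV_diff[OF d(1) DM(2)] by auto
    qed (use Xt M\<eta> in auto)
    show "(\<lambda>(x, t). v (x, t) - M * \<eta> (snd x)) ((X, hi), t) \<le> 0 \<or>
         (\<exists>d<0. ((\<lambda>s. (\<lambda>(x, t). v (x, t) - M * \<eta> (snd x)) ((X, s), t)) has_real_derivative d) (at hi within {lo..hi}))"
      using ends_cond[of hi, OF insertI2[OF singletonI]]
    proof (elim disjE)
      assume "\<forall>X\<in>D. \<forall>t\<in>{0<..<T}. \<exists>d. ((\<lambda>r. v ((X, r), t)) has_field_derivative d) (at hi within {lo..hi}) \<and>
           \<bar>d\<bar> \<le> C * cosh h"
      then obtain d where d: "((\<lambda>r. v ((X, r), t)) has_field_derivative d) (at hi within {lo..hi})" "\<bar>d\<bar> \<le> C * cosh h"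
        using Xt by blast
      have "d - M * \<eta>1 hi < 0" using d(2) pos by (simp add: ends)
      then show ?thesis using DERIV_diff[OF d(1) DM(2)] by auto
    qed (use Xt M\<eta> in auto)
  qed
  then show ?thesis by simp
qed

text \<open>At a Dirichlet face the derivative of \<open>v\<close> is not given, and the monotonicity principle instead asks
how fast \<open>v\<close> can leave its boundary value.  That rate is controlled by comparison with
\<open>M (\<Gamma> - \<Gamma> lo)\<close>.\<close>

lemma growth_from_lo:
  assumes dir: "\<forall>X\<in>D. \<forall>t\<in>{0<..<T}. v ((X, lo), t) = 0"
    and "X \<in> closure D" "s \<in> {lo..hi}" "t \<in> {0..<T}"
  shows "v ((X, s), t) \<le> M * (\<Gamma> s - \<Gamma> lo)"
proof -
  let ?G = "\<lambda>s. M * \<Gamma> s + (- M * \<Gamma> lo)"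
  have "(\<lambda>(x, t). v (x, t) - ?G (snd x)) ((X, s), t) \<le> 0"
  proof (rule weak_maximum_principle[OF D lohi ell c_pos diff_profile[OF sol DM(1,2)] _ cont_diff_profile[OF cont DM(1)] _ _ _ _ assms(2-)])
    have G0: "?G s \<ge> 0" if "s \<in> {lo..hi}" for s
      using M0 \<Gamma>_mono[of lo s] that by (simp add: mult_left_mono)
    show "(\<lambda>(x, t). F (x, t) - (- a t e\<^sub>n e\<^sub>n * (M * \<eta>1 (snd x)) + b t e\<^sub>n * (M * \<eta> (snd x)) + c t * ?G (snd x)))
        ((X, s), t) \<le> 0" if X: "X \<in> D" "s \<in> {lo<..<hi}" "t \<in> {0<..<T}" for X s t
    proof -
      have "1 \<le> LG s t - c t * \<Gamma> lo"
        using LG_increasing[OF X(3), of lo s] outward_flux(1)[OF X(3)] X(2) by (simp add: LG_def)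
      then have "M * 1 \<le> M * (LG s t - c t * \<Gamma> lo)"
        using M0 by (intro mult_left_mono) auto
      then show ?thesis using FC[OF X] M by (simp add: algebra_simps LG_def)
    qed
    show "(\<lambda>(x, t). v (x, t) - ?G (snd x)) ((X, s), 0) \<le> 0" if "X \<in> closure D" "s \<in> {lo..hi}" for X s
      using init[OF that] G0[OF that(2)] by simp
    show "(\<lambda>(x, t). v (x, t) - ?G (snd x)) ((X, s), t) \<le> 0"
      if "X \<in> frontier D" "s \<in> {lo..hi}" "t \<in> {0<..<T}" for X s t
      using lat[OF that] G0[OF that(2)] by simp
    fix X t assume Xt: "X \<in> D" "t \<in> {0<..<T}"
    show "(\<lambda>(x, t). v (x, t) - ?G (snd x)) ((X, lo), t) \<le> 0 \<or>
         (\<exists>d>0. ((\<lambda>s. (\<lambda>(x, t). v (x, t) - ?G (snd x)) ((X, s), t)) has_real_derivative d) (at lo within {lo..hi}))"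
      using dir Xt by simp
    show "(\<lambda>(x, t). v (x, t) - ?G (snd x)) ((X, hi), t) \<le> 0 \<or>
         (\<exists>d<0. ((\<lambda>s. (\<lambda>(x, t). v (x, t) - ?G (snd x)) ((X, s), t)) has_real_derivative d) (at hi within {lo..hi}))"
      using ends_cond[of hi, OF insertI2[OF singletonI]]
    proof (elim disjE)
      assume "\<forall>X\<in>D. \<forall>t\<in>{0<..<T}. \<exists>d. ((\<lambda>r. v ((X, r), t)) has_field_derivative d) (at hi within {lo..hi}) \<and>
           \<bar>d\<bar> \<le> C * cosh h"
      then obtain d where d: "((\<lambda>r. v ((X, r), t)) has_field_derivative d) (at hi within {lo..hi})" "\<bar>d\<bar> \<le> C * cosh h"
        using Xt by blast
      have "d - M * \<eta> hi < 0" using d(2) MC_cosh unfolding ends by linarith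
      then show ?thesis using DERIV_diff[OF d(1) DM(1)[where q="- M * \<Gamma> lo"]] by auto
    qed (use Xt G0[of hi] lohi in auto)
  qed
  then show ?thesis by (simp add: algebra_simps)
qed

lemma growth_from_hi:
  assumes dir: "\<forall>X\<in>D. \<forall>t\<in>{0<..<T}. v ((X, hi), t) = 0"
    and "X \<in> closure D" "s \<in> {lo..hi}" "t \<in> {0..<T}"
  shows "- v ((X, s), t) \<le> M * (\<Gamma> hi - \<Gamma> s)"
proof -
  let ?G = "\<lambda>s. M * \<Gamma> hi - M * \<Gamma> s" and ?v = "\<lambda>z. - v z"
  have DG: "(?G has_field_derivative - (M * \<eta> s)) (at s within A)" for s A
    by (auto intro!: derivative_eq_intros D\<Gamma>)
  have DG1: "((\<lambda>s. - (M * \<eta> s)) has_field_derivative - (M * \<eta>1 s)) (at s within A)" for s A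
    by (auto intro!: derivative_eq_intros D\<eta>)
  have contm: "continuous_on ((closure D \<times> {lo..hi}) \<times> {0..<T}) ?v" by (intro continuous_on_minus cont)
  have "(\<lambda>(x, t). ?v (x, t) - ?G (snd x)) ((X, s), t) \<le> 0"
  proof (rule weak_maximum_principle[OF D lohi ell c_pos diff_profile[OF parabolic_solution_uminus[OF sol] DG DG1] _ cont_diff_profile[OF contm DG] _ _ _ _ assms(2-)])
    have G0: "?G s \<ge> 0" if "s \<in> {lo..hi}" for s
      using M0 \<Gamma>_mono[of s hi] that by (simp add: mult_left_mono)
    show "(\<lambda>(x, t). - F (x, t) - (- a t e\<^sub>n e\<^sub>n * (- (M * \<eta>1 (snd x))) + b t e\<^sub>n * (- (M * \<eta> (snd x))) + c t * ?G (snd x)))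
        ((X, s), t) \<le> 0" if X: "X \<in> D" "s \<in> {lo<..<hi}" "t \<in> {0<..<T}" for X s t
    proof -
      have "1 \<le> c t * \<Gamma> hi - LG s t"
        using LG_increasing[OF X(3), of s hi] outward_flux(2)[OF X(3)] X(2) by (simp add: LG_def)
      then have "M * 1 \<le> M * (c t * \<Gamma> hi - LG s t)"
        using M0 by (intro mult_left_mono) auto
      then show ?thesis using FC[OF X] M by (simp add: algebra_simps LG_def)
    qed
    show "(\<lambda>(x, t). ?v (x, t) - ?G (snd x)) ((X, s), 0) \<le> 0" if "X \<in> closure D" "s \<in> {lo..hi}" for X s
      using init[OF that] G0[OF that(2)] by simp
    show "(\<lambda>(x, t). ?v (x, t) - ?G (snd x)) ((X, s), t) \<le> 0"
      if "X \<in> frontier D" "s \<in> {lo..hi}" "t \<in> {0<..<T}" for X s t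
      using lat[OF that] G0[OF that(2)] by simp
    fix X t assume Xt: "X \<in> D" "t \<in> {0<..<T}"
    show "(\<lambda>(x, t). ?v (x, t) - ?G (snd x)) ((X, hi), t) \<le> 0 \<or>
         (\<exists>d<0. ((\<lambda>s. (\<lambda>(x, t). ?v (x, t) - ?G (snd x)) ((X, s), t)) has_real_derivative d) (at hi within {lo..hi}))"
      using dir Xt by simp
    show "(\<lambda>(x, t). ?v (x, t) - ?G (snd x)) ((X, lo), t) \<le> 0 \<or>
         (\<exists>d>0. ((\<lambda>s. (\<lambda>(x, t). ?v (x, t) - ?G (snd x)) ((X, s), t)) has_real_derivative d) (at lo within {lo..hi}))"
      using ends_cond[of lo, OF insertI1]
    proof (elim disjE)
      assume "\<forall>X\<in>D. \<forall>t\<in>{0<..<T}. \<exists>d. ((\<lambda>r. v ((X, r), t)) has_field_derivative d) (at lo within {lo..hi}) \<and>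
           \<bar>d\<bar> \<le> C * cosh h"
      then obtain d where d: "((\<lambda>r. v ((X, r), t)) has_field_derivative d) (at lo within {lo..hi})" "\<bar>d\<bar> \<le> C * cosh h"
        using Xt by blast
      have "- d - - (M * \<eta> lo) > 0" using d(2) MC_cosh unfolding ends by linarith
      then show ?thesis using DERIV_diff[OF DERIV_minus[OF d(1)] DG] by auto
    qed (use Xt G0[of lo] lohi in auto)
  qed
  then show ?thesis by (simp add: algebra_simps)
qed

text \<open>The function \<open>v - M \<Gamma>\<close> is nonincreasing in the normal direction by the monotonicity principle: its
slope at a face with prescribed flux is at most \<open>C cosh h - M \<eta> < 0\<close>, and at a Dirichlet face the
growth bounds apply.\<close>

lemma increment_bound:
  assumes "X \<in> closure D" "lo \<le> y" "y \<le> x" "x \<le> hi" "t \<in> {0..<T}"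
  shows "v ((X, x), t) - v ((X, y), t) \<le> M * (\<Gamma> x - \<Gamma> y)"
proof -
  let ?G = "\<lambda>s. M * \<Gamma> s + 0"
  have "(\<lambda>(x, t). v (x, t) - ?G (snd x)) ((X, x), t) \<le> (\<lambda>(x, t). v (x, t) - ?G (snd x)) ((X, y), t)"
  proof (rule monotonicity_principle[OF D lohi ell c_pos diff_profile[OF sol DM(1,2)] _ cont_diff_profile[OF cont DM(1)] _ _ _ _ assms])
    have Gm: "?G y \<le> ?G x" if "y < x" for x y
      using M0 \<Gamma>_mono[of y x] that by (simp add: mult_left_mono)
    show "(\<lambda>(x, t). F (x, t) - (- a t e\<^sub>n e\<^sub>n * (M * \<eta>1 (snd x)) + b t e\<^sub>n * (M * \<eta> (snd x)) + c t * ?G (snd x))) ((X, x), t)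
      \<le> (\<lambda>(x, t). F (x, t) - (- a t e\<^sub>n e\<^sub>n * (M * \<eta>1 (snd x)) + b t e\<^sub>n * (M * \<eta> (snd x)) + c t * ?G (snd x))) ((X, y), t)"
      if X: "X \<in> D" "lo < y" "y < x" "x < hi" "t \<in> {0<..<T}" for X x y t
    proof -
      have "F ((X, x), t) - F ((X, y), t) \<le> C * (x - y)" using FL[of X t x y] X by auto
      also have "\<dots> \<le> M * (x - y)" using M X by (intro mult_right_mono) auto
      also have "\<dots> \<le> M * (LG x t - LG y t)" using M0 X by (intro mult_left_mono LG_increasing) auto
      finally show ?thesis by (simp add: algebra_simps LG_def)
    qed
    show "(\<lambda>(x, t). v (x, t) - ?G (snd x)) ((X, x), 0) \<le> (\<lambda>(x, t). v (x, t) - ?G (snd x)) ((X, y), 0)"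
      if "X \<in> closure D" "lo \<le> y" "y < x" "x \<le> hi" for X x y
      using init[OF that(1), of x] init[OF that(1), of y] that Gm[of y x] by simp
    show "(\<lambda>(x, t). v (x, t) - ?G (snd x)) ((X, x), t) \<le> (\<lambda>(x, t). v (x, t) - ?G (snd x)) ((X, y), t)"
      if "X \<in> frontier D" "lo \<le> y" "y < x" "x \<le> hi" "t \<in> {0<..<T}" for X x y t
      using lat[OF that(1), of x t] lat[OF that(1), of y t] that Gm[of y x] by simp
    fix X t assume Xt: "X \<in> D" "t \<in> {0<..<T}"
    then have Xt': "X \<in> closure D" "t \<in> {0..<T}" using closure_subset[of D] by auto
    show "(\<forall>x\<in>{lo..hi}. (\<lambda>(x, t). v (x, t) - ?G (snd x)) ((X, x), t) \<le> (\<lambda>(x, t). v (x, t) - ?G (snd x)) ((X, lo), t)) \<or>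
         (\<exists>d<0. ((\<lambda>s. (\<lambda>(x, t). v (x, t) - ?G (snd x)) ((X, s), t)) has_real_derivative d) (at lo within {lo..hi}))"
      using ends_cond[of lo, OF insertI1]
    proof (elim disjE)
      assume dir: "\<forall>X\<in>D. \<forall>t\<in>{0<..<T}. v ((X, lo), t) = 0"
      show ?thesis
        using growth_from_lo[OF dir Xt'(1) _ Xt'(2)] dir Xt by (auto simp: algebra_simps)
    next
      assume "\<forall>X\<in>D. \<forall>t\<in>{0<..<T}. \<exists>d. ((\<lambda>r. v ((X, r), t)) has_field_derivative d) (at lo within {lo..hi}) \<and>
           \<bar>d\<bar> \<le> C * cosh h"
      then obtain d where d: "((\<lambda>r. v ((X, r), t)) has_field_derivative d) (at lo within {lo..hi})" "\<bar>d\<bar> \<le> C * cosh h"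
        using Xt by blast
      have "d - M * \<eta> lo < 0" using d(2) MC_cosh unfolding ends by linarith
      then show ?thesis using DERIV_diff[OF d(1) DM(1)[where q=0]] by auto
    qed
    show "(\<forall>y\<in>{lo..hi}. (\<lambda>(x, t). v (x, t) - ?G (snd x)) ((X, hi), t) \<le> (\<lambda>(x, t). v (x, t) - ?G (snd x)) ((X, y), t)) \<or>
         (\<exists>d<0. ((\<lambda>s. (\<lambda>(x, t). v (x, t) - ?G (snd x)) ((X, s), t)) has_real_derivative d) (at hi within {lo..hi}))"
      using ends_cond[of hi, OF insertI2[OF singletonI]]
    proof (elim disjE)
      assume dir: "\<forall>X\<in>D. \<forall>t\<in>{0<..<T}. v ((X, hi), t) = 0"
      show ?thesis
        using growth_from_hi[OF dir Xt'(1) _ Xt'(2)] dir Xt by (fastforce simp: algebra_simps)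
    next
      assume "\<forall>X\<in>D. \<forall>t\<in>{0<..<T}. \<exists>d. ((\<lambda>r. v ((X, r), t)) has_field_derivative d) (at hi within {lo..hi}) \<and>
           \<bar>d\<bar> \<le> C * cosh h"
      then obtain d where d: "((\<lambda>r. v ((X, r), t)) has_field_derivative d) (at hi within {lo..hi})" "\<bar>d\<bar> \<le> C * cosh h"
        using Xt by blast
      have "d - M * \<eta> hi < 0" using d(2) MC_cosh unfolding ends by linarith
      then show ?thesis using DERIV_diff[OF d(1) DM(1)[where q=0]] by auto
    qed
  qed
  then show ?thesis by (simp add: algebra_simps)
qed

end

lemma sup_estimate:
  assumes data: "data_bounded_by C F v"
    and "X \<in> closure D" "s \<in> {lo..hi}" "t \<in> {0..<T}"
  shows "\<bar>v ((X, s), t)\<bar> \<le> C * \<eta> s"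
proof -
  have "v ((X, s), t) \<le> C * \<eta> s"
    by (rule ge_from_strictly_larger) (rule upper_bound[OF data _ assms(2-)])
  moreover have "- v ((X, s), t) \<le> C * \<eta> s"
    by (rule ge_from_strictly_larger) (rule upper_bound[OF data_bounded_by_uminus[OF data] _ assms(2-)])
  ultimately show ?thesis by linarith
qed

lemma increment_estimate:
  assumes data: "data_bounded_by C F v"
    and "X \<in> closure D" "lo \<le> y" "y \<le> x" "x \<le> hi" "t \<in> {0..<T}"
  shows "\<bar>v ((X, x), t) - v ((X, y), t)\<bar> \<le> C * (\<Gamma> x - \<Gamma> y)"
proof -
  have "v ((X, x), t) - v ((X, y), t) \<le> C * (\<Gamma> x - \<Gamma> y)"
    by (rule ge_from_strictly_larger) (rule increment_bound[OF data _ assms(2-)])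
  moreover have "- v ((X, x), t) - - v ((X, y), t) \<le> C * (\<Gamma> x - \<Gamma> y)"
    by (rule ge_from_strictly_larger) (rule increment_bound[OF data_bounded_by_uminus[OF data] _ assms(2-)])
  ultimately show ?thesis by linarith
qed

lemma normal_derivative_estimate:
  assumes data: "data_bounded_by C F v"
    and X: "X \<in> closure D" and s: "s \<in> {lo<..<hi}" and t: "t \<in> {0..<T}"
    and d: "((\<lambda>r. v ((X, r), t)) has_field_derivative d) (at s)"
  shows "\<bar>d\<bar> \<le> C * \<eta> s"
proof -
  have *: "(((\<lambda>r. (f r - f s) / (r - s)) \<longlongrightarrow> d) (at_right s))" if "(f has_field_derivative d) (at s)"
    for f :: "real \<Rightarrow> real" and d
    using that unfolding has_field_derivative_iff by - (rule tendsto_mono[OF at_le[OF subset_UNIV]])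
  show ?thesis
  proof (rule tendsto_le[OF _ tendsto_mult_left[OF *[OF D\<Gamma>], of C] tendsto_rabs[OF *[OF d]]])
    have "\<forall>\<^sub>F r in at_right s. r \<in> {s<..<hi}"
      using s by (intro eventually_at_rightI[of s hi]) auto
    then show "\<forall>\<^sub>F r in at_right s. \<bar>(v ((X, r), t) - v ((X, s), t)) / (r - s)\<bar> \<le> C * ((\<Gamma> r - \<Gamma> s) / (r - s))"
    proof eventually_elim
      case (elim r)
      then show ?case
        using increment_estimate[OF data X _ _ _ t, of s r] s
        by (simp add: divide_right_mono)
    qed
  qed simp
qed

text \<open>Fluxes bounded by \<open>R\<close> at the ends give bounds \<open>R q\<close> inside, with \<open>q < 1\<close>.\<close>

lemma homogeneous_estimate:
  assumes sol: "parabolic_solution a b c (\<lambda>z. 0) (D \<times> {lo<..<hi}) T v"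
    and cont: "continuous_on ((closure D \<times> {lo..hi}) \<times> {0..<T}) v"
    and init: "\<And>X s. X \<in> closure D \<Longrightarrow> s \<in> {lo..hi} \<Longrightarrow> v ((X, s), 0) = 0"
    and lat: "\<And>X s t. X \<in> frontier D \<Longrightarrow> s \<in> {lo..hi} \<Longrightarrow> t \<in> {0<..<T} \<Longrightarrow> v ((X, s), t) = 0"
    and R: "R \<ge> 0"
    and bd: "\<And>s. s \<in> {lo, hi} \<Longrightarrow> (\<forall>X\<in>D. \<forall>t\<in>{0<..<T}. v ((X, s), t) = 0) \<or>
       (\<forall>X\<in>D. \<forall>t\<in>{0<..<T}. \<exists>d. ((\<lambda>r. v ((X, r), t)) has_field_derivative d) (at s within {lo..hi}) \<and> \<bar>d\<bar> \<le> R)"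
    and X: "X \<in> D" and s: "s \<in> {lo<..<hi}" and t: "t \<in> {0<..<T}"
  defines "q \<equiv> cosh (\<mu> * (s - (lo + hi) / 2)) / cosh (\<mu> * (hi - lo) / 2)"
  shows "\<bar>v ((X, s), t)\<bar> \<le> R * q"
    and "((\<lambda>r. v ((X, r), t)) has_field_derivative d) (at s) \<Longrightarrow> \<bar>d\<bar> \<le> R * q"
proof -
  have data: "data_bounded_by (R / cosh h) (\<lambda>z. 0) v"
    unfolding data_bounded_by_def using sol cont R init lat bd by simp
  have Xt: "X \<in> closure D" "t \<in> {0..<T}" using X t closure_subset[of D] by auto
  have q: "R / cosh h * \<eta> s = R * q" by (simp add: q_def \<eta>_def)
  show "\<bar>v ((X, s), t)\<bar> \<le> R * q"
    using sup_estimate[OF data Xt(1) _ Xt(2), of s] s unfolding q by auto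
  show "\<bar>d\<bar> \<le> R * q" if "((\<lambda>r. v ((X, r), t)) has_field_derivative d) (at s)"
    using normal_derivative_estimate[OF data Xt(1) s Xt(2) that] unfolding q .
qed

end

section \<open>Smooth functions and Lipschitz sources\<close>

lemma Ck_on_cong:
  assumes "open S" "\<And>x. x \<in> S \<Longrightarrow> f x = g x"
  shows "Ck_on k f S \<Longrightarrow> Ck_on k g S"
  using assms(2)
proof (induction k arbitrary: f g)
  case 0
  then show ?case by (simp cong: continuous_on_cong)
next
  case (Suc k)
  have D: "(f has_derivative f') (at x) \<longleftrightarrow> (g has_derivative f') (at x)" if "x \<in> S" for x f'
    using has_derivative_transform_within_open[of f f' x UNIV S g]
      has_derivative_transform_within_open[of g f' x UNIV S f] that \<open>open S\<close> Suc.prems(2) by auto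
  have d: "g differentiable (at x)" if "x \<in> S" for x
  proof -
    from Suc.prems(1) that obtain f' where "(f has_derivative f') (at x)"
      by (auto simp: differentiable_def)
    then show ?thesis unfolding D[OF that] differentiable_def by blast
  qed
  have F: "frechet_derivative f (at x) = frechet_derivative g (at x)" if "x \<in> S" for x
    unfolding frechet_derivative_def using D[OF that] by simp
  show ?case
    using Suc.prems(1) d Suc.IH[of "\<lambda>x. frechet_derivative f (at x) _" "\<lambda>x. frechet_derivative g (at x) _"] F
    by auto
qed

lemma smooth_on_cong:
  assumes "open S" "smooth_on f S" "\<And>x. x \<in> S \<Longrightarrow> f x = g x"
  shows "smooth_on g S"
  using assms(2) Ck_on_cong[of S f g] assms(1,3) unfolding smooth_on_def by blast

lemma smooth_on_frechet:
  assumes "smooth_on f S" "x \<in> S"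
  shows "(f has_derivative frechet_derivative f (at x)) (at x)"
  using assms by (auto simp: smooth_on_def frechet_derivative_works[symmetric] dest: spec[of _ "Suc 0"])

lemma smooth_on_directional:
  assumes "smooth_on f S"
  shows "smooth_on (\<lambda>x. frechet_derivative f (at x) v) S"
  using assms unfolding smooth_on_def by (metis Ck_on.simps(2))

lemma smooth_on_imp_continuous_on: "smooth_on f S \<Longrightarrow> continuous_on S f"
  unfolding smooth_on_def by (metis Ck_on.simps(1))

lemma smooth_on_subset:
  assumes "smooth_on f S" "R \<subseteq> S"
  shows "smooth_on f R"
proof -
  have "Ck_on k g S \<Longrightarrow> Ck_on k g R" for k and g :: "'a \<Rightarrow> 'b"
    by (induction k arbitrary: g) (use assms(2) in \<open>auto intro: continuous_on_subset\<close>)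
  then show ?thesis using assms(1) by (auto simp: smooth_on_def)
qed

lemma has_derivative_along:
  fixes f :: "'a::real_normed_vector \<Rightarrow> real"
  assumes "(f has_derivative f') (at x)"
  shows "((\<lambda>h. f (x + h *\<^sub>R w)) has_field_derivative f' w) (at 0)"
proof -
  interpret bounded_linear f' using assms by (rule has_derivative_bounded_linear)
  have "((\<lambda>h. f (x + h *\<^sub>R w)) has_derivative (\<lambda>h. f' (h *\<^sub>R w))) (at 0)"
    by (rule has_derivative_compose[of "\<lambda>h. x + h *\<^sub>R w" "\<lambda>h. h *\<^sub>R w" 0 UNIV f f'])
       (use assms in \<open>auto intro!: derivative_eq_intros\<close>)
  moreover have "(\<lambda>h. f' (h *\<^sub>R w)) = (*) (f' w)" by (auto simp: scaleR mult.commute)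
  ultimately show ?thesis by (simp add: has_field_derivative_def)
qed

text \<open>The one-dimensional derivatives that define the operator are directional values of the Frechet
derivative; iterated ones are smooth for that reason.\<close>

lemma dx_eq_frechet:
  assumes "smooth_on u S" "(x, t) \<in> S"
  shows "dx i u (x, t) = frechet_derivative u (at (x, t)) (i, 0)"
  using DERIV_imp_deriv[OF has_derivative_along[OF smooth_on_frechet[OF assms], of "(i, 0)"]]
  by (simp add: dx_def)

lemma time_derivative:
  assumes "smooth_on u S" "(x, t) \<in> S"
  shows "((\<lambda>s. u (x, s)) has_field_derivative dt u (x, t)) (at t)"
    and "dt u (x, t) = frechet_derivative u (at (x, t)) (0, 1)"
proof -
  have "((\<lambda>s. u (x, s + t)) has_field_derivative frechet_derivative u (at (x, t)) (0, 1)) (at 0)"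
    using has_derivative_along[OF smooth_on_frechet[OF assms], of "(0, 1)"] by (simp add: add.commute)
  then have "((\<lambda>s. u (x, s)) has_field_derivative frechet_derivative u (at (x, t)) (0, 1)) (at t)"
    using DERIV_shift[of "\<lambda>s. u (x, s)" _ 0 t] by simp
  then show "dt u (x, t) = frechet_derivative u (at (x, t)) (0, 1)"
    "((\<lambda>s. u (x, s)) has_field_derivative dt u (x, t)) (at t)"
    by (auto simp: dt_def DERIV_imp_deriv)
qed

lemma smooth_on_dx: "open S \<Longrightarrow> smooth_on u S \<Longrightarrow> smooth_on (dx i u) S"
  by (rule smooth_on_cong[OF _ smooth_on_directional[of u S "(i, 0)"]]) (auto simp: dx_eq_frechet[of u S])

lemma smooth_on_dt: "open S \<Longrightarrow> smooth_on u S \<Longrightarrow> smooth_on (dt u) S"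
  by (rule smooth_on_cong[OF _ smooth_on_directional[of u S "(0, 1)"]]) (auto simp: time_derivative(2)[of u S])

lemma spatial_derivative:
  assumes "smooth_on u S" "(x, t) \<in> S"
  shows "((\<lambda>y. u (y, t)) has_derivative (\<lambda>h. \<Sum>i\<in>Basis. (h \<bullet> i) * dx i u (x, t))) (at x)"
proof -
  let ?f' = "frechet_derivative u (at (x, t))"
  interpret bounded_linear ?f' using smooth_on_frechet[OF assms] by (rule has_derivative_bounded_linear)
  have "((\<lambda>y. u (y, t)) has_derivative (\<lambda>h. ?f' (h, 0))) (at x)"
    by (rule has_derivative_compose[of "\<lambda>y. (y, t)" "\<lambda>h. (h, 0)" x UNIV u ?f'])
       (use smooth_on_frechet[OF assms] in \<open>auto intro!: derivative_eq_intros\<close>)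
  moreover have "?f' (h, 0) = (\<Sum>i\<in>Basis. (h \<bullet> i) * dx i u (x, t))" for h
  proof -
    have "(h, 0) = (\<Sum>i\<in>Basis. (h \<bullet> i) *\<^sub>R (i, 0::real))"
      by (simp add: prod_eq_iff fst_sum snd_sum euclidean_representation)
    then have "?f' (h, 0) = (\<Sum>i\<in>Basis. ?f' ((h \<bullet> i) *\<^sub>R (i, 0::real)))"
      by (simp only: sum)
    then show ?thesis by (simp only: scaleR dx_eq_frechet[OF assms] real_scaleR_def)
  qed
  ultimately show ?thesis by simp
qed

lemma smooth_imp_parabolic_solution:
  assumes "open Q" "smooth_on u (Q \<times> {0<..<T})"
  shows "parabolic_solution a b c (parabolic_op a b c u) Q T u"
proof -
  have o: "open (Q \<times> {0<..<T})" using assms(1) by (intro open_Times) auto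
  show ?thesis
    unfolding parabolic_solution_def
  proof (rule exI[of _ "\<lambda>x t. dt u (x, t)"], rule exI[of _ "\<lambda>t i x. dx i u (x, t)"],
      rule exI[of _ "\<lambda>t x i j. dx i (dx j u) (x, t)"], intro ballI conjI)
    fix x t assume "x \<in> Q" "t \<in> {0<..<T}"
    then have xt: "(x, t) \<in> Q \<times> {0<..<T}" by simp
    show "((\<lambda>s. u (x, s)) has_real_derivative dt u (x, t)) (at t)"
      by (rule time_derivative[OF assms(2) xt])
    show "((\<lambda>y. u (y, t)) has_derivative (\<lambda>h. \<Sum>i\<in>Basis. h \<bullet> i * dx i u (x, t))) (at x)"
      by (rule spatial_derivative[OF assms(2) xt])
    show "((\<lambda>x. dx j u (x, t)) has_derivative (\<lambda>h. \<Sum>i\<in>Basis. h \<bullet> i * dx i (dx j u) (x, t))) (at x)" for j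
      by (rule spatial_derivative[OF smooth_on_dx[OF o assms(2)] xt])
    show "dt u (x, t) - (\<Sum>i\<in>Basis. \<Sum>j\<in>Basis. a t i j * dx i (dx j u) (x, t)) +
       (\<Sum>i\<in>Basis. b t i * dx i u (x, t)) + c t * u (x, t) = parabolic_op a b c u (x, t)"
      by (simp add: parabolic_op_def)
  qed
qed

lemma normal_derivative:
  fixes u :: "('m::finite) pt \<times> real \<Rightarrow> real"
  assumes "smooth_on u S" "((X, s), t) \<in> S"
  shows "((\<lambda>r. u ((X, r), t)) has_field_derivative dx e\<^sub>n u ((X, s), t)) (at s)"
proof -
  have "((\<lambda>h. u ((X, h + s), t)) has_field_derivative dx e\<^sub>n u ((X, s), t)) (at 0)"
    using has_derivative_along[OF smooth_on_frechet[OF assms], of "((0, 1), 0)"]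
    by (simp add: dx_eq_frechet[OF assms] add.commute)
  then show ?thesis
    using DERIV_shift[of "\<lambda>r. u ((X, r), t)" _ 0 s] by simp
qed

text \<open>Lipschitz continuity is required only in the normal direction, the one in which the monotonicity
principle compares sources.\<close>

definition bounded_Lipschitz :: "('m::finite pt \<times> real) set \<Rightarrow> ('m pt \<times> real \<Rightarrow> real) \<Rightarrow> bool" where
  "bounded_Lipschitz R W \<longleftrightarrow> (\<exists>C\<ge>0. (\<forall>z\<in>R. \<bar>W z\<bar> \<le> C) \<and>
     (\<forall>X x y t. ((X, x), t) \<in> R \<longrightarrow> ((X, y), t) \<in> R \<longrightarrow> \<bar>W ((X, x), t) - W ((X, y), t)\<bar> \<le> C * \<bar>x - y\<bar>))"

lemma bounded_LipschitzI:
  assumes "\<And>z. z \<in> R \<Longrightarrow> \<bar>W z\<bar> \<le> C"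
    and "\<And>X x y t. ((X, x), t) \<in> R \<Longrightarrow> ((X, y), t) \<in> R \<Longrightarrow> \<bar>W ((X, x), t) - W ((X, y), t)\<bar> \<le> K * \<bar>x - y\<bar>"
  shows "bounded_Lipschitz R W"
  unfolding bounded_Lipschitz_def
proof (rule exI[of _ "max 0 (max C K)"], intro conjI ballI allI impI)
  show "\<bar>W z\<bar> \<le> max 0 (max C K)" if "z \<in> R" for z using assms(1)[OF that] by auto
  fix X x y t assume r: "((X, x), t) \<in> R" "((X, y), t) \<in> R"
  have "K * \<bar>x - y\<bar> \<le> max 0 (max C K) * \<bar>x - y\<bar>" by (intro mult_right_mono) auto
  then show "\<bar>W ((X, x), t) - W ((X, y), t)\<bar> \<le> max 0 (max C K) * \<bar>x - y\<bar>"
    using assms(2)[OF r] by linarith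
qed simp

lemma bounded_LipschitzE:
  assumes "bounded_Lipschitz R W"
  obtains C where "C \<ge> 0" "\<And>z. z \<in> R \<Longrightarrow> \<bar>W z\<bar> \<le> C"
    "\<And>X x y t. ((X, x), t) \<in> R \<Longrightarrow> ((X, y), t) \<in> R \<Longrightarrow> \<bar>W ((X, x), t) - W ((X, y), t)\<bar> \<le> C * \<bar>x - y\<bar>"
  using assms unfolding bounded_Lipschitz_def by blast

lemma bounded_Lipschitz_add:
  assumes "bounded_Lipschitz R V" "bounded_Lipschitz R W"
  shows "bounded_Lipschitz R (\<lambda>z. V z + W z)"
proof -
  obtain C where C: "C \<ge> 0" "\<And>z. z \<in> R \<Longrightarrow> \<bar>V z\<bar> \<le> C"
    "\<And>X x y t. ((X, x), t) \<in> R \<Longrightarrow> ((X, y), t) \<in> R \<Longrightarrow> \<bar>V ((X, x), t) - V ((X, y), t)\<bar> \<le> C * \<bar>x - y\<bar>"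
    using bounded_LipschitzE[OF assms(1)] by blast
  obtain K where K: "K \<ge> 0" "\<And>z. z \<in> R \<Longrightarrow> \<bar>W z\<bar> \<le> K"
    "\<And>X x y t. ((X, x), t) \<in> R \<Longrightarrow> ((X, y), t) \<in> R \<Longrightarrow> \<bar>W ((X, x), t) - W ((X, y), t)\<bar> \<le> K * \<bar>x - y\<bar>"
    using bounded_LipschitzE[OF assms(2)] by blast
  show ?thesis
  proof (rule bounded_LipschitzI[where C = "C + K" and K = "C + K"])
    show "\<bar>V z + W z\<bar> \<le> C + K" if "z \<in> R" for z using C(2)[OF that] K(2)[OF that] by linarith
    show "\<bar>V ((X, x), t) + W ((X, x), t) - (V ((X, y), t) + W ((X, y), t))\<bar> \<le> (C + K) * \<bar>x - y\<bar>"
      if "((X, x), t) \<in> R" "((X, y), t) \<in> R" for X x y t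
      using C(3)[OF that] K(3)[OF that] unfolding distrib_right by linarith
  qed
qed

lemma bounded_Lipschitz_mult:
  assumes "bounded_Lipschitz R V" "bounded_Lipschitz R W"
  shows "bounded_Lipschitz R (\<lambda>z. V z * W z)"
proof -
  obtain C where C: "C \<ge> 0" "\<And>z. z \<in> R \<Longrightarrow> \<bar>V z\<bar> \<le> C"
    "\<And>X x y t. ((X, x), t) \<in> R \<Longrightarrow> ((X, y), t) \<in> R \<Longrightarrow> \<bar>V ((X, x), t) - V ((X, y), t)\<bar> \<le> C * \<bar>x - y\<bar>"
    using bounded_LipschitzE[OF assms(1)] by blast
  obtain K where K: "K \<ge> 0" "\<And>z. z \<in> R \<Longrightarrow> \<bar>W z\<bar> \<le> K"
    "\<And>X x y t. ((X, x), t) \<in> R \<Longrightarrow> ((X, y), t) \<in> R \<Longrightarrow> \<bar>W ((X, x), t) - W ((X, y), t)\<bar> \<le> K * \<bar>x - y\<bar>"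
    using bounded_LipschitzE[OF assms(2)] by blast
  show ?thesis
  proof (rule bounded_LipschitzI[where C = "C * K" and K = "C * K + C * K"])
    show "\<bar>V z * W z\<bar> \<le> C * K" if "z \<in> R" for z
      using mult_mono[OF C(2)[OF that] K(2)[OF that]] C(1) by (simp add: abs_mult)
    show "\<bar>V ((X, x), t) * W ((X, x), t) - V ((X, y), t) * W ((X, y), t)\<bar> \<le> (C * K + C * K) * \<bar>x - y\<bar>"
      if r: "((X, x), t) \<in> R" "((X, y), t) \<in> R" for X x y t
    proof -
      have "V ((X, x), t) * W ((X, x), t) - V ((X, y), t) * W ((X, y), t)
        = V ((X, x), t) * (W ((X, x), t) - W ((X, y), t)) + (V ((X, x), t) - V ((X, y), t)) * W ((X, y), t)"
        by (simp add: algebra_simps)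
      moreover have "\<bar>V ((X, x), t) * (W ((X, x), t) - W ((X, y), t))\<bar> \<le> C * (K * \<bar>x - y\<bar>)"
        unfolding abs_mult by (intro mult_mono C(2) K(3) r) (use C(1) in auto)
      moreover have "\<bar>(V ((X, x), t) - V ((X, y), t)) * W ((X, y), t)\<bar> \<le> (C * \<bar>x - y\<bar>) * K"
        unfolding abs_mult by (intro mult_mono C(3) K(2) r) (use C(1) in auto)
      ultimately show ?thesis by (simp add: algebra_simps)
    qed
  qed
qed

lemma bounded_Lipschitz_time:
  assumes "bounded (range k)"
  shows "bounded_Lipschitz R (\<lambda>(x, t). k t)"
proof -
  obtain C where "\<And>t. \<bar>k t\<bar> \<le> C" using assms by (auto simp: bounded_iff)
  then show ?thesis by (intro bounded_LipschitzI[where C = C and K = 0]) auto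
qed

lemma bounded_Lipschitz_sum:
  assumes "finite I" "\<And>i. i \<in> I \<Longrightarrow> bounded_Lipschitz R (W i)"
  shows "bounded_Lipschitz R (\<lambda>z. \<Sum>i\<in>I. W i z)"
  using assms
proof (induction I rule: finite_induct)
  case empty
  show ?case by (rule bounded_LipschitzI[where C = 0 and K = 0]) auto
next
  case (insert i I)
  then show ?case by (simp add: bounded_Lipschitz_add)
qed

lemma bounded_Lipschitz_uminus:
  assumes "bounded_Lipschitz R W"
  shows "bounded_Lipschitz R (\<lambda>z. - W z)"
proof -
  have "bounded_Lipschitz R (\<lambda>(x, t). - 1)"
    by (rule bounded_LipschitzI[where C = 1 and K = 0]) auto
  from bounded_Lipschitz_mult[OF this assms] show ?thesis by (simp add: case_prod_unfold)
qed

lemma smooth_imp_bounded_Lipschitz: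
  fixes W :: "('m::finite) pt \<times> real \<Rightarrow> real"
  assumes V: "open V" "smooth_on W V" and K: "compact K" "K \<subseteq> V"
    and seg: "\<And>X x y r t. ((X, x), t) \<in> K \<Longrightarrow> ((X, y), t) \<in> K \<Longrightarrow> x \<le> r \<Longrightarrow> r \<le> y \<Longrightarrow> ((X, r), t) \<in> K"
  shows "bounded_Lipschitz K W"
proof -
  have bd: "\<exists>C. \<forall>z\<in>K. \<bar>G z\<bar> \<le> C" if "smooth_on G V" for G :: "'m pt \<times> real \<Rightarrow> real"
  proof -
    have "bounded (G ` K)"
      using K smooth_on_imp_continuous_on[OF that]
      by (intro compact_imp_bounded compact_continuous_image) (auto intro: continuous_on_subset)
    then show ?thesis by (auto simp: bounded_iff)
  qed
  obtain C where C: "\<And>z. z \<in> K \<Longrightarrow> \<bar>W z\<bar> \<le> C" using bd[OF V(2)] by blast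
  obtain L where L: "\<And>z. z \<in> K \<Longrightarrow> \<bar>dx e\<^sub>n W z\<bar> \<le> L" using bd[OF smooth_on_dx[OF V]] by blast
  have step: "\<bar>W ((X, y), t) - W ((X, x), t)\<bar> \<le> L * \<bar>y - x\<bar>"
    if r: "((X, x), t) \<in> K" "((X, y), t) \<in> K" "x < y" for X x y t
  proof -
    have "((\<lambda>r. W ((X, r), t)) has_field_derivative dx e\<^sub>n W ((X, r), t)) (at r)" if "x \<le> r" "r \<le> y" for r
      using seg[OF r(1,2) that] K(2) by (intro normal_derivative[OF V(2)]) auto
    then obtain \<xi> where \<xi>: "x < \<xi>" "\<xi> < y" "W ((X, y), t) - W ((X, x), t) = (y - x) * dx e\<^sub>n W ((X, \<xi>), t)"
      using MVT2[OF r(3), of "\<lambda>r. W ((X, r), t)" "\<lambda>r. dx e\<^sub>n W ((X, r), t)"] by blast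
    have "\<bar>dx e\<^sub>n W ((X, \<xi>), t)\<bar> \<le> L" using seg[OF r(1,2), of \<xi>] \<xi> by (intro L) auto
    then show ?thesis
      unfolding \<xi>(3) abs_mult by (subst mult.commute) (rule mult_right_mono, auto)
  qed
  show ?thesis
  proof (rule bounded_LipschitzI[OF C, where K = L])
    show "\<bar>W ((X, x), t) - W ((X, y), t)\<bar> \<le> L * \<bar>x - y\<bar>" if "((X, x), t) \<in> K" "((X, y), t) \<in> K" for X x y t
      using step[of X x t y] step[of X y t x] that
      by (cases x y rule: linorder_cases) (auto simp: abs_minus_commute)
  qed
qed

lemma parabolic_op_bounded_Lipschitz:
  fixes W :: "('m::finite) pt \<times> real \<Rightarrow> real"
  assumes V: "open V" "smooth_on W V" and K: "compact K" "K \<subseteq> V"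
    and seg: "\<And>X x y r t. ((X, x), t) \<in> K \<Longrightarrow> ((X, y), t) \<in> K \<Longrightarrow> x \<le> r \<Longrightarrow> r \<le> y \<Longrightarrow> ((X, r), t) \<in> K"
    and a: "\<And>i j. i \<in> Basis \<Longrightarrow> j \<in> Basis \<Longrightarrow> bounded (range (\<lambda>t. a t i j))"
    and b: "\<And>i. i \<in> Basis \<Longrightarrow> bounded (range (\<lambda>t. b t i))" and c: "bounded (range c)"
  shows "bounded_Lipschitz K (parabolic_op a b c W)"
proof -
  have sm: "bounded_Lipschitz K G" if "smooth_on G V" for G
    by (rule smooth_imp_bounded_Lipschitz[OF V(1) that K]) (rule seg)
  have eq: "parabolic_op a b c W = (\<lambda>z. ((dt W z
     + - (\<Sum>i\<in>Basis. \<Sum>j\<in>Basis. (\<lambda>(x, t). a t i j) z * dx i (dx j W) z))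
     + (\<Sum>i\<in>Basis. (\<lambda>(x, t). b t i) z * dx i W z)) + (\<lambda>(x, t). c t) z * W z)"
    by (auto simp: parabolic_op_def fun_eq_iff)
  show ?thesis
    unfolding eq
    by (intro bounded_Lipschitz_add bounded_Lipschitz_mult bounded_Lipschitz_uminus bounded_Lipschitz_sum
        bounded_Lipschitz_time a b c sm smooth_on_dt smooth_on_dx V finite_Basis)
qed

section \<open>The equation in a cylinder over a bounded domain\<close>

locale parabolic_setting =
  fixes D :: "(real ^ 'm::finite) set" and T :: real
    and a :: "real \<Rightarrow> 'm pt \<Rightarrow> 'm pt \<Rightarrow> real" and b :: "real \<Rightarrow> 'm pt \<Rightarrow> real" and c :: "real \<Rightarrow> real"
  assumes T: "0 < T" and D: "open D" "bounded D"
    and sym: "\<forall>t\<in>{0<..<T}. \<forall>i\<in>Basis. \<forall>j\<in>Basis. a t i j = a t j i"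
    and coercive: "\<exists>\<nu>0>0. \<forall>t\<in>{0<..<T}. \<forall>\<xi>::'m pt.
           (\<Sum>i\<in>Basis. \<Sum>j\<in>Basis. a t i j * (\<xi> \<bullet> i) * (\<xi> \<bullet> j)) \<ge> \<nu>0 * (norm \<xi>)\<^sup>2"
    and a_bdd: "\<And>i j. i \<in> Basis \<Longrightarrow> j \<in> Basis \<Longrightarrow> bounded (range (\<lambda>t. a t i j))"
    and b_bdd: "\<And>i. i \<in> Basis \<Longrightarrow> bounded (range (\<lambda>t. b t i))"
    and c_bdd: "bounded (range c)"
begin

text \<open>A large \<open>\<mu>\<close> makes the barrier steep, uniformly for all slabs of width at least \<open>L\<close>, because
\<open>cosh \<le> 2 sinh\<close> from \<open>1\<close> on; then the rate \<open>\<kappa>\<close> of the exponential weight in time is chosen to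
absorb everything else.  The coefficients are those of the equation for
\<open>exp (p x\<^sub>n - \<kappa> t) u\<close>.\<close>

lemma cosh_barrier_exists:
  assumes "L > 0"
  shows "\<exists>\<mu> \<kappa>. \<mu> > 0 \<and> (\<forall>lo hi. L \<le> hi - lo \<longrightarrow> cosh_barrier D lo hi T \<mu> a
    (\<lambda>t i. b t i + p * (a t i e\<^sub>n + a t e\<^sub>n i)) (\<lambda>t. c t + \<kappa> - p * b t e\<^sub>n - p\<^sup>2 * a t e\<^sub>n e\<^sub>n))"
proof -
  note n = e\<^sub>n_Basis[where 'a = "real ^ 'm"]
  obtain \<nu> where \<nu>: "\<nu> > 0" and quad: "\<And>t \<xi>. t \<in> {0<..<T} \<Longrightarrow>
      (\<Sum>i\<in>Basis. \<Sum>j\<in>Basis. a t i j * (\<xi> \<bullet> i) * (\<xi> \<bullet> j)) \<ge> \<nu> * (norm (\<xi> :: 'm pt))\<^sup>2"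
    using coercive by blast
  obtain Ka where Ka: "\<And>t. \<bar>a t e\<^sub>n e\<^sub>n\<bar> \<le> Ka" using a_bdd[OF n n] by (auto simp: bounded_iff)
  obtain Kb where Kb: "\<And>t. \<bar>b t e\<^sub>n\<bar> \<le> Kb" using b_bdd[OF n] by (auto simp: bounded_iff)
  obtain Kc where Kc: "\<And>t. \<bar>c t\<bar> \<le> Kc" using c_bdd by (auto simp: bounded_iff)
  define B where "B = Kb + \<bar>p\<bar> * (2 * Ka)"
  have B: "\<bar>b t e\<^sub>n + p * (a t e\<^sub>n e\<^sub>n + a t e\<^sub>n e\<^sub>n)\<bar> \<le> B" for t
  proof -
    have "\<bar>p * (a t e\<^sub>n e\<^sub>n + a t e\<^sub>n e\<^sub>n)\<bar> \<le> \<bar>p\<bar> * (2 * Ka)"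
      unfolding abs_mult using Ka[of t] by (intro mult_left_mono) auto
    then show ?thesis using Kb[of t] unfolding B_def by linarith
  qed
  then have B0: "B \<ge> 0" by (meson abs_ge_zero order_trans)
  define \<mu> where "\<mu> = max (2 / L) (max (2 * (B + 1) / \<nu>) 4)"
  have \<mu>: "\<mu> \<ge> 4" "\<mu> * L \<ge> 2" "\<nu> * \<mu> \<ge> 2 * (B + 1)"
  proof -
    show "\<mu> \<ge> 4" by (simp add: \<mu>_def)
    have "\<mu> \<ge> 2 / L" by (simp add: \<mu>_def)
    then show "\<mu> * L \<ge> 2" using \<open>L > 0\<close> by (simp add: pos_divide_le_eq)
    have "\<mu> \<ge> 2 * (B + 1) / \<nu>" by (simp add: \<mu>_def)
    then show "\<nu> * \<mu> \<ge> 2 * (B + 1)" using \<nu> by (simp add: pos_divide_le_eq mult.commute)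
  qed
  define \<kappa> where "\<kappa> = Ka * \<mu>\<^sup>2 + B * \<mu> + 1 + (Kc + \<bar>p\<bar> * Kb + p\<^sup>2 * Ka)"
  have "cosh_barrier D lo hi T \<mu> a (\<lambda>t i. b t i + p * (a t i e\<^sub>n + a t e\<^sub>n i))
      (\<lambda>t. c t + \<kappa> - p * b t e\<^sub>n - p\<^sup>2 * a t e\<^sub>n e\<^sub>n)" if lohi: "L \<le> hi - lo" for lo hi
  proof
    show "open D" "bounded D" using D by auto
    show "lo < hi" using lohi \<open>L > 0\<close> by simp
    show "\<mu> > 0" using \<mu> by simp
    have "\<mu> * L \<le> \<mu> * (hi - lo)" using lohi \<mu>(1) by (intro mult_left_mono) auto
    \<comment> \<open>the half-width in units of \<open>1 / \<mu>\<close>\<close>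
    then have h1: "\<mu> * (hi - lo) / 2 \<ge> 1" using \<mu>(2) by simp
    have sc: "cosh (\<mu> * (hi - lo) / 2) \<le> 2 * sinh (\<mu> * (hi - lo) / 2)"
    proof -
      define h where "h = \<mu> * (hi - lo) / 2"
      have "1 \<le> h" using h1 by (simp add: h_def)
      then have "3 \<le> exp (2 * h)" using exp_ge_add_one_self[of "2 * h"] by linarith
      then have "3 * exp (- h) \<le> exp (2 * h) * exp (- h)" by (intro mult_right_mono) auto
      then have "3 * exp (- h) \<le> exp h" by (simp flip: exp_add)
      then show ?thesis unfolding h_def[symmetric] by (simp add: sinh_def cosh_def)
    qed
    have c0: "cosh (\<mu> * (hi - lo) / 2) > 0" by simp
    have s0: "sinh (\<mu> * (hi - lo) / 2) > 0" using sc c0 by linarith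
    show "2 * cosh (\<mu> * (hi - lo) / 2) \<le> \<mu> * sinh (\<mu> * (hi - lo) / 2)"
      using sc s0 mult_right_mono[OF \<mu>(1), of "sinh (\<mu> * (hi - lo) / 2)"] by linarith
    fix t assume t: "t \<in> {0<..<T}"
    show "elliptic (a t)"
      unfolding elliptic_def
    proof (intro conjI allI impI)
      show "\<forall>i\<in>Basis. \<forall>j\<in>Basis. a t i j = a t j i" using sym t by blast
      show "0 < (\<Sum>i\<in>Basis. \<Sum>j\<in>Basis. a t i j * (\<xi> \<bullet> i) * (\<xi> \<bullet> j))" if "\<xi> \<noteq> 0" for \<xi>
      proof -
        have "0 < \<nu> * (norm \<xi>)\<^sup>2" using \<nu> that by simp
        then show ?thesis using quad[OF t, of \<xi>] by linarith
      qed
    qed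
    have ann: "\<nu> \<le> a t e\<^sub>n e\<^sub>n"
    proof -
      have "(\<Sum>i\<in>Basis. \<Sum>j\<in>Basis. a t i j * (e\<^sub>n \<bullet> i) * (e\<^sub>n \<bullet> j))
          = (\<Sum>i\<in>Basis. \<Sum>j\<in>Basis. if j = e\<^sub>n then (if i = e\<^sub>n then a t i j else 0) else 0)"
        using n by (intro sum.cong refl) (auto simp: inner_Basis)
      also have "\<dots> = a t e\<^sub>n e\<^sub>n" using n by simp
      finally show ?thesis using quad[OF t, of "e\<^sub>n"] by (simp add: norm_Pair)
    qed
    show "(\<bar>b t e\<^sub>n + p * (a t e\<^sub>n e\<^sub>n + a t e\<^sub>n e\<^sub>n)\<bar> + 1) * cosh (\<mu> * (hi - lo) / 2)
      \<le> a t e\<^sub>n e\<^sub>n * (\<mu> * sinh (\<mu> * (hi - lo) / 2))"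
    proof -
      have "(\<bar>b t e\<^sub>n + p * (a t e\<^sub>n e\<^sub>n + a t e\<^sub>n e\<^sub>n)\<bar> + 1) * cosh (\<mu> * (hi - lo) / 2)
         \<le> (B + 1) * (2 * sinh (\<mu> * (hi - lo) / 2))"
        using B[of t] sc B0 by (intro mult_mono) auto
      also have "\<dots> = (2 * (B + 1)) * sinh (\<mu> * (hi - lo) / 2)" by simp
      also have "\<dots> \<le> (\<nu> * \<mu>) * sinh (\<mu> * (hi - lo) / 2)" using \<mu>(3) s0 by (intro mult_right_mono) auto
      also have "\<dots> \<le> (a t e\<^sub>n e\<^sub>n * \<mu>) * sinh (\<mu> * (hi - lo) / 2)"
        using ann \<mu>(1) s0 by (intro mult_right_mono) auto
      finally show ?thesis by (simp only: mult.assoc)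
    qed
    show "a t e\<^sub>n e\<^sub>n * \<mu>\<^sup>2 + \<bar>b t e\<^sub>n + p * (a t e\<^sub>n e\<^sub>n + a t e\<^sub>n e\<^sub>n)\<bar> * \<mu> + 1
       \<le> c t + \<kappa> - p * b t e\<^sub>n - p\<^sup>2 * a t e\<^sub>n e\<^sub>n"
    proof -
      have an: "a t e\<^sub>n e\<^sub>n \<le> Ka" using Ka[of t] by linarith
      have "a t e\<^sub>n e\<^sub>n * \<mu>\<^sup>2 \<le> Ka * \<mu>\<^sup>2" using an by (intro mult_right_mono) auto
      moreover have "\<bar>b t e\<^sub>n + p * (a t e\<^sub>n e\<^sub>n + a t e\<^sub>n e\<^sub>n)\<bar> * \<mu> \<le> B * \<mu>"
        using B[of t] \<mu>(1) by (intro mult_right_mono) auto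
      moreover have "p\<^sup>2 * a t e\<^sub>n e\<^sub>n \<le> p\<^sup>2 * Ka" using an by (intro mult_left_mono) auto
      moreover have "\<bar>p * b t e\<^sub>n\<bar> \<le> \<bar>p\<bar> * Kb" unfolding abs_mult using Kb by (intro mult_left_mono) auto
      ultimately show ?thesis using Kc[of t] unfolding \<kappa>_def by linarith
    qed
  qed
  then show ?thesis using \<mu>(1) by (intro exI[of _ \<mu>] exI[of _ \<kappa>]) auto
qed

lemma closure_cylinder:
  "lo < hi \<Longrightarrow> closure (D \<times> {lo<..<hi}) = closure D \<times> {lo..(hi::real)}"
  by (simp add: closure_Times)

lemma closure_space_time:
  "lo < hi \<Longrightarrow> closure ((D \<times> {lo<..<hi}) \<times> {0<..<T}) = (closure D \<times> {lo..(hi::real)}) \<times> {0..T}"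
  using T by (simp add: closure_Times)

lemma frontier_cylinder:
  assumes "lo < (hi::real)" "X \<in> closure D" "s \<in> {lo..hi}" "X \<in> frontier D \<or> s = lo \<or> s = hi"
  shows "(X, s) \<in> frontier (D \<times> {lo<..<hi})"
proof -
  have "interior (D \<times> {lo<..<hi}) = D \<times> {lo<..<hi}"
    using D by (intro interior_open open_Times) auto
  moreover have "X \<notin> D" if "X \<in> frontier D" using that D by (auto simp: frontier_def interior_open)
  ultimately show ?thesis
    using assms unfolding frontier_def closure_cylinder[OF assms(1)] by auto
qed

text \<open>The Robin data of the first error contain \<open>\<partial>\<^sub>n u\<close> on the interfaces, whose boundedness is not part
of the notion of solution.  Subtracting a smooth extension \<open>G\<close> of the boundary data leaves a problem
with homogeneous Dirichlet data and a source that is smooth up to the boundary, to which the slab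
estimates apply.\<close>

lemma normal_derivative_bounded:
  assumes \<alpha>\<beta>: "\<alpha> < \<beta>"
    and f: "smooth_on_closure f ((D \<times> {\<alpha><..<\<beta>}) \<times> {0<..<T})"
    and g: "smooth_on_closure g ((D \<times> {\<alpha><..<\<beta>}) \<times> {0<..<T})"
    and u: "solves_P T a b c f g (D \<times> {\<alpha><..<\<beta>}) u"
  shows "\<exists>B. \<forall>X\<in>D. \<forall>s\<in>{\<alpha><..<\<beta>}. \<forall>t\<in>{0<..<T}. \<bar>dx e\<^sub>n u ((X, s), t)\<bar> \<le> B"
proof -
  define Q where "Q = D \<times> {\<alpha><..<\<beta>}"
  define K where "K = (closure D \<times> {\<alpha>..\<beta>}) \<times> {0..T}"
  have K_closure: "closure (Q \<times> {0<..<T}) = K" unfolding K_def Q_def by (rule closure_space_time[OF \<alpha>\<beta>])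
  have K: "compact K" using D unfolding K_def by (intro compact_Times compact_Icc) auto
  have seg: "((X, r), t) \<in> K" if "((X, x), t) \<in> K" "((X, y), t) \<in> K" "x \<le> r" "r \<le> y" for X x y r t
    using that by (auto simp: K_def)
  have oQ: "open Q" using D unfolding Q_def by (intro open_Times) auto
  have QK: "Q \<times> {0<..<T} \<subseteq> K" using closure_subset[of "Q \<times> {0<..<T}"] K_closure by simp
  obtain V1 F where F: "open V1" "K \<subseteq> V1" "smooth_on F V1" "\<And>z. z \<in> K \<Longrightarrow> f z = F z"
    using f unfolding smooth_on_closure_def Q_def[symmetric] K_closure by blast
  obtain V2 G where G: "open V2" "K \<subseteq> V2" "smooth_on G V2" "\<And>z. z \<in> K \<Longrightarrow> g z = G z"
    using g unfolding smooth_on_closure_def Q_def[symmetric] K_closure by blast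
  have us: "smooth_on u (Q \<times> {0<..<T})" and uc: "continuous_on (closure Q \<times> {0..<T}) u"
    and ueq: "\<And>z. z \<in> Q \<times> {0<..<T} \<Longrightarrow> parabolic_op a b c u z = f z"
    and ub: "\<And>z. z \<in> frontier Q \<times> {0<..<T} \<Longrightarrow> u z = g z" and ui: "\<And>x. x \<in> Q \<Longrightarrow> u (x, 0) = g (x, 0)"
    using u unfolding solves_P_def classical_solution_def Q_def by auto
  obtain \<mu> \<kappa> where bar: "cosh_barrier D \<alpha> \<beta> T \<mu> a b (\<lambda>t. c t + \<kappa>)"
    using cosh_barrier_exists[of "\<beta> - \<alpha>" 0] \<alpha>\<beta> by auto
  \<comment> \<open>no Robin condition occurs here, and \<open>p = 0\<close> gives a weight in time only\<close>
  interpret bar: cosh_barrier D \<alpha> \<beta> T \<mu> a b "\<lambda>t. c t + \<kappa>" by (rule bar)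
  define LG where "LG = parabolic_op a b c G"
  define S where "S = (\<lambda>z. (\<lambda>(x, t). exp (- \<kappa> * t)) z * (F z + - LG z))"
  define w where "w = (\<lambda>z. u z - G z)"
  define v where "v = (\<lambda>(x, t). exp (- \<kappa> * t) * w (x, t))"
  have "parabolic_solution a b c (\<lambda>z. parabolic_op a b c u z - LG z) Q T w"
    unfolding w_def LG_def using us G(2,3) QK
    by (intro parabolic_solution_diff smooth_imp_parabolic_solution oQ) (auto intro: smooth_on_subset)
  from parabolic_solution_exp_mult[OF this e\<^sub>n_Basis, of 0 \<kappa>]
  have "parabolic_solution a b (\<lambda>t. c t + \<kappa>)
      (\<lambda>(x, t). exp (- \<kappa> * t) * (parabolic_op a b c u (x, t) - LG (x, t))) Q T v"
    unfolding v_def by simp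
  then have sol: "parabolic_solution a b (\<lambda>t. c t + \<kappa>) S Q T v"
  proof (rule parabolic_solution_cong[OF _ subset_refl])
    fix x t assume "x \<in> Q" "t \<in> {0<..<T}"
    then have "(x, t) \<in> Q \<times> {0<..<T}" by simp
    moreover from this have "(x, t) \<in> K" using QK by blast
    ultimately show "(\<lambda>(x, t). exp (- \<kappa> * t) * (parabolic_op a b c u (x, t) - LG (x, t))) (x, t) = S (x, t)"
      by (simp add: S_def ueq F(4))
  qed
  have Kb: "bounded_Lipschitz K S"
  proof -
    have "bounded_Lipschitz K F" by (rule smooth_imp_bounded_Lipschitz[OF F(1,3) K F(2)]) (rule seg)
    moreover have "bounded_Lipschitz K LG" unfolding LG_def
      by (rule parabolic_op_bounded_Lipschitz[OF G(1,3) K G(2)]) (auto intro: seg a_bdd b_bdd c_bdd)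
    moreover have "bounded_Lipschitz K (\<lambda>(x, t). exp (- \<kappa> * t))"
    proof (rule bounded_LipschitzI[where C = "exp (\<bar>\<kappa>\<bar> * T)" and K = 0])
      fix z assume z: "z \<in> K"
      obtain x t where z': "z = (x, t)" by (cases z)
      have "- \<kappa> * t \<le> \<bar>\<kappa>\<bar> * t" using z by (intro mult_right_mono) (auto simp: z' K_def)
      also have "\<dots> \<le> \<bar>\<kappa>\<bar> * T" using z by (intro mult_left_mono) (auto simp: z' K_def)
      finally show "\<bar>(\<lambda>(x, t). exp (- \<kappa> * t)) z\<bar> \<le> exp (\<bar>\<kappa>\<bar> * T)" by (simp add: z')
    qed auto
    ultimately show ?thesis
      unfolding S_def by (intro bounded_Lipschitz_mult bounded_Lipschitz_add bounded_Lipschitz_uminus)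
  qed
  obtain C where C: "C \<ge> 0" "\<And>z. z \<in> K \<Longrightarrow> \<bar>S z\<bar> \<le> C"
    "\<And>X x y t. ((X, x), t) \<in> K \<Longrightarrow> ((X, y), t) \<in> K \<Longrightarrow> \<bar>S ((X, x), t) - S ((X, y), t)\<bar> \<le> C * \<bar>x - y\<bar>"
    using bounded_LipschitzE[OF Kb] by blast
  have clQ: "closure Q = closure D \<times> {\<alpha>..\<beta>}" unfolding Q_def by (rule closure_cylinder[OF \<alpha>\<beta>])
  have wc: "continuous_on (closure Q \<times> {0..<T}) w"
    unfolding w_def
    by (intro continuous_on_diff uc continuous_on_subset[OF smooth_on_imp_continuous_on[OF G(3)]]
        order_trans[OF _ G(2)]) (auto simp: K_def clQ)
  have wi: "w (x, 0) = 0" if "x \<in> closure Q" for x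
  proof (rule continuous_constant_on_closure[OF _ _ that, of "\<lambda>x. w (x, 0)"])
    show "continuous_on (closure Q) (\<lambda>x. w (x, 0))"
      using T by (intro continuous_on_compose2[OF wc] continuous_intros) auto
    show "w (x, 0) = 0" if "x \<in> Q" for x
    proof -
      have "(x, 0) \<in> K" using that T closure_subset[of Q] by (auto simp: K_def clQ[symmetric])
      then show ?thesis using ui[OF that] G(4) by (simp add: w_def)
    qed
  qed
  have wb: "w ((X, s), t) = 0" if "X \<in> closure D" "s \<in> {\<alpha>..\<beta>}" "t \<in> {0<..<T}" "X \<in> frontier D \<or> s = \<alpha> \<or> s = \<beta>" for X s t
  proof -
    have "(X, s) \<in> frontier Q" unfolding Q_def by (rule frontier_cylinder[OF \<alpha>\<beta> that(1,2,4)])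
    moreover have "((X, s), t) \<in> K" using that by (auto simp: K_def)
    ultimately show ?thesis using ub that(3) G(4) by (simp add: w_def)
  qed
  have data: "bar.data_bounded_by C S v"
    unfolding bar.data_bounded_by_def
  proof (intro conjI ballI)
    show "parabolic_solution a b (\<lambda>t. c t + \<kappa>) S (D \<times> {\<alpha><..<\<beta>}) T v" using sol by (simp add: Q_def)
    show "continuous_on ((closure D \<times> {\<alpha>..\<beta>}) \<times> {0..<T}) v"
      using wc unfolding v_def clQ case_prod_unfold by (auto intro!: continuous_intros)
    show "v ((X, s), 0) = 0" if "X \<in> closure D" "s \<in> {\<alpha>..\<beta>}" for X s
      using wi[of "(X, s)"] that by (simp add: v_def clQ)
    show "v ((X, s), t) = 0" if "X \<in> frontier D" "s \<in> {\<alpha>..\<beta>}" "t \<in> {0<..<T}" for X s t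
      using wb[of X s t] that by (simp add: v_def frontier_def)
    show "\<bar>S ((X, s), t)\<bar> \<le> C" if "X \<in> D" "s \<in> {\<alpha><..<\<beta>}" "t \<in> {0<..<T}" for X s t
      using that closure_subset[of D] by (intro C(2)) (auto simp: K_def)
    show "\<bar>S ((X, x), t) - S ((X, y), t)\<bar> \<le> C * \<bar>x - y\<bar>"
      if "X \<in> D" "t \<in> {0<..<T}" "x \<in> {\<alpha><..<\<beta>}" "y \<in> {\<alpha><..<\<beta>}" for X t x y
      using that closure_subset[of D] by (intro C(3)) (auto simp: K_def)
    fix s assume s: "s \<in> {\<alpha>, \<beta>}"
    have "\<forall>X\<in>D. \<forall>t\<in>{0<..<T}. v ((X, s), t) = 0"
    proof (intro ballI)
      fix X t assume "X \<in> D" "t \<in> {0<..<T}"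
      then show "v ((X, s), t) = 0"
        using wb[of X s t] s \<alpha>\<beta> closure_subset[of D] by (auto simp: v_def)
    qed
    then show "(\<forall>X\<in>D. \<forall>t\<in>{0<..<T}. v ((X, s), t) = 0) \<or>
       (\<forall>X\<in>D. \<forall>t\<in>{0<..<T}. \<exists>d. ((\<lambda>r. v ((X, r), t)) has_field_derivative d) (at s within {\<alpha>..\<beta>}) \<and>
           \<bar>d\<bar> \<le> C * cosh (\<mu> * (\<beta> - \<alpha>) / 2))" by (rule disjI1)
  qed (use C(1) in auto)
  have "bounded (dx e\<^sub>n G ` K)"
    by (intro compact_imp_bounded compact_continuous_image K
        continuous_on_subset[OF smooth_on_imp_continuous_on[OF smooth_on_dx[OF G(1,3)]] G(2)])
  then obtain L where L: "\<And>z. z \<in> K \<Longrightarrow> \<bar>dx e\<^sub>n G z\<bar> \<le> L" by (auto simp: bounded_iff)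
  show ?thesis
  proof (intro exI ballI)
    fix X s t assume X: "X \<in> D" and s: "s \<in> {\<alpha><..<\<beta>}" and t: "t \<in> {0<..<T}"
    then have Qz: "((X, s), t) \<in> Q \<times> {0<..<T}" by (auto simp: Q_def)
    then have Kz: "((X, s), t) \<in> K" using QK by blast
    let ?d = "dx e\<^sub>n u ((X, s), t) - dx e\<^sub>n G ((X, s), t)"
    have "((\<lambda>r. v ((X, r), t)) has_field_derivative exp (- \<kappa> * t) * ?d) (at s)"
      unfolding v_def w_def prod.case
      by (intro DERIV_cmult DERIV_diff normal_derivative[OF us Qz] normal_derivative[OF G(3)]) (use Kz G(2) in blast)
    then have "\<bar>exp (- \<kappa> * t) * ?d\<bar> \<le> C * bar.\<eta> s"
      using X s t closure_subset[of D] by (intro bar.normal_derivative_estimate[OF data]) auto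
    also have "\<dots> \<le> C * cosh (\<mu> * (\<beta> - \<alpha>) / 2)"
      unfolding bar.\<eta>_def using s bar.\<mu>
      by (intro mult_left_mono C(1) less_imp_le[OF cosh_less_at_ends]) auto
    finally have "exp (\<kappa> * t) * \<bar>exp (- \<kappa> * t) * ?d\<bar> \<le> exp (\<kappa> * t) * (C * cosh (\<mu> * (\<beta> - \<alpha>) / 2))"
      by (intro mult_left_mono) auto
    moreover have "exp (\<kappa> * t) * \<bar>exp (- \<kappa> * t) * ?d\<bar> = \<bar>?d\<bar>"
      by (simp add: abs_mult mult.assoc[symmetric] exp_minus)
    moreover have "exp (\<kappa> * t) * (C * cosh (\<mu> * (\<beta> - \<alpha>) / 2)) \<le> exp (\<bar>\<kappa>\<bar> * T) * (C * cosh (\<mu> * (\<beta> - \<alpha>) / 2))"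
    proof (intro mult_right_mono)
      have "\<kappa> * t \<le> \<bar>\<kappa>\<bar> * T" using t by (intro mult_mono) auto
      then show "exp (\<kappa> * t) \<le> exp (\<bar>\<kappa>\<bar> * T)" by simp
    qed (use C(1) in auto)
    ultimately show "\<bar>dx e\<^sub>n u ((X, s), t)\<bar> \<le> L + exp (\<bar>\<kappa>\<bar> * T) * (C * cosh (\<mu> * (\<beta> - \<alpha>) / 2))"
      using L[OF Kz] by linarith
  qed
qed

end

section \<open>Contraction of the Schwarz iteration\<close>

lemma subdomain_geometry:
  assumes "subdomains N \<alpha> \<beta> lo hi"
  shows "2 \<le> N" "lo 1 = \<alpha>" "hi N = \<beta>"
    and "\<And>l. l \<in> {1..N-1} \<Longrightarrow> lo l < lo (l + 1)"
    and "\<And>l. l \<in> {1..N-1} \<Longrightarrow> lo (l + 1) < hi l"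
    and "\<And>l. l \<in> {1..N-1} \<Longrightarrow> hi l < hi (l + 1)"
    and "\<And>l. l \<in> {1..N} \<Longrightarrow> lo l < hi l"
    and "\<And>l. l \<in> {1..N} \<Longrightarrow> \<alpha> \<le> lo l"
    and "\<And>l. l \<in> {1..N} \<Longrightarrow> hi l \<le> \<beta>"
    and "\<And>l. l \<in> {2..N} \<Longrightarrow> \<alpha> < lo l"
    and "\<And>l. l \<in> {1..N-1} \<Longrightarrow> hi l < \<beta>"
    and "\<alpha> < \<beta>"
proof -
  show N: "2 \<le> N" and l1: "lo 1 = \<alpha>" and hN: "hi N = \<beta>"
    using assms by (auto simp: subdomains_def)
  have l12: "lo 1 < lo 2" and hNN: "hi (N - 1) < hi N" using assms by (auto simp: subdomains_def)
  show overlap: "lo (l + 1) < hi l" if "l \<in> {1..N-1}" for l using assms that by (auto simp: subdomains_def)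
  have gap: "hi l < lo (l + 2)" if "l \<in> {1..N-2}" for l using assms that by (auto simp: subdomains_def)
  show lo_step: "lo l < lo (l + 1)" if l: "l \<in> {1..N-1}" for l
  proof (cases "l = 1")
    case True
    then show ?thesis using l12 by (simp add: numeral_2_eq_2)
  next
    case False
    then have "l - 1 \<in> {1..N-1}" "l - 1 \<in> {1..N-2}" "l - 1 + 1 = l" "l - 1 + 2 = l + 1" using l by auto
    then have "lo l < hi (l - 1)" "hi (l - 1) < lo (l + 1)"
      using overlap[of "l - 1"] gap[of "l - 1"] by metis+
    then show ?thesis by simp
  qed
  show hi_step: "hi l < hi (l + 1)" if l: "l \<in> {1..N-1}" for l
  proof (cases "l = N - 1")
    case True
    then show ?thesis using hNN N by simp
  next
    case False
    then have "hi l < lo (l + 2)" "lo (l + 2) < hi (l + 1)"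
      using overlap[of "l + 1"] gap[of l] l by auto
    then show ?thesis by simp
  qed
  show lohi: "lo l < hi l" if l: "l \<in> {1..N}" for l
  proof (cases "l = N")
    case True
    have "N - 1 \<in> {1..N-1}" "N - 1 + 1 = N" using N by auto
    then have "lo N < hi (N - 1)" using overlap[of "N - 1"] by metis
    then show ?thesis using hNN True by simp
  next
    case False
    then have "l \<in> {1..N-1}" using l by auto
    then show ?thesis using overlap[of l] lo_step[of l] by simp
  qed
  have A: "1 \<le> l \<Longrightarrow> l \<le> N \<Longrightarrow> \<alpha> \<le> lo l" for l
  proof (induction l rule: dec_induct)
    case (step n)
    then have "n \<in> {1..N-1}" by (intro iffD2[OF atLeastAtMost_iff] conjI) linarith+
    then have "lo n < lo (Suc n)" using lo_step[of n] by simp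
    then show ?case using step by simp
  qed (use l1 in simp)
  then show lo_ge: "\<alpha> \<le> lo l" if "l \<in> {1..N}" for l using that by auto
  have B: "l \<le> N \<Longrightarrow> 1 \<le> l \<Longrightarrow> hi l \<le> \<beta>" for l
  proof (induction l rule: inc_induct)
    case (step n)
    then have "n \<in> {1..N-1}" by (intro iffD2[OF atLeastAtMost_iff] conjI) linarith+
    then have "hi n < hi (Suc n)" using hi_step[of n] by simp
    then show ?case using step by simp
  qed (use hN in simp)
  then show hi_le: "hi l \<le> \<beta>" if "l \<in> {1..N}" for l using that by auto
  show "\<alpha> < lo l" if "l \<in> {2..N}" for l
  proof -
    have "lo (l - 1) < lo (l - 1 + 1)" using that by (intro lo_step) auto
    moreover have "\<alpha> \<le> lo (l - 1)" using that by (intro lo_ge) auto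
    ultimately show ?thesis using that by simp
  qed
  show "hi l < \<beta>" if "l \<in> {1..N-1}" for l
  proof -
    have "1 \<le> l" "l \<le> N - 1" using that by auto
    then have "l + 1 \<in> {1..N}" using N by (intro iffD2[OF atLeastAtMost_iff] conjI) linarith+
    then show ?thesis using hi_step[OF that] hi_le[of "l + 1"] by linarith
  qed
  show "\<alpha> < \<beta>" using lo_ge[of 1] lohi[of 1] hi_le[of 1] N by auto
qed

lemma robin_trace_interior:
  assumes "((\<lambda>r. v ((X, r), t)) has_field_derivative d) (at s)" "x < s" "s < y"
  shows "robin_trace p {x..y} v s X t = d + p * v ((X, s), t)"
proof -
  have "((\<lambda>r. v ((X, r), t)) has_vector_derivative d) (at s within {x..y})"
    using assms(1) by (simp add: has_real_derivative_iff_has_vector_derivative[symmetric] has_field_derivative_at_within)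
  then show ?thesis
    using assms(2,3) vector_derivative_within_closed_interval[of x y s] unfolding robin_trace_def by force
qed

text \<open>At an end point of the interval only the existence of the one-sided derivative is known.\<close>

lemma robin_trace_end:
  assumes "dn_differentiable J v s X t"
  shows "((\<lambda>r. v ((X, r), t)) has_field_derivative robin_trace p J v s X t - p * v ((X, s), t)) (at s within J)"
  using assms unfolding dn_differentiable_def robin_trace_def
  by (simp add: vector_derivative_works has_real_derivative_iff_has_vector_derivative)

text \<open>The derivative of the weighted function is the weighted Robin trace.\<close>

lemma weighted_derivative:
  fixes p \<kappa> :: real
  assumes "((\<lambda>r. w ((X, r), t)) has_field_derivative d) (at s within J)"
  shows "((\<lambda>r. exp (p * r - \<kappa> * t) * w ((X, r), t)) has_field_derivative
     exp (p * s - \<kappa> * t) * (d + p * w ((X, s), t))) (at s within J)"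
  using assms by (auto intro!: derivative_eq_intros simp: algebra_simps)

lemma dx_normalI:
  assumes "((\<lambda>r. w ((X, r), t)) has_field_derivative d) (at s)"
  shows "dx e\<^sub>n w ((X, s), t) = d"
proof -
  have "((\<lambda>h. w ((X, s + h), t)) has_field_derivative d) (at 0)"
    using DERIV_shift[of "\<lambda>r. w ((X, r), t)" d 0 s] assms by (simp add: add.commute)
  then show ?thesis by (auto simp: dx_def intro: DERIV_imp_deriv)
qed

text \<open>Let \<open>v k l\<close> be the weighted error in the \<open>l\<close>-th subdomain at iteration \<open>k + 1\<close>.  Its normal derivative
on an interface is the weighted difference of Robin traces, which the transmission conditions
transport from the neighbouring subdomain at the previous iteration.  There the interface is an
interior plane, and the slab estimate supplies a factor \<open>q < 1\<close>.  The supremum of the fluxes over all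
interfaces thus decays geometrically with \<open>\<gamma>\<close>, the largest of these factors; the slab estimate turns
this into decay of the errors and of their normal derivatives.\<close>

lemma (in parabolic_setting) schwarz_error_decay:
  assumes f: "smooth_on_closure f ((D \<times> {\<alpha><..<\<beta>}) \<times> {0<..<T})"
    and g: "smooth_on_closure g ((D \<times> {\<alpha><..<\<beta>}) \<times> {0<..<T})"
    and h0: "bounded (h0 ` closure ((D \<times> {\<alpha><..<\<beta>}) \<times> {0<..<T}))"
    and sub: "subdomains N \<alpha> \<beta> lo hi"
    and u: "solves_P T a b c f g (D \<times> {\<alpha><..<\<beta>}) u"
    and ubd: "bounded (u ` ((D \<times> {\<alpha><..<\<beta>}) \<times> {0<..<T}))"
    and U: "schwarz_iterates T a b c f g D \<alpha> \<beta> N lo hi p h0 U"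
  shows "\<exists>R \<gamma>. 0 \<le> \<gamma> \<and> \<gamma> < 1 \<and> (\<forall>k. \<forall>l\<in>{1..N}. \<forall>z\<in>(D \<times> {lo l<..<hi l}) \<times> {0<..<T}.
     \<bar>U (Suc k) l z - u z\<bar> \<le> R * \<gamma> ^ k \<and> \<bar>dx e\<^sub>n (\<lambda>z. U (Suc k) l z - u z) z\<bar> \<le> R * \<gamma> ^ k)"
proof -
  note geo = subdomain_geometry[OF sub]
  have sub\<alpha>\<beta>: "lo l \<ge> \<alpha>" "hi l \<le> \<beta>" "lo l < hi l" if "l \<in> {1..N}" for l
    using geo(7-9)[OF that] by auto
  define Q where "Q l = D \<times> {lo l<..<hi l}" for l
  define \<Omega> where "\<Omega> = D \<times> {\<alpha><..<\<beta>}"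
  have oQ: "open (Q l)" for l using D unfolding Q_def by (intro open_Times) auto
  have Q\<Omega>: "Q l \<subseteq> \<Omega>" if "l \<in> {1..N}" for l using sub\<alpha>\<beta>[OF that] by (auto simp: Q_def \<Omega>_def)
  have clQ: "closure (Q l) = closure D \<times> {lo l..hi l}" if "l \<in> {1..N}" for l
    unfolding Q_def by (rule closure_cylinder[OF sub\<alpha>\<beta>(3)[OF that]])
  have cl\<Omega>: "closure \<Omega> = closure D \<times> {\<alpha>..\<beta>}" unfolding \<Omega>_def by (rule closure_cylinder[OF geo(12)])
  have us: "smooth_on u (\<Omega> \<times> {0<..<T})" and uc: "continuous_on (closure \<Omega> \<times> {0..<T}) u"
    and ueq: "\<And>z. z \<in> \<Omega> \<times> {0<..<T} \<Longrightarrow> parabolic_op a b c u z = f z"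
    and ub: "\<And>z. z \<in> frontier \<Omega> \<times> {0<..<T} \<Longrightarrow> u z = g z" and ui: "\<And>x. x \<in> \<Omega> \<Longrightarrow> u (x, 0) = g (x, 0)"
    using u unfolding solves_P_def classical_solution_def \<Omega>_def by auto
  have Us: "smooth_on (U (Suc k) l) (Q l \<times> {0<..<T})"
    and Uc: "continuous_on (closure (Q l) \<times> {0..<T}) (U (Suc k) l)"
    and Ueq: "\<And>z. z \<in> Q l \<times> {0<..<T} \<Longrightarrow> parabolic_op a b c (U (Suc k) l) z = f z"
    and Ub: "\<And>z. z \<in> (frontier (Q l) \<inter> frontier \<Omega>) \<times> {0<..<T} \<Longrightarrow> U (Suc k) l z = g z"
    and Ui: "\<And>x. x \<in> Q l \<Longrightarrow> U (Suc k) l (x, 0) = g (x, 0)"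
    if "l \<in> {1..N}" for k l
    using U that unfolding schwarz_iterates_def classical_solution_def Q_def \<Omega>_def by auto
  have Ulo: "dn_differentiable {lo l..hi l} (U (Suc k) l) (lo l) X t"
      "robin_trace p {lo l..hi l} (U (Suc k) l) (lo l) X t =
         (if k = 0 then h0 ((X, lo l), t)
          else robin_trace p {lo (l - 1)..hi (l - 1)} (U k (l - 1)) (lo l) X t)"
    if "l \<in> {2..N}" "X \<in> D" "t \<in> {0<..<T}" for k l X t
    using U that unfolding schwarz_iterates_def by auto
  have Uhi: "dn_differentiable {lo l..hi l} (U (Suc k) l) (hi l) X t"
      "robin_trace p {lo l..hi l} (U (Suc k) l) (hi l) X t =
         (if k = 0 then h0 ((X, hi l), t)
          else robin_trace p {lo (l + 1)..hi (l + 1)} (U k (l + 1)) (hi l) X t)"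
    if "l \<in> {1..N-1}" "X \<in> D" "t \<in> {0<..<T}" for k l X t
    using U that unfolding schwarz_iterates_def by auto

  define L where "L = Min ((\<lambda>l. hi l - lo l) ` {1..N})"
  have L: "L > 0" "\<And>l. l \<in> {1..N} \<Longrightarrow> L \<le> hi l - lo l"
    using sub\<alpha>\<beta>(3) geo(1) by (auto simp: L_def)
  obtain \<mu> \<kappa> where \<mu>: "\<mu> > 0" and barrier: "\<And>lo hi. L \<le> hi - lo \<Longrightarrow> cosh_barrier D lo hi T \<mu> a
    (\<lambda>t i. b t i + p * (a t i e\<^sub>n + a t e\<^sub>n i)) (\<lambda>t. c t + \<kappa> - p * b t e\<^sub>n - p\<^sup>2 * a t e\<^sub>n e\<^sub>n)"
    using cosh_barrier_exists[OF L(1)] by blast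
  \<comment> \<open>ratio of the barrier at \<open>s\<close> to its value at the ends of the \<open>l\<close>-th interval\<close>
  define q where "q l s = cosh (\<mu> * (s - (lo l + hi l) / 2)) / cosh (\<mu> * (hi l - lo l) / 2)" for l s
  have q: "0 < q l s" "q l s < 1" if "s \<in> {lo l<..<hi l}" for l s
    using cosh_less_at_ends[OF \<mu>, of "lo l" s "hi l"] that by (auto simp: q_def)
  \<comment> \<open>worst ratio over the interfaces at which a subdomain is read by a neighbour\<close>
  define \<gamma> where "\<gamma> = Max ((\<lambda>l. max (q l (lo (l + 1))) (q (l + 1) (hi l))) ` {1..N-1})"
  have fin: "finite ((\<lambda>l. max (q l (lo (l + 1))) (q (l + 1) (hi l))) ` {1..N-1})"
    "(\<lambda>l. max (q l (lo (l + 1))) (q (l + 1) (hi l))) ` {1..N-1} \<noteq> {}" using geo(1) by auto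
  have inter: "lo (l + 1) \<in> {lo l<..<hi l}" "hi l \<in> {lo (l + 1)<..<hi (l + 1)}" if "l \<in> {1..N-1}" for l
    using geo(4-6)[OF that] by auto
  have \<gamma>_ge: "q l (lo (l + 1)) \<le> \<gamma>" "q (l + 1) (hi l) \<le> \<gamma>" if "l \<in> {1..N-1}" for l
  proof -
    have "max (q l (lo (l + 1))) (q (l + 1) (hi l)) \<le> \<gamma>"
      unfolding \<gamma>_def using that by (intro Max_ge fin imageI)
    then show "q l (lo (l + 1)) \<le> \<gamma>" "q (l + 1) (hi l) \<le> \<gamma>" by auto
  qed
  have \<gamma>1: "\<gamma> < 1" unfolding \<gamma>_def using q(2) inter by (subst Max_less_iff[OF fin]) auto
  have \<gamma>0: "0 \<le> \<gamma>"
  proof -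
    have "1 \<in> {1..N-1}" using geo(1) by auto
    from \<gamma>_ge(1)[OF this] q(1)[OF inter(1)[OF this]] show ?thesis by linarith
  qed

  obtain Bd where Bd: "\<And>X s t. X \<in> D \<Longrightarrow> s \<in> {\<alpha><..<\<beta>} \<Longrightarrow> t \<in> {0<..<T} \<Longrightarrow> \<bar>dx e\<^sub>n u ((X, s), t)\<bar> \<le> Bd"
    using normal_derivative_bounded[OF geo(12) f g u] by blast
  obtain Bu where Bu: "\<And>z. z \<in> \<Omega> \<times> {0<..<T} \<Longrightarrow> \<bar>u z\<bar> \<le> Bu"
    using ubd by (auto simp: bounded_iff \<Omega>_def)
  obtain Bh where Bh: "\<And>z. z \<in> closure (\<Omega> \<times> {0<..<T}) \<Longrightarrow> \<bar>h0 z\<bar> \<le> Bh"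
    using h0 by (auto simp: bounded_iff \<Omega>_def)
  \<comment> \<open>bounds the weight and its reciprocal on the whole space-time cylinder\<close>
  define E where "E = exp (\<bar>p\<bar> * max \<bar>\<alpha>\<bar> \<bar>\<beta>\<bar> + \<bar>\<kappa>\<bar> * T)"
  have E: "exp (p * s - \<kappa> * t) \<le> E" "exp (- (p * s - \<kappa> * t)) \<le> E" if "s \<in> {\<alpha>..\<beta>}" "t \<in> {0<..<T}" for s t
  proof -
    have "\<bar>p * s\<bar> \<le> \<bar>p\<bar> * max \<bar>\<alpha>\<bar> \<bar>\<beta>\<bar>" unfolding abs_mult using that by (intro mult_left_mono) auto
    moreover have "\<bar>\<kappa> * t\<bar> \<le> \<bar>\<kappa>\<bar> * T" unfolding abs_mult using that by (intro mult_left_mono) auto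
    ultimately show "exp (p * s - \<kappa> * t) \<le> E" "exp (- (p * s - \<kappa> * t)) \<le> E" unfolding E_def exp_le_cancel_iff by linarith+
  qed
  have E0: "E > 0" by (simp add: E_def)
  define R where "R = E * (\<bar>Bh\<bar> + \<bar>Bd\<bar> + \<bar>p\<bar> * \<bar>Bu\<bar>)"
  have R0: "R \<ge> 0" using E0 by (simp add: R_def)

  define e where "e k l = (\<lambda>z. U (Suc k) l z - u z)" for k l
  define v where "v k l = (\<lambda>(x, t). exp (p * snd x - \<kappa> * t) * e k l (x, t))" for k l
  have ec: "continuous_on (closure (Q l) \<times> {0..<T}) (e k l)" if "l \<in> {1..N}" for k l
    unfolding e_def
    by (intro continuous_on_diff Uc[OF that] continuous_on_subset[OF uc] Sigma_mono closure_mono Q\<Omega>[OF that] order_refl)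
  have e_init: "e k l (x, 0) = 0" if l: "l \<in> {1..N}" and x: "x \<in> closure (Q l)" for k l x
  proof (rule continuous_constant_on_closure[OF _ _ x, of "\<lambda>x. e k l (x, 0)"])
    show "continuous_on (closure (Q l)) (\<lambda>x. e k l (x, 0))"
      using T by (intro continuous_on_compose2[OF ec[OF l]] continuous_intros) auto
    show "e k l (x, 0) = 0" if "x \<in> Q l" for x
      using Ui[OF l that] ui[of x] Q\<Omega>[OF l] that by (auto simp: e_def)
  qed
  have e_bdry: "e k l ((X, s), t) = 0"
    if l: "l \<in> {1..N}" and X: "X \<in> closure D" and s: "s \<in> {lo l..hi l}" and t: "t \<in> {0<..<T}"
      and bd: "X \<in> frontier D \<or> (s = lo l \<and> l = 1) \<or> (s = hi l \<and> l = N)" for k l X s t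
  proof -
    have "(X, s) \<in> frontier (Q l)"
      unfolding Q_def using bd by (intro frontier_cylinder sub\<alpha>\<beta>(3)[OF l] X s) auto
    moreover have "(X, s) \<in> frontier \<Omega>"
      unfolding \<Omega>_def using bd s sub\<alpha>\<beta>[OF l] geo(2,3) by (intro frontier_cylinder geo(12) X) auto
    ultimately show ?thesis using Ub[OF l, of "((X, s), t)"] ub[of "((X, s), t)"] t by (auto simp: e_def)
  qed
  have e_sol: "parabolic_solution a b c (\<lambda>z. 0) (Q l) T (e k l)" if l: "l \<in> {1..N}" for k l
  proof -
    have "smooth_on u (Q l \<times> {0<..<T})"
      using Q\<Omega>[OF l] by (intro smooth_on_subset[OF us]) auto
    from parabolic_solution_diff[OF smooth_imp_parabolic_solution[OF oQ Us[OF l]] smooth_imp_parabolic_solution[OF oQ this]]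
    show ?thesis
      unfolding e_def
    proof (rule parabolic_solution_cong[OF _ subset_refl])
      fix x t assume "x \<in> Q l" "t \<in> {0<..<T}"
      then show "parabolic_op a b c (U (Suc k) l) (x, t) - parabolic_op a b c u (x, t) = 0"
        using Ueq[OF l, of "(x, t)" k] ueq[of "(x, t)"] Q\<Omega>[OF l] by auto
    qed
  qed
  have v_sol: "parabolic_solution a (\<lambda>t i. b t i + p * (a t i e\<^sub>n + a t e\<^sub>n i))
      (\<lambda>t. c t + \<kappa> - p * b t e\<^sub>n - p\<^sup>2 * a t e\<^sub>n e\<^sub>n) (\<lambda>z. 0) (D \<times> {lo l<..<hi l}) T (v k l)" if l: "l \<in> {1..N}" for k l
    using parabolic_solution_exp_mult[OF e_sol[OF l] e\<^sub>n_Basis, of p \<kappa> k]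
    by (simp add: v_def Q_def case_prod_unfold inner_prod_def)

  have normal_e: "((\<lambda>r. e k l ((X, r), t)) has_field_derivative dx e\<^sub>n (U (Suc k) l) ((X, s), t) - dx e\<^sub>n u ((X, s), t)) (at s)"
    if l: "l \<in> {1..N}" and X: "X \<in> D" and s: "s \<in> {lo l<..<hi l}" and t: "t \<in> {0<..<T}" for k l X s t
    unfolding e_def using that sub\<alpha>\<beta>[OF l]
    by (intro DERIV_diff normal_derivative[OF Us[OF l]] normal_derivative[OF us]) (auto simp: Q_def \<Omega>_def)
  define ru where "ru X s t = dx e\<^sub>n u ((X, s), t) + p * u ((X, s), t)" for X s t
  have v_interior: "((\<lambda>r. v k l ((X, r), t)) has_field_derivative
       exp (p * s - \<kappa> * t) * (robin_trace p {lo l..hi l} (U (Suc k) l) s X t - ru X s t)) (at s)"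
    if l: "l \<in> {1..N}" and X: "X \<in> D" and s: "s \<in> {lo l<..<hi l}" and t: "t \<in> {0<..<T}" for k l X s t
  proof -
    have "((\<lambda>r. U (Suc k) l ((X, r), t)) has_field_derivative dx e\<^sub>n (U (Suc k) l) ((X, s), t)) (at s)"
      using X s t by (intro normal_derivative[OF Us[OF l]]) (auto simp: Q_def)
    from robin_trace_interior[OF this, of "lo l" "hi l" p] s
    have "(dx e\<^sub>n (U (Suc k) l) ((X, s), t) - dx e\<^sub>n u ((X, s), t)) + p * e k l ((X, s), t)
        = robin_trace p {lo l..hi l} (U (Suc k) l) s X t - ru X s t"
      by (simp add: ru_def e_def right_diff_distrib)
    then show ?thesis
      using weighted_derivative[where w = "e k l", OF normal_e[OF that, of k], of p \<kappa>] by (simp add: v_def)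
  qed
  have v_end: "((\<lambda>r. v k l ((X, r), t)) has_field_derivative
       exp (p * s - \<kappa> * t) * (robin_trace p {lo l..hi l} (U (Suc k) l) s X t - ru X s t)) (at s within {lo l..hi l})"
    if dn: "dn_differentiable {lo l..hi l} (U (Suc k) l) s X t"
      and X: "X \<in> D" and s: "s \<in> {\<alpha><..<\<beta>}" and t: "t \<in> {0<..<T}" for k l X s t
  proof -
    have "((\<lambda>r. u ((X, r), t)) has_field_derivative dx e\<^sub>n u ((X, s), t)) (at s within {lo l..hi l})"
      by (rule has_field_derivative_at_within[OF normal_derivative[OF us]]) (use X s t in \<open>auto simp: \<Omega>_def\<close>)
    then have "((\<lambda>r. e k l ((X, r), t)) has_field_derivative
        robin_trace p {lo l..hi l} (U (Suc k) l) s X t - p * U (Suc k) l ((X, s), t) - dx e\<^sub>n u ((X, s), t))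
        (at s within {lo l..hi l})"
      using DERIV_diff[OF robin_trace_end[OF dn, of p]] unfolding e_def by blast
    from weighted_derivative[where w = "e k l", OF this, of p \<kappa>]
    have "((\<lambda>r. v k l ((X, r), t)) has_field_derivative exp (p * s - \<kappa> * t) *
       (robin_trace p {lo l..hi l} (U (Suc k) l) s X t - p * U (Suc k) l ((X, s), t) - dx e\<^sub>n u ((X, s), t)
          + p * e k l ((X, s), t))) (at s within {lo l..hi l})"
      by (simp add: v_def)
    moreover have "robin_trace p {lo l..hi l} (U (Suc k) l) s X t - p * U (Suc k) l ((X, s), t) - dx e\<^sub>n u ((X, s), t)
          + p * e k l ((X, s), t) = robin_trace p {lo l..hi l} (U (Suc k) l) s X t - ru X s t"
      by (simp add: e_def ru_def right_diff_distrib)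
    ultimately show ?thesis by simp
  qed

  \<comment> \<open>the normal derivative of \<open>v k l\<close>, expressed so that the transmission conditions apply to it\<close>
  define flux where "flux k l s X t = exp (p * s - \<kappa> * t) * (robin_trace p {lo l..hi l} (U (Suc k) l) s X t - ru X s t)" for k l s X t
  define bounded_flux where "bounded_flux k \<longleftrightarrow> (\<forall>X\<in>D. \<forall>t\<in>{0<..<T}.
      (\<forall>l\<in>{2..N}. \<bar>flux k l (lo l) X t\<bar> \<le> R * \<gamma> ^ k) \<and> (\<forall>l\<in>{1..N-1}. \<bar>flux k l (hi l) X t\<bar> \<le> R * \<gamma> ^ k))" for k

  have estimate: "\<bar>v k l ((X, s), t)\<bar> \<le> R * \<gamma> ^ k * q l s" "\<bar>flux k l s X t\<bar> \<le> R * \<gamma> ^ k * q l s"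
    if bf: "bounded_flux k" and l: "l \<in> {1..N}" and X: "X \<in> D" and s: "s \<in> {lo l<..<hi l}" and t: "t \<in> {0<..<T}" for k l X s t
  proof -
    interpret bar: cosh_barrier D "lo l" "hi l" T \<mu> a "\<lambda>t i. b t i + p * (a t i e\<^sub>n + a t e\<^sub>n i)"
      "\<lambda>t. c t + \<kappa> - p * b t e\<^sub>n - p\<^sup>2 * a t e\<^sub>n e\<^sub>n"
      by (rule barrier[OF L(2)[OF l]])
    have cont: "continuous_on ((closure D \<times> {lo l..hi l}) \<times> {0..<T}) (v k l)"
      using ec[OF l, of k] unfolding v_def clQ[OF l] case_prod_unfold by (auto intro!: continuous_intros)
    have bd: "(\<forall>X\<in>D. \<forall>t\<in>{0<..<T}. v k l ((X, s), t) = 0) \<or>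
       (\<forall>X\<in>D. \<forall>t\<in>{0<..<T}. \<exists>d. ((\<lambda>r. v k l ((X, r), t)) has_field_derivative d) (at s within {lo l..hi l}) \<and> \<bar>d\<bar> \<le> R * \<gamma> ^ k)"
      if s: "s \<in> {lo l, hi l}" for s
    proof (cases "(s = lo l \<and> l = 1) \<or> (s = hi l \<and> l = N)")
      case True
      have "v k l ((X, s), t) = 0" if "X \<in> D" "t \<in> {0<..<T}" for X t
        using e_bdry[OF l _ _ that(2), of X s k] that(1) closure_subset[of D] True sub\<alpha>\<beta>(3)[OF l] s
        by (auto simp: v_def)
      then show ?thesis by blast
    next
      case False
      have "\<exists>d. ((\<lambda>r. v k l ((X, r), t)) has_field_derivative d) (at s within {lo l..hi l}) \<and> \<bar>d\<bar> \<le> R * \<gamma> ^ k"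
        if X: "X \<in> D" and t: "t \<in> {0<..<T}" for X t
      proof (cases "s = lo l")
        case True
        then have l2: "l \<in> {2..N}" using False l by auto
        have "lo l \<in> {\<alpha><..<\<beta>}" using geo(10)[OF l2] sub\<alpha>\<beta>[OF l] by auto
        from v_end[OF Ulo(1)[OF l2 X t] X this t] show ?thesis
          using bf X t l2 unfolding True bounded_flux_def flux_def by blast
      next
        case neq: False
        then have hi: "s = hi l" and l2: "l \<in> {1..N-1}" using False l s by auto
        have "hi l \<in> {\<alpha><..<\<beta>}" using geo(11)[OF l2] sub\<alpha>\<beta>[OF l] by auto
        from v_end[OF Uhi(1)[OF l2 X t] X this t] show ?thesis
          using bf X t l2 unfolding hi bounded_flux_def flux_def by blast
      qed
      then show ?thesis by blast
    qed
    have init: "v k l ((X, s), 0) = 0" if "X \<in> closure D" "s \<in> {lo l..hi l}" for X s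
      using e_init[OF l, of "(X, s)" k] that by (simp add: v_def clQ[OF l])
    have lat: "v k l ((X, s), t) = 0" if "X \<in> frontier D" "s \<in> {lo l..hi l}" "t \<in> {0<..<T}" for X s t
      using e_bdry[OF l _ that(2,3), of X k] that(1) by (simp add: v_def frontier_def)
    have "R * \<gamma> ^ k \<ge> 0" using R0 \<gamma>0 by simp
    note est = bar.homogeneous_estimate[OF v_sol[OF l] cont init lat this bd X s t, folded q_def]
    show "\<bar>v k l ((X, s), t)\<bar> \<le> R * \<gamma> ^ k * q l s" by (rule est(1))
    show "\<bar>flux k l s X t\<bar> \<le> R * \<gamma> ^ k * q l s"
    proof -
      have "((\<lambda>r. v k l ((X, r), t)) has_field_derivative flux k l s X t) (at s)"
        unfolding flux_def by (rule v_interior[OF l X s t])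
      then show ?thesis by (intro est(2)) assumption+
    qed
  qed

  have bounded_flux: "bounded_flux k" for k
  proof (induction k)
    case 0
    have "\<bar>exp (p * s - \<kappa> * t) * (h0 ((X, s), t) - ru X s t)\<bar> \<le> R"
      if X: "X \<in> D" and s: "s \<in> {\<alpha><..<\<beta>}" and t: "t \<in> {0<..<T}" for X s t
    proof -
      have z: "((X, s), t) \<in> \<Omega> \<times> {0<..<T}" using that by (auto simp: \<Omega>_def)
      then have "((X, s), t) \<in> closure (\<Omega> \<times> {0<..<T})" using closure_subset[of "\<Omega> \<times> {0<..<T}"] by (rule rev_subsetD)
      then have "\<bar>h0 ((X, s), t)\<bar> \<le> \<bar>Bh\<bar>" using Bh[of "((X, s), t)"] by linarith
      moreover have "\<bar>dx e\<^sub>n u ((X, s), t)\<bar> \<le> \<bar>Bd\<bar>" using Bd[OF that] by linarith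
      moreover have "\<bar>p * u ((X, s), t)\<bar> \<le> \<bar>p\<bar> * \<bar>Bu\<bar>"
        unfolding abs_mult using Bu[OF z] by (intro mult_left_mono) auto
      moreover have "\<bar>x - (y + z)\<bar> \<le> A + B + C" if "\<bar>x\<bar> \<le> A" "\<bar>y\<bar> \<le> B" "\<bar>z\<bar> \<le> C" for x y z A B C :: real
        using that by linarith
      ultimately have "\<bar>h0 ((X, s), t) - ru X s t\<bar> \<le> \<bar>Bh\<bar> + \<bar>Bd\<bar> + \<bar>p\<bar> * \<bar>Bu\<bar>"
        unfolding ru_def by blast
      then show ?thesis
        unfolding abs_mult abs_exp_cancel R_def using E(1)[of s t] E0 s t by (intro mult_mono) auto
    qed
    moreover have "lo l \<in> {\<alpha><..<\<beta>}" if "l \<in> {2..N}" for l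
      using geo(10)[OF that] sub\<alpha>\<beta>[of l] that by auto
    moreover have "hi l \<in> {\<alpha><..<\<beta>}" if "l \<in> {1..N-1}" for l
    proof -
      have "l \<in> {1..N}" using that diff_le_self[of N 1] by (meson atLeastAtMost_iff le_trans)
      then show ?thesis using geo(11)[OF that] sub\<alpha>\<beta>[of l] by auto
    qed
    ultimately show ?case
      unfolding bounded_flux_def flux_def using Ulo(2)[of _ _ _ 0] Uhi(2)[of _ _ _ 0] by simp
  next
    case (Suc k)
    have step: "\<bar>flux k j s X t\<bar> \<le> R * \<gamma> ^ Suc k"
      if "j \<in> {1..N}" "s \<in> {lo j<..<hi j}" "q j s \<le> \<gamma>" "X \<in> D" "t \<in> {0<..<T}" for j s X t
    proof -
      have "\<bar>flux k j s X t\<bar> \<le> R * \<gamma> ^ k * q j s" using that by (intro estimate(2)[OF Suc]) auto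
      also have "\<dots> \<le> R * \<gamma> ^ k * \<gamma>" using that R0 \<gamma>0 by (intro mult_left_mono) auto
      finally show ?thesis by (simp add: mult_ac)
    qed
    show ?case
      unfolding bounded_flux_def
    proof (intro ballI conjI)
      fix X t l assume X: "X \<in> D" and t: "t \<in> {0<..<T}" and l: "l \<in> {2..N}"
      define j where "j = l - 1"
      have j: "j \<in> {1..N-1}" "l = j + 1" using l by (auto simp: j_def)
      have "flux (Suc k) l (lo l) X t = flux k j (lo l) X t"
        unfolding flux_def using Ulo(2)[OF l X t, of "Suc k"] by (simp add: j_def)
      then show "\<bar>flux (Suc k) l (lo l) X t\<bar> \<le> R * \<gamma> ^ Suc k"
        using step[of j "lo l" X t] inter(1)[OF j(1)] \<gamma>_ge(1)[OF j(1)] j X t by auto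
    next
      fix X t l assume X: "X \<in> D" and t: "t \<in> {0<..<T}" and l: "l \<in> {1..N-1}"
      have "flux (Suc k) l (hi l) X t = flux k (l + 1) (hi l) X t"
        unfolding flux_def using Uhi(2)[OF l X t, of "Suc k"] by simp
      then show "\<bar>flux (Suc k) l (hi l) X t\<bar> \<le> R * \<gamma> ^ Suc k"
        using step[of "l + 1" "hi l" X t] inter(2)[OF l] \<gamma>_ge(2)[OF l] l X t by auto
    qed
  qed

  have final: "\<bar>e k l ((X, s), t)\<bar> \<le> E * R * \<gamma> ^ k"
      "\<bar>dx e\<^sub>n (e k l) ((X, s), t)\<bar> \<le> (1 + \<bar>p\<bar>) * (E * R * \<gamma> ^ k)"
    if l: "l \<in> {1..N}" and X: "X \<in> D" and s: "s \<in> {lo l<..<hi l}" and t: "t \<in> {0<..<T}" for k l X s t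
  proof -
    define \<rho> where "\<rho> = exp (- (p * s - \<kappa> * t))"
    have \<rho>: "\<rho> * (exp (p * s - \<kappa> * t) * y) = y" for y
      by (simp add: \<rho>_def mult.assoc[symmetric] exp_add[symmetric])
    have \<rho>E: "0 \<le> \<rho>" "\<rho> \<le> E" using E(2)[of s t] sub\<alpha>\<beta>[OF l] s t by (auto simp: \<rho>_def)
    have Rk: "R * \<gamma> ^ k \<ge> 0" using R0 \<gamma>0 by simp
    have "R * \<gamma> ^ k * q l s \<le> R * \<gamma> ^ k * 1" using q(2)[OF s] Rk by (intro mult_left_mono) auto
    then have b: "\<bar>v k l ((X, s), t)\<bar> \<le> R * \<gamma> ^ k" "\<bar>flux k l s X t\<bar> \<le> R * \<gamma> ^ k"
      using estimate[OF bounded_flux[of k] that] by linarith+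
    have scale: "\<bar>\<rho> * y\<bar> \<le> E * R * \<gamma> ^ k" if "\<bar>y\<bar> \<le> R * \<gamma> ^ k" for y
      unfolding abs_mult mult.assoc using \<rho>E that by (intro mult_mono) auto
    have e1: "e k l ((X, s), t) = \<rho> * v k l ((X, s), t)" by (simp add: v_def \<rho>)
    then show e2: "\<bar>e k l ((X, s), t)\<bar> \<le> E * R * \<gamma> ^ k" using scale[OF b(1)] by simp
    have "((\<lambda>r. v k l ((X, r), t)) has_field_derivative
       exp (p * s - \<kappa> * t) * ((dx e\<^sub>n (U (Suc k) l) ((X, s), t) - dx e\<^sub>n u ((X, s), t)) + p * e k l ((X, s), t))) (at s)"
      using weighted_derivative[where w = "e k l", OF normal_e[OF that, of k], of p \<kappa>] by (simp add: v_def)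
    from DERIV_unique[OF this v_interior[OF that]] dx_normalI[OF normal_e[OF that, of k]]
    have "exp (p * s - \<kappa> * t) * (dx e\<^sub>n (e k l) ((X, s), t) + p * e k l ((X, s), t)) = flux k l s X t"
      by (simp add: flux_def)
    then have "dx e\<^sub>n (e k l) ((X, s), t) + p * e k l ((X, s), t) = \<rho> * flux k l s X t" using \<rho> by metis
    moreover have "\<bar>p * e k l ((X, s), t)\<bar> \<le> \<bar>p\<bar> * (E * R * \<gamma> ^ k)"
      unfolding abs_mult using e2 by (intro mult_left_mono) auto
    ultimately show "\<bar>dx e\<^sub>n (e k l) ((X, s), t)\<bar> \<le> (1 + \<bar>p\<bar>) * (E * R * \<gamma> ^ k)"
      using scale[OF b(2)] unfolding distrib_right by linarith
  qed
  have le: "E * R * \<gamma> ^ k \<le> (1 + \<bar>p\<bar>) * (E * R) * \<gamma> ^ k" for k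
    using R0 E0 \<gamma>0 by (intro mult_right_mono) (auto simp: distrib_right)
  show ?thesis
  proof (intro exI conjI allI ballI)
    show "0 \<le> \<gamma>" "\<gamma> < 1" by fact+
    fix k l z assume l: "l \<in> {1..N}" and z: "z \<in> (D \<times> {lo l<..<hi l}) \<times> {0<..<T}"
    obtain X s t where z': "z = ((X, s), t)" "X \<in> D" "s \<in> {lo l<..<hi l}" "t \<in> {0<..<T}"
      using z by (cases z) auto
    show "\<bar>U (Suc k) l z - u z\<bar> \<le> (1 + \<bar>p\<bar>) * (E * R) * \<gamma> ^ k"
      using final(1)[OF l z'(2-4), of k] le[of k] by (simp add: e_def z'(1))
    show "\<bar>dx e\<^sub>n (\<lambda>z. U (Suc k) l z - u z) z\<bar> \<le> (1 + \<bar>p\<bar>) * (E * R) * \<gamma> ^ k"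
      using final(2)[OF l z'(2-4), of k] by (simp add: e_def z'(1) mult.assoc)
  qed
qed

section \<open>Convergence\<close>

text \<open>On a bounded time interval a positive continuous weight \<open>\<phi>\<close> is bounded, and the geometric decay of the
normal derivatives already holds with exponential weights in time removed.  Hence the convergence
takes place for every \<open>\<phi>\<close>, and \<open>\<Lambda> = 0\<close> serves.  The limits are taken along \<open>k + 1\<close> because
the algorithm defines the iterates from \<open>k = 1\<close> on.\<close>

theorem theorem2p1:
  fixes D :: "(real ^ 'm::finite) set"
    and T \<alpha> \<beta> p :: real
    and a :: "real \<Rightarrow> 'm pt \<Rightarrow> 'm pt \<Rightarrow> real"
    and b :: "real \<Rightarrow> 'm pt \<Rightarrow> real"
    and c :: "real \<Rightarrow> real"
    and f g h0 u :: "'m pt \<times> real \<Rightarrow> real"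
    and N :: nat
    and lo hi :: "nat \<Rightarrow> real"
    and U :: "nat \<Rightarrow> nat \<Rightarrow> 'm pt \<times> real \<Rightarrow> real"
  assumes "0 < T"
    and "open D" "connected D" "D \<noteq> {}" "bounded D" "C1_boundary D"
    and "\<forall>t\<in>{0<..<T}. \<forall>i\<in>Basis. \<forall>j\<in>Basis. a t i j = a t j i"
    and "\<exists>\<nu>0>0. \<forall>t\<in>{0<..<T}. \<forall>\<xi>::'m pt.
           (\<Sum>i\<in>Basis. \<Sum>j\<in>Basis. a t i j * (\<xi> \<bullet> i) * (\<xi> \<bullet> j)) \<ge> \<nu>0 * (norm \<xi>)\<^sup>2"
    and "\<forall>i\<in>Basis. \<forall>j\<in>Basis. smooth_on (\<lambda>t. a t i j) UNIV \<and> bounded (range (\<lambda>t. a t i j))"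
    and "\<forall>i\<in>Basis. smooth_on (\<lambda>t. b t i) UNIV \<and> bounded (range (\<lambda>t. b t i))"
    and "smooth_on c UNIV" "bounded (range c)"
    and "smooth_on_closure f ((D \<times> {\<alpha><..<\<beta>}) \<times> {0<..<T})"
    and "bounded (f ` closure ((D \<times> {\<alpha><..<\<beta>}) \<times> {0<..<T}))"
    and "smooth_on_closure g ((D \<times> {\<alpha><..<\<beta>}) \<times> {0<..<T})"
    and "bounded (g ` closure ((D \<times> {\<alpha><..<\<beta>}) \<times> {0<..<T}))"
    and "smooth_on_closure h0 ((D \<times> {\<alpha><..<\<beta>}) \<times> {0<..<T})"
    and "bounded (h0 ` closure ((D \<times> {\<alpha><..<\<beta>}) \<times> {0<..<T}))"
    and "subdomains N \<alpha> \<beta> lo hi"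
    and "solves_P T a b c f g (D \<times> {\<alpha><..<\<beta>}) u"
    and "bounded (u ` ((D \<times> {\<alpha><..<\<beta>}) \<times> {0<..<T}))"
    and "schwarz_iterates T a b c f g D \<alpha> \<beta> N lo hi p h0 U"
  shows "(\<exists>\<Lambda>::real. \<forall>\<phi>::real \<Rightarrow> real.
            \<phi> C1_differentiable_on UNIV \<longrightarrow> (\<forall>s. \<phi> s > 0) \<longrightarrow>
            - (SUP s. ereal (deriv \<phi> s / \<phi> s)) \<ge> ereal \<Lambda> \<longrightarrow>
            (\<lambda>k. MAX l\<in>{1..N}.
               sup_norm ((D \<times> {lo l<..<hi l}) \<times> {0<..<T})
                 (\<lambda>((X, s), t).
                    (dx (0, 1) (\<lambda>z. U k l z - u z) ((X, s), t) * exp (p * s))\<^sup>2 * \<phi> t))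
            \<longlonglongrightarrow> 0)
         \<and> (\<forall>l\<in>{1..N}. \<forall>z \<in> (D \<times> {lo l<..<hi l}) \<times> {0<..<T}.
              (\<lambda>k. U k l z - u z) \<longlonglongrightarrow> 0)"
proof -
  interpret parabolic_setting D T a b c by unfold_locales (use assms in auto)
  note geo = subdomain_geometry[OF assms(19)]
  obtain R \<gamma> where \<gamma>: "0 \<le> \<gamma>" "\<gamma> < 1" and decay: "\<And>k l z. l \<in> {1..N} \<Longrightarrow> z \<in> (D \<times> {lo l<..<hi l}) \<times> {0<..<T} \<Longrightarrow>
      \<bar>U (Suc k) l z - u z\<bar> \<le> R * \<gamma> ^ k \<and> \<bar>dx e\<^sub>n (\<lambda>z. U (Suc k) l z - u z) z\<bar> \<le> R * \<gamma> ^ k"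
    using schwarz_error_decay[OF assms(13,15,18,19,20,21,22)] by blast
  have pow: "(\<lambda>k. \<gamma> ^ k) \<longlonglongrightarrow> 0" using \<gamma> by (intro LIMSEQ_power_zero) auto
  show ?thesis
  proof (intro conjI exI[of _ 0] allI impI ballI)
    fix l z assume "l \<in> {1..N}" "z \<in> (D \<times> {lo l<..<hi l}) \<times> {0<..<T}"
    then have bound: "\<bar>U (Suc k) l z - u z\<bar> \<le> R * \<gamma> ^ k" for k using decay by blast
    have "(\<lambda>k. R * \<gamma> ^ k) \<longlonglongrightarrow> 0" using tendsto_mult_right_zero[OF pow] by simp
    then have "(\<lambda>k. U (Suc k) l z - u z) \<longlonglongrightarrow> 0"
      by (rule Lim_null_comparison[rotated]) (simp only: real_norm_def bound always_eventually simp_thms)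
    then show "(\<lambda>k. U k l z - u z) \<longlonglongrightarrow> 0" by (rule LIMSEQ_imp_Suc)
  next
    fix \<phi> :: "real \<Rightarrow> real"
    assume C1: "\<phi> C1_differentiable_on UNIV" and pos: "\<forall>s. \<phi> s > 0"
    define err where "err k l = (\<lambda>((X, s), t). (dx (0, 1) (\<lambda>z. U k l z - u z) ((X, s), t) * exp (p * s))\<^sup>2 * \<phi> t)" for k l
    define m where "m k = (MAX l\<in>{1..N}. sup_norm ((D \<times> {lo l<..<hi l}) \<times> {0<..<T}) (err k l))" for k
    have "continuous_on {0..T} \<phi>"
      using C1_differentiable_imp_continuous_on[OF C1] by (rule continuous_on_subset) simp
    then have "bounded (\<phi> ` {0..T})" by (intro compact_imp_bounded compact_continuous_image compact_Icc)
    then obtain \<Phi> where "\<forall>t\<in>{0..T}. \<bar>\<phi> t\<bar> \<le> \<Phi>" by (auto simp: bounded_iff)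
    then have \<Phi>: "\<bar>\<phi> t\<bar> \<le> \<Phi>" if "t \<in> {0..T}" for t using that by blast
    define E where "E = exp (\<bar>p\<bar> * max \<bar>\<alpha>\<bar> \<bar>\<beta>\<bar>)"
    have err: "\<bar>err (Suc k) l z\<bar> \<le> (R * \<gamma> ^ k * E)\<^sup>2 * \<Phi>"
      if l: "l \<in> {1..N}" and z: "z \<in> (D \<times> {lo l<..<hi l}) \<times> {0<..<T}" for k l z
    proof -
      obtain X s t where z': "z = ((X, s), t)" "s \<in> {lo l<..<hi l}" "t \<in> {0<..<T}"
        using z by (cases z) auto
      have "\<bar>s\<bar> \<le> max \<bar>\<alpha>\<bar> \<bar>\<beta>\<bar>" using z'(2) geo(8,9)[OF l] by auto
      then have "\<bar>p * s\<bar> \<le> \<bar>p\<bar> * max \<bar>\<alpha>\<bar> \<bar>\<beta>\<bar>" unfolding abs_mult by (intro mult_left_mono) auto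
      then have "exp (p * s) \<le> E" unfolding E_def by auto
      then have "\<bar>dx e\<^sub>n (\<lambda>z. U (Suc k) l z - u z) z * exp (p * s)\<bar> \<le> R * \<gamma> ^ k * E"
        unfolding abs_mult using decay[OF l z, of k] by (intro mult_mono) auto
      then have "(dx e\<^sub>n (\<lambda>z. U (Suc k) l z - u z) z * exp (p * s))\<^sup>2 \<le> (R * \<gamma> ^ k * E)\<^sup>2"
        by (rule abs_le_square_iff[THEN iffD1, OF order_trans]) simp
      then have "(dx e\<^sub>n (\<lambda>z. U (Suc k) l z - u z) z * exp (p * s))\<^sup>2 * \<bar>\<phi> t\<bar> \<le> (R * \<gamma> ^ k * E)\<^sup>2 * \<Phi>"
        using z'(3) by (intro mult_mono \<Phi>) auto
      then show ?thesis by (simp add: err_def z'(1) abs_mult)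
    qed
    have fin: "finite ((\<lambda>l. sup_norm ((D \<times> {lo l<..<hi l}) \<times> {0<..<T}) (err k l)) ` {1..N})"
      "(\<lambda>l. sup_norm ((D \<times> {lo l<..<hi l}) \<times> {0<..<T}) (err k l)) ` {1..N} \<noteq> {}" for k
      using geo(1) by auto
    have upper: "m (Suc k) \<le> ereal ((R * \<gamma> ^ k * E)\<^sup>2 * \<Phi>)" for k
      unfolding m_def
    proof (subst Max_le_iff[OF fin], intro ballI)
      fix y assume "y \<in> (\<lambda>l. sup_norm ((D \<times> {lo l<..<hi l}) \<times> {0<..<T}) (err (Suc k) l)) ` {1..N}"
      then obtain l where l: "l \<in> {1..N}" "y = sup_norm ((D \<times> {lo l<..<hi l}) \<times> {0<..<T}) (err (Suc k) l)" by auto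
      show "y \<le> ereal ((R * \<gamma> ^ k * E)\<^sup>2 * \<Phi>)"
        unfolding l(2) sup_norm_def by (rule SUP_least) (use err[OF l(1)] in simp)
    qed
    have lower: "0 \<le> m k" for k
    proof -
      obtain X where "X \<in> D" using assms(4) by blast
      then have z: "((X, (lo 1 + hi 1) / 2), T / 2) \<in> (D \<times> {lo 1<..<hi 1}) \<times> {0<..<T}" (is "?z \<in> _")
        using geo(7)[of 1] geo(1) T by auto
      have "0 \<le> ereal \<bar>err k 1 ?z\<bar>" by simp
      also have "\<dots> \<le> sup_norm ((D \<times> {lo 1<..<hi 1}) \<times> {0<..<T}) (err k 1)"
        unfolding sup_norm_def by (rule SUP_upper[OF z])
      also have "\<dots> \<le> m k" unfolding m_def using geo(1) by (intro Max_ge fin imageI) auto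
      finally show ?thesis .
    qed
    have "(\<lambda>k. (R * \<gamma> ^ k * E)\<^sup>2 * \<Phi>) \<longlonglongrightarrow> (R * 0 * E)\<^sup>2 * \<Phi>"
      by (intro tendsto_intros pow)
    then have "(\<lambda>k. ereal ((R * \<gamma> ^ k * E)\<^sup>2 * \<Phi>)) \<longlonglongrightarrow> 0" by (simp add: zero_ereal_def)
    then have "(\<lambda>k. m (Suc k)) \<longlonglongrightarrow> 0"
      by (rule tendsto_sandwich[OF _ _ tendsto_const, rotated 2]) (use lower upper in auto)
    then have "m \<longlonglongrightarrow> 0" by (rule LIMSEQ_imp_Suc)
    then show "(\<lambda>k. MAX l\<in>{1..N}. sup_norm ((D \<times> {lo l<..<hi l}) \<times> {0<..<T})
        (\<lambda>((X, s), t). (dx (0, 1) (\<lambda>z. U k l z - u z) ((X, s), t) * exp (p * s))\<^sup>2 * \<phi> t)) \<longlonglongrightarrow> 0"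
      unfolding m_def err_def .
  qed
qed

end
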